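(* Let $0\le\delta\le1$ and suppose that the measurable functional $\Gamma:\Lambda\to\mathbb R$ is bounded. Then the martingale problem related to $\mathcal Lf=L^\delta f+\Gamma f'$ with respect to $\mathcal D_{L^\delta}(\mathbb R_+)$ admits uniqueness, i.e. for every initial condition $x_0\ge 0$ any two solutions $(X^i,\mathbb P^i)$, $i=1,2$, have the same law.
   Context: $T>0$ is fixed, $\mathbb R_+=[0,\infty)$, $\mathbb R_-=(-\infty,0]$. For $\eta\in C([0,T])$ and $t\in[0,T]$, $\eta^t$ is the stopped path $\eta^t_s=\eta_{s\wedge t}$; $\Lambda=\{(s,\eta^s): s\in[0,T],\ \eta\in C([0,T])\}$, and $\Gamma$ is extended by $\Gamma(t,\eta):=\Gamma(t,\eta^t)$. Domain and operator. For $0\le\delta<1$, $\mathcal D_{L^\delta}$ is the set of continuous $f:\mathbb R\to\mathbb R$ whose restrictions to $\mathbb R_+$ and to $\mathbb R_-$ are of class $C^2$ and such that (a) there is a continuous $g:\mathbb R\to\mathbb R$ extending $x\mapsto f'(x)|x|^{\delta-1}$, $x\neq0$; (b) there is a continuous $G:\mathbb R\to\mathbb R$ extending $x\mapsto g'(x)|x|^{1-\delta}$, $x\ne0$. One sets $L^\delta f:=G/2$; thus $L^\delta f(x)=\frac{f''(x)}2+\frac{(\delta-1)f'(x)}{2x}$ for $x\neq0$. (Such $f$ are $C^1$ with $f'(0)=0$.) For $\delta=1$, $\mathcal D_{L^1}=\{f\in C^2(\mathbb R):f'(0)=0\}$ and $L^1f=\frac{f''}2$. In all cases $\mathcal D_{L^\delta}(\mathbb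 R_+)$ is the set of restrictions to $\mathbb R_+$ of functions $\hat f\in\mathcal D_{L^\delta}$, and for such a restriction $f$, $L^\delta f$ is the restriction of $L^\delta\hat f$ to $\mathbb R_+$. Martingale problem: a couple $(X,\mathbb P)$, $X$ a continuous $\mathbb R_+$-valued process on $[0,T]$ with $X_0=x_0$, solves the martingale problem related to $\mathcal L$ with respect to $\mathcal D_{L^\delta}(\mathbb R_+)$ if for every $f\in\mathcal D_{L^\delta}(\mathbb R_+)$ the process $f(X_t)-f(x_0)-\int_0^tL^\delta f(X_s)ds-\int_0^tf'(X_s)\Gamma(s,X^s)ds$ is a $\mathbb P$-local martingale (with respect to the canonical filtration of $X$). *)

theory Defs
  imports "HOL-Probability.Probability"
begin

section \<open>The space of continuous paths and the set of stopped paths\<close>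

definition borel_of :: "'a topology \<Rightarrow> 'a measure" where
  "borel_of X = sigma (topspace X) {U. openin X U}"

text \<open>The space of real continuous functions on the interval from 0 to T with the uniform metric;
  its elements are the functions on that interval, i.e. they are extensional.\<close>

definition path_metric :: "real \<Rightarrow> (real \<Rightarrow> real) metric" where
  "path_metric T = cfunspace (top_of_set {0..T}) euclidean_metric"

definition path_borel :: "real \<Rightarrow> (real \<Rightarrow> real) measure" where
  "path_borel T = borel_of (mtopology_of (path_metric T))"

definition stopped_path :: "real \<Rightarrow> real \<Rightarrow> (real \<Rightarrow> real) \<Rightarrow> (real \<Rightarrow> real)" where
  "stopped_path T t \<eta> = (\<lambda>s\<in>{0..T}. \<eta> (min s t))"

definition stopped_paths :: "real \<Rightarrow> (real \<times> (real \<Rightarrow> real)) set" where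
  "stopped_paths T = {(s, stopped_path T s \<eta>) |s \<eta>. s \<in> {0..T} \<and> \<eta> \<in> mspace (path_metric T)}"

text \<open>The set of stopped paths carries the topology induced by the product topology.\<close>

definition stopped_paths_borel :: "real \<Rightarrow> (real \<times> (real \<Rightarrow> real)) measure" where
  "stopped_paths_borel T = borel_of
     (subtopology (prod_topology (top_of_set {0..T}) (mtopology_of (path_metric T))) (stopped_paths T))"

text \<open>Extension of a functional from stopped paths to arbitrary paths.\<close>

definition extend_functional ::
    "real \<Rightarrow> (real \<times> (real \<Rightarrow> real) \<Rightarrow> real) \<Rightarrow> real \<Rightarrow> (real \<Rightarrow> real) \<Rightarrow> real" where
  "extend_functional T \<Gamma> t \<eta> = \<Gamma> (t, stopped_path T t \<eta>)"

section \<open>The operator and its domain\<close>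

text \<open>Class C2 on a set; derivatives are relative to the set, hence one-sided at endpoints.\<close>

definition C2_on :: "real set \<Rightarrow> (real \<Rightarrow> real) \<Rightarrow> bool" where
  "C2_on S f \<longleftrightarrow> (\<exists>f' f''. (\<forall>x\<in>S. (f has_real_derivative f' x) (at x within S) \<and>
                                   (f' has_real_derivative f'' x) (at x within S)) \<and>
                          continuous_on S f'')"

definition bessel_extensions :: "real \<Rightarrow> (real \<Rightarrow> real) \<Rightarrow> (real \<Rightarrow> real) \<Rightarrow> (real \<Rightarrow> real) \<Rightarrow> bool" where
  "bessel_extensions \<delta> f g G \<longleftrightarrow>
     continuous_on UNIV g \<and> (\<forall>x. x \<noteq> 0 \<longrightarrow> g x = deriv f x * \<bar>x\<bar> powr (\<delta> - 1)) \<and>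
     continuous_on UNIV G \<and> (\<forall>x. x \<noteq> 0 \<longrightarrow> G x = deriv g x * \<bar>x\<bar> powr (1 - \<delta>))"

definition bessel_domain :: "real \<Rightarrow> (real \<Rightarrow> real) set" where
  "bessel_domain \<delta> =
     (if \<delta> = 1 then {f. C2_on UNIV f \<and> deriv f 0 = 0}
      else {f. continuous_on UNIV f \<and> C2_on {0..} f \<and> C2_on {..0} f \<and>
               (\<exists>g G. bessel_extensions \<delta> f g G)})"

definition bessel_op :: "real \<Rightarrow> (real \<Rightarrow> real) \<Rightarrow> real \<Rightarrow> real" where
  "bessel_op \<delta> f =
     (if \<delta> = 1 then (\<lambda>x. deriv (deriv f) x / 2)
      else (\<lambda>x. (THE G. \<exists>g. bessel_extensions \<delta> f g G) x / 2))"

definition bessel_domain_nonneg :: "real \<Rightarrow> (real \<Rightarrow> real) set" where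
  "bessel_domain_nonneg \<delta> = (\<lambda>f. restrict f {0..}) ` bessel_domain \<delta>"

text \<open>The choice of the extension to the whole line is immaterial, see
  \<open>bessel_op_nonneg_restrict\<close> below.\<close>

definition bessel_op_nonneg :: "real \<Rightarrow> (real \<Rightarrow> real) \<Rightarrow> real \<Rightarrow> real" where
  "bessel_op_nonneg \<delta> f =
     restrict (bessel_op \<delta> (SOME h. h \<in> bessel_domain \<delta> \<and> restrict h {0..} = f)) {0..}"

lemma continuous_eq_off_0:
  fixes u v :: "real \<Rightarrow> real"
  assumes "continuous_on UNIV u" "continuous_on UNIV v" "\<And>x. 0 < x \<Longrightarrow> u x = v x" "0 \<le> x"
  shows "u x = v x"
proof -
  have "closed {x. u x = v x}"
    using assms by (intro closed_Collect_eq)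
  then have "closure {0<..} \<subseteq> {x. u x = v x}"
    using assms by (intro closure_minimal) auto
  then show ?thesis using assms(4) by auto
qed

lemma deriv_eq_pos:
  fixes u v :: "real \<Rightarrow> real"
  assumes "\<And>x. 0 < x \<Longrightarrow> u x = v x" "0 < x"
  shows "deriv u x = deriv v x"
proof (rule deriv_cong_ev)
  show "eventually (\<lambda>y. u y = v y) (nhds x)"
    using eventually_nhds_in_open[of "{0<..}" x] assms by (auto elim!: eventually_mono)
qed simp

lemma bessel_extensions_eq_nonneg:
  assumes "bessel_extensions \<delta> f g G" "bessel_extensions \<delta> f' g' G'"
    and "\<And>x. 0 < x \<Longrightarrow> f x = f' x" "0 \<le> x"
  shows "G x = G' x"
proof -
  have "g x = g' x" if "0 < x" for x
    using assms(1,2) deriv_eq_pos[of f f' x] assms(3) that by (auto simp: bessel_extensions_def)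
  then have "G x = G' x" if "0 < x" for x
    using assms(1,2) deriv_eq_pos[of g g' x] that by (auto simp: bessel_extensions_def)
  then show ?thesis
    using continuous_eq_off_0[of G G' x] assms by (auto simp: bessel_extensions_def)
qed

lemma bessel_extensions_unique:
  assumes "bessel_extensions \<delta> f g G" "bessel_extensions \<delta> f g' G'"
  shows "g = g'" "G = G'"
proof -
  have ext: "u = v" if "continuous_on UNIV u" "continuous_on UNIV v" "\<And>x. x \<noteq> 0 \<Longrightarrow> u x = v x"
    for u v :: "real \<Rightarrow> real"
  proof
    show "u x = v x" for x
      using continuous_eq_off_0[of u v 0] that by (cases "x = 0") auto
  qed
  show "g = g'"
    using assms by (intro ext) (auto simp: bessel_extensions_def)
  then show "G = G'"
    using assms by (intro ext) (auto simp: bessel_extensions_def)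
qed

lemma bessel_op_eq:
  assumes "bessel_extensions \<delta> f g G" "\<delta> \<noteq> 1"
  shows "bessel_op \<delta> f x = G x / 2"
proof -
  have "(THE G. \<exists>g. bessel_extensions \<delta> f g G) = G"
    using assms bessel_extensions_unique by (intro the_equality) blast+
  then show ?thesis using assms by (simp add: bessel_op_def)
qed

lemma bessel_op_cong_nonneg:
  assumes "f \<in> bessel_domain \<delta>" "h \<in> bessel_domain \<delta>"
    and eq: "\<And>x. 0 \<le> x \<Longrightarrow> f x = h x" and "0 \<le> x"
  shows "bessel_op \<delta> f x = bessel_op \<delta> h x"
proof (cases "\<delta> = 1")
  case True
  have cont: "continuous_on UNIV (deriv (deriv u))" if u: "u \<in> bessel_domain \<delta>" for u
  proof -
    obtain u' u'' where d: "\<And>x. (u has_real_derivative u' x) (at x)"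
        "\<And>x. (u' has_real_derivative u'' x) (at x)" "continuous_on UNIV u''"
      using u True by (auto simp: bessel_domain_def C2_on_def)
    then have "deriv u = u'" "deriv u' = u''" by (auto intro!: ext DERIV_imp_deriv)
    with d show ?thesis by simp
  qed
  have "deriv (deriv f) y = deriv (deriv h) y" if "0 < y" for y
    by (intro deriv_eq_pos) (use that eq in auto)
  then have "deriv (deriv f) x = deriv (deriv h) x"
    using continuous_eq_off_0[OF cont cont] assms by blast
  then show ?thesis using True by (simp add: bessel_op_def)
next
  case False
  then obtain g G g' G' where e: "bessel_extensions \<delta> f g G" "bessel_extensions \<delta> h g' G'"
    using assms(1,2) by (auto simp: bessel_domain_def)
  then have "G x = G' x"
    using bessel_extensions_eq_nonneg[OF e] eq \<open>0 \<le> x\<close> by simp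
  then show ?thesis
    by (simp add: bessel_op_eq[OF e(1) False] bessel_op_eq[OF e(2) False])
qed

lemma bessel_op_nonneg_restrict:
  assumes "f \<in> bessel_domain \<delta>"
  shows "bessel_op_nonneg \<delta> (restrict f {0..}) = restrict (bessel_op \<delta> f) {0..}"
proof -
  define h where "h = (SOME h. h \<in> bessel_domain \<delta> \<and> restrict h {0..} = restrict f {0..})"
  have h: "h \<in> bessel_domain \<delta> \<and> restrict h {0..} = restrict f {0..}"
    unfolding h_def by (rule someI[of _ f]) (use assms in simp)
  have "h x = f x" if "0 \<le> x" for x
    using fun_cong[OF conjunct2[OF h], of x] that by simp
  then have "bessel_op \<delta> h x = bessel_op \<delta> f x" if "0 \<le> x" for x
    using bessel_op_cong_nonneg[of h \<delta> f x] h assms that by blast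
  then show ?thesis
    unfolding bessel_op_nonneg_def h_def[symmetric] by (auto simp: restrict_def)
qed

section \<open>Local martingales on a bounded time interval\<close>

text \<open>The canonical (raw) filtration of a process indexed by the times between 0 and T, extended
  constantly beyond T in order to be indexed by all real numbers.\<close>

definition canonical_filtration :: "real \<Rightarrow> 'a measure \<Rightarrow> (real \<Rightarrow> 'a \<Rightarrow> real) \<Rightarrow> real \<Rightarrow> 'a measure" where
  "canonical_filtration T P X t =
     sigma (space P) {X s -` A \<inter> space P |s A. s \<in> {0..min t T} \<and> A \<in> sets borel}"

definition martingale_on :: "real \<Rightarrow> 'a measure \<Rightarrow> (real \<Rightarrow> 'a measure) \<Rightarrow> (real \<Rightarrow> 'a \<Rightarrow> real) \<Rightarrow> bool" where
  "martingale_on T P F M \<longleftrightarrow>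
     (\<forall>t\<in>{0..T}. M t \<in> borel_measurable (F t) \<and> integrable P (M t)) \<and>
     (\<forall>s t. 0 \<le> s \<and> s \<le> t \<and> t \<le> T \<longrightarrow> (AE \<omega> in P. real_cond_exp P (F s) (M t) \<omega> = M s \<omega>))"

text \<open>On the closed interval, localization means that almost surely the stopping times eventually
  reach T (and not merely that they converge to T). As nothing happens after T, real-valued
  stopping times suffice: any value above T plays the role of infinity.\<close>

definition local_martingale_on :: "real \<Rightarrow> 'a measure \<Rightarrow> (real \<Rightarrow> 'a measure) \<Rightarrow> (real \<Rightarrow> 'a \<Rightarrow> real) \<Rightarrow> bool" where
  "local_martingale_on T P F M \<longleftrightarrow>
     (\<exists>\<tau> :: nat \<Rightarrow> 'a \<Rightarrow> real.
        (\<forall>n. stopping_time F (\<tau> n) \<and> (\<forall>\<omega>\<in>space P. 0 \<le> \<tau> n \<omega>)) \<and>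
        (AE \<omega> in P. incseq (\<lambda>n. \<tau> n \<omega>) \<and> (\<exists>n. T \<le> \<tau> n \<omega>)) \<and>
        (\<forall>n. martingale_on T P F (\<lambda>t \<omega>. M (min t (\<tau> n \<omega>)) \<omega>)))"

section \<open>The martingale problem\<close>

definition sample_path :: "real \<Rightarrow> (real \<Rightarrow> 'a \<Rightarrow> real) \<Rightarrow> 'a \<Rightarrow> (real \<Rightarrow> real)" where
  "sample_path T X \<omega> = (\<lambda>t\<in>{0..T}. X t \<omega>)"

definition path_law :: "real \<Rightarrow> 'a measure \<Rightarrow> (real \<Rightarrow> 'a \<Rightarrow> real) \<Rightarrow> (real \<Rightarrow> real) measure" where
  "path_law T P X = distr P (path_borel T) (sample_path T X)"

definition mp_process ::
    "real \<Rightarrow> real \<Rightarrow> (real \<times> (real \<Rightarrow> real) \<Rightarrow> real) \<Rightarrow> real \<Rightarrow> (real \<Rightarrow> 'a \<Rightarrow> real) \<Rightarrow> (real \<Rightarrow> real) \<Rightarrow>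
     real \<Rightarrow> 'a \<Rightarrow> real" where
  "mp_process T \<delta> \<Gamma> x0 X f t \<omega> =
     f (X t \<omega>) - f x0
     - (LBINT s:{0..t}. bessel_op_nonneg \<delta> f (X s \<omega>))
     - (LBINT s:{0..t}. vector_derivative f (at (X s \<omega>) within {0..}) *
                        extend_functional T \<Gamma> s (sample_path T X \<omega>))"

definition solves_martingale_problem ::
    "real \<Rightarrow> real \<Rightarrow> (real \<times> (real \<Rightarrow> real) \<Rightarrow> real) \<Rightarrow> real \<Rightarrow> 'a measure \<Rightarrow> (real \<Rightarrow> 'a \<Rightarrow> real) \<Rightarrow> bool" where
  "solves_martingale_problem T \<delta> \<Gamma> x0 P X \<longleftrightarrow>
     prob_space P \<and>
     (\<forall>t\<in>{0..T}. X t \<in> borel_measurable P) \<and>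
     (\<forall>\<omega>\<in>space P. continuous_on {0..T} (\<lambda>t. X t \<omega>) \<and> (\<forall>t\<in>{0..T}. 0 \<le> X t \<omega>)) \<and>
     (AE \<omega> in P. X 0 \<omega> = x0) \<and>
     (\<forall>f\<in>bessel_domain_nonneg \<delta>.
        local_martingale_on T P (canonical_filtration T P X) (mp_process T \<delta> \<Gamma> x0 X f))"

end

theory Submission
  imports Defs
begin

text \<open>The Gaussians \<open>exp (- l x\<^sup>2)\<close> lie in the domain, and without drift the expectation of a product of
  such functions of \<open>X\<close> at several times is an explicit Gaussian. Hence every cylinder functional \<open>\<Phi>\<close> is
  the terminal value of an explicit process \<open>v\<close> which satisfies \<open>dv = w (dW + \<Gamma> dt)\<close> under any solution,
  and this can be read off from the martingale problem without any stochastic integration.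
  Taking expectations of \<open>v\<close> and \<open>v\<^sup>2\<close> gives \<open>E \<Phi> = E v\<^sub>t + \<integral> E (w \<Gamma>) ds\<close> over the time interval from \<open>t\<close> to
  \<open>q\<close> and, if \<open>q - t\<close> is small, the energy estimate \<open>\<integral> E w\<^sup>2 ds \<le> 4 E \<Phi>\<^sup>2\<close>.

  Let two solutions agree up to time \<open>t\<close>, and suppose that the difference of their expectations satisfies
  \<open>(\<Delta> \<Phi>)\<^sup>2 \<le> k (E\<^sub>1 \<Phi>\<^sup>2 + E\<^sub>2 \<Phi>\<^sup>2)\<close> for functionals \<open>\<Phi>\<close> of the path up to time \<open>q\<close>. Applying this bound to
  \<open>w \<Gamma>\<close>, the energy estimate improves \<open>k\<close> to \<open>k / 2\<close>, first for cylinder functionals and then by density.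
  Therefore \<open>\<Delta> = 0\<close> up to time \<open>q\<close>, and finitely many such steps reach the time \<open>T\<close>.\<close>

section \<open>Measurability on the space of paths\<close>

text \<open>The classical route removes a bounded drift by a change of measure, for which a Brownian
  motion must be extracted from the solution; here this is delicate, as the identity is not in the
  domain and the operator is singular at the origin. The perturbation argument stays in
  \<open>L^2\<close> instead. Three obstacles shape it. \<Gamma> depends on the whole past, so
  \<open>w \<Gamma>\<close> is in general no cylinder functional: the bound on \<Delta> is assumed
  for all bounded functionals of the path up to \<open>q\<close>, and its improvement for cylinder
  functionals must be extended by approximation. \<Gamma> is merely measurable in time, so Gaussians
  with moving parameters cannot be inserted by a classical chain rule. Cylinder functionals see only
  squares of path values; these determine the path because \<open>X\<close> is nonnegative.
  Gaussians are suitable since they are bounded and stable under products and under the driftless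
  evolution. The iteration starts from \<open>k = 2\<close>, by Cauchy-Schwarz. In the smallness
  condition \<open>32 C^2 (q - t) \<le> 1\<close>, a factor 4 comes from the energy estimate; the
  remaining 8 pays for a factor 4 lost in the approximation and for the halving.\<close>

lemma mspace_path_metric:
  "mspace (path_metric T) = {f \<in> extensional {0..T}. continuous_on {0..T} f}"
proof -
  \<comment> \<open>Elements of \<open>cfunspace\<close> have to be bounded, which is automatic on a
    compact interval.\<close>
  have "Met_TC.mbounded (f ` {0..T})" if "continuous_on {0..T} f" for f :: "real \<Rightarrow> real"
  proof -
    have "bounded (f ` {0..T})"
      using that by (intro compact_imp_bounded compact_continuous_image) auto
    then show ?thesis by simp
  qed
  then show ?thesis
    by (auto simp: path_metric_def)
qed

lemma mdist_path_le:
  assumes "0 \<le> T" "f \<in> mspace (path_metric T)" "g \<in> mspace (path_metric T)"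
  shows "mdist (path_metric T) f g \<le> a \<longleftrightarrow> (\<forall>x\<in>{0..T}. \<bar>f x - g x\<bar> \<le> a)"
  using cfunspace_mdist_le[of f "top_of_set {0..T}" euclidean_metric g a] assms
  by (auto simp: path_metric_def dist_real_def)

section \<open>Separability of path space and its Borel sigma-algebra\<close>

text \<open>Polynomials with rational coefficients. The coefficients form a list because lists of
  rationals are a countable type; entries beyond the length are unspecified, which affects neither
  countability nor density.\<close>

definition rational_paths :: "real \<Rightarrow> (real \<Rightarrow> real) set" where
  "rational_paths T = range (\<lambda>(q, n). \<lambda>s\<in>{0..T}. \<Sum>i\<le>n. of_rat (q ! i) * s ^ i)"

lemma countable_rational_paths: "countable (rational_paths T)"
  unfolding rational_paths_def by (rule countable_image) auto

lemma rational_paths_subset: "rational_paths T \<subseteq> mspace (path_metric T)"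
proof -
  have "continuous_on {0..T} (\<lambda>s\<in>{0..T}. \<Sum>i\<le>n. real_of_rat (q ! i) * s ^ i)" for q and n :: nat
  proof -
    have "continuous_on {0..T} (\<lambda>s. \<Sum>i\<le>n. real_of_rat (q ! i) * s ^ i)"
      by (intro continuous_intros)
    then show ?thesis by (rule continuous_on_eq) auto
  qed
  then show ?thesis
    unfolding mspace_path_metric rational_paths_def by auto
qed

lemma rational_paths_dense:
  assumes "0 \<le> T" "\<eta> \<in> mspace (path_metric T)" "0 < e"
  shows "\<exists>d\<in>rational_paths T. mdist (path_metric T) d \<eta> < e"
proof -
  have "continuous_on {0..T} \<eta>" using assms by (simp add: mspace_path_metric)
  then obtain p where p: "real_polynomial_function p" "\<And>x. x \<in> {0..T} \<Longrightarrow> \<bar>\<eta> x - p x\<bar> < e/4"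
    using Stone_Weierstrass_real_polynomial_function[of "{0..T}" \<eta> "e/4"] assms by auto
  obtain a n where a: "p = (\<lambda>x. \<Sum>i\<le>n. a i * x^i)"
    using p(1) real_polynomial_function_iff_sum by blast
  \<comment> \<open>\<open>M\<close> dominates the sum of \<open>\<bar>x\<bar> ^ i\<close> over
    \<open>i \<le> n\<close> on the interval, so changing each coefficient by less than
    \<open>e / (4 * M)\<close> moves the polynomial by at most \<open>e / 4\<close>.\<close>
  define M where "M = real (Suc n) * (max 1 T) ^ n"
  have M: "0 < M" by (simp add: M_def)
  have "\<exists>q. \<bar>a i - of_rat q\<bar> < e / (4 * M)" for i
  proof -
    have "a i < a i + e/(4*M)" using M assms by simp
    then obtain q where "a i < of_rat q" "of_rat q < a i + e/(4*M)"
      using of_rat_dense by blast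
    then show ?thesis by (intro exI[of _ q]) auto
  qed
  then obtain q where q: "\<And>i. \<bar>a i - of_rat (q i)\<bar> < e / (4 * M)" by metis
  define d where "d = (\<lambda>s\<in>{0..T}. \<Sum>i\<le>n. real_of_rat (map q [0..<Suc n] ! i) * s ^ i)"
  have d: "d \<in> rational_paths T"
    unfolding d_def rational_paths_def by (rule range_eqI[of _ _ "(map q [0..<Suc n], n)"]) simp
  have "\<bar>d x - \<eta> x\<bar> \<le> e/2" if x: "x \<in> {0..T}" for x
  proof -
    have "d x = (\<Sum>i\<le>n. real_of_rat (q i) * x ^ i)"
      unfolding d_def using x by (auto intro!: sum.cong simp del: upt_Suc)
    then have "d x - p x = (\<Sum>i\<le>n. (of_rat (q i) - a i) * x ^ i)"
      by (simp add: a sum_subtractf algebra_simps)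
    also have "\<bar>\<dots>\<bar> \<le> (\<Sum>i\<le>n. \<bar>(of_rat (q i) - a i) * x ^ i\<bar>)" by (rule sum_abs)
    also have "\<dots> \<le> (\<Sum>i\<le>n. e/(4*M) * (max 1 T) ^ n)"
    proof (rule sum_mono)
      fix i assume i: "i \<in> {..n}"
      have "\<bar>x ^ i\<bar> \<le> (max 1 T) ^ i"
        using x by (auto simp: power_abs intro!: power_mono)
      also have "\<dots> \<le> (max 1 T) ^ n" using i by (intro power_increasing) auto
      finally show "\<bar>(of_rat (q i) - a i) * x ^ i\<bar> \<le> e/(4*M) * (max 1 T) ^ n"
        unfolding abs_mult using q[of i] M assms
        by (intro mult_mono) (auto simp: abs_minus_commute)
    qed
    also have "\<dots> = e/(4*M) * M"
    proof -
      have "(\<Sum>i\<le>n. K * m) = K * (real (Suc n) * m)" for K m :: real by simp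
      then show ?thesis by (simp only: M_def)
    qed
    also have "\<dots> = e/4" using M by simp
    finally show ?thesis using p(2)[OF x] by linarith
  qed
  then have "mdist (path_metric T) d \<eta> \<le> e/2"
    using mdist_path_le[OF assms(1) subsetD[OF rational_paths_subset d] assms(2)] by blast
  then show ?thesis using d assms by (intro bexI[of _ d]) auto
qed

lemma space_path_borel: "space (path_borel T) = mspace (path_metric T)"
  and sets_path_borel: "sets (path_borel T) =
    sigma_sets (mspace (path_metric T)) {U. openin (mtopology_of (path_metric T)) U}"
proof -
  have "{U. openin (mtopology_of (path_metric T)) U} \<subseteq> Pow (mspace (path_metric T))"
    using openin_subset[of "mtopology_of (path_metric T)"] by auto
  then show "space (path_borel T) = mspace (path_metric T)" "sets (path_borel T) =
    sigma_sets (mspace (path_metric T)) {U. openin (mtopology_of (path_metric T)) U}"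
    by (simp_all add: path_borel_def borel_of_def space_measure_of sets_measure_of)
qed

text \<open>Second countability in the form used below: every open set is a union of balls from one
  countable family. A radius below \<open>r / 2\<close> leaves room for the triangle
  inequality.\<close>

lemma countable_ball_cover:
  assumes "0 \<le> T" "openin (mtopology_of (path_metric T)) U" "\<eta> \<in> U"
  shows "\<exists>d\<in>rational_paths T. \<exists>n. mdist (path_metric T) d \<eta> < 1 / Suc n \<and>
    mball_of (path_metric T) d (1 / Suc n) \<subseteq> U"
proof -
  interpret Metric_space "mspace (path_metric T)" "mdist (path_metric T)" by simp
  obtain r where r: "r > 0" "mball \<eta> r \<subseteq> U" and \<eta>: "\<eta> \<in> mspace (path_metric T)"
    using assms(2,3) unfolding mtopology_of_def openin_mtopology by blast
  obtain n where n: "1 / Suc n < r/2"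
    using r(1) nat_approx_posE[of "r/2"] by auto
  obtain d where d: "d \<in> rational_paths T" "mdist (path_metric T) d \<eta> < 1 / Suc n"
    using rational_paths_dense[OF assms(1) \<eta>, of "1 / Suc n"] by auto
  have "mball d (1 / Suc n) \<subseteq> mball \<eta> r"
  proof
    fix x assume x: "x \<in> mball d (1 / Suc n)"
    then have "mdist (path_metric T) \<eta> x \<le> mdist (path_metric T) d \<eta> + mdist (path_metric T) d x"
      using triangle[of \<eta> d x] \<eta> by (simp add: commute)
    then show "x \<in> mball \<eta> r" using x d n \<eta> by (simp add: in_mball)
  qed
  then show ?thesis using d r by (auto simp: mball_of_def)
qed

lemma openin_mball_of: "openin (mtopology_of m) (mball_of m x r)"
  by (simp add: Metric_space.openin_mball mball_of_def mtopology_of_def)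

lemma rational_dense_Icc:
  fixes T :: real
  assumes "0 < T"
  shows "{0..T} \<subseteq> closure ({0..T} \<inter> \<rat>)"
proof
  fix x assume x: "x \<in> {0..T}"
  show "x \<in> closure ({0..T} \<inter> \<rat>)"
    unfolding closure_approachable
  proof (intro allI impI)
    fix e :: real assume "0 < e"
    then have "max 0 (x - e) < min T (x + e)" using x assms by auto
    then obtain q where "q \<in> \<rat>" "max 0 (x - e) < q" "q < min T (x + e)"
      using Rats_dense_in_real by blast
    then show "\<exists>y\<in>{0..T} \<inter> \<rat>. dist y x < e"
      by (intro bexI[of _ q]) (auto simp: dist_real_def)
  qed
qed

text \<open>By separability every open set is a countable union of balls, and the distance to a
  fixed centre is a supremum over rational times. Hence the evaluations generate the Borel sets of
  the uniform metric.\<close>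

lemma measurable_path_borel:
  assumes "0 \<le> T" and sp: "\<And>x. x \<in> space M \<Longrightarrow> \<Psi> x \<in> mspace (path_metric T)"
    and ev: "\<And>u. u \<in> {0..T} \<Longrightarrow> (\<lambda>x. \<Psi> x u) \<in> borel_measurable M"
  shows "\<Psi> \<in> measurable M (path_borel T)"
  unfolding path_borel_def borel_of_def
proof (rule measurable_measure_of)
  interpret Metric_space "mspace (path_metric T)" "mdist (path_metric T)" by simp
  let ?D = "rational_paths T"
  show "{U. openin (mtopology_of (path_metric T)) U} \<subseteq> Pow (topspace (mtopology_of (path_metric T)))"
    using openin_subset[of "mtopology_of (path_metric T)"] by auto
  show "\<Psi> \<in> space M \<rightarrow> topspace (mtopology_of (path_metric T))"
    using sp by auto
  have ball: "\<Psi> -` mball_of (path_metric T) d r \<inter> space M \<in> sets M" if d: "d \<in> ?D" for d r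
  proof -
    have d': "d \<in> mspace (path_metric T)" using d rational_paths_subset by auto
    \<comment> \<open>A strict bound on a supremum cannot be tested pointwise. It is a countable
      union of non-strict bounds, and by continuity these can be tested at rational times.\<close>
    have "mdist (path_metric T) d (\<Psi> x) < r \<longleftrightarrow> (\<exists>k. \<forall>u\<in>{0..T} \<inter> \<rat>. \<bar>d u - \<Psi> x u\<bar> \<le> r - 1 / Suc k)"
      if x: "x \<in> space M" for x
    proof -
      have "mdist (path_metric T) d (\<Psi> x) < r \<longleftrightarrow> (\<exists>k. mdist (path_metric T) d (\<Psi> x) \<le> r - 1 / Suc k)"
      proof
        assume "mdist (path_metric T) d (\<Psi> x) < r"
        then obtain k where "1 / Suc k < r - mdist (path_metric T) d (\<Psi> x)"
          using nat_approx_posE[of "r - mdist (path_metric T) d (\<Psi> x)"] by auto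
        then show "\<exists>k. mdist (path_metric T) d (\<Psi> x) \<le> r - 1 / Suc k" by (intro exI[of _ k]) linarith
      next
        assume "\<exists>k. mdist (path_metric T) d (\<Psi> x) \<le> r - 1 / Suc k"
        then obtain k where k: "mdist (path_metric T) d (\<Psi> x) \<le> r - 1 / Suc k" ..
        have "0 < 1 / real (Suc k)" by simp
        then show "mdist (path_metric T) d (\<Psi> x) < r" using k by linarith
      qed
      also have "\<dots> \<longleftrightarrow> (\<exists>k. \<forall>u\<in>{0..T}. \<bar>d u - \<Psi> x u\<bar> \<le> r - 1 / Suc k)"
        using mdist_path_le[OF assms(1) d' sp[OF x]] by simp
      also have "\<dots> \<longleftrightarrow> (\<exists>k. \<forall>u\<in>{0..T} \<inter> \<rat>. \<bar>d u - \<Psi> x u\<bar> \<le> r - 1 / Suc k)"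
      proof (intro ex_cong1 iffI)
        fix k assume H: "\<forall>u\<in>{0..T} \<inter> \<rat>. \<bar>d u - \<Psi> x u\<bar> \<le> r - 1 / Suc k"
        show "\<forall>u\<in>{0..T}. \<bar>d u - \<Psi> x u\<bar> \<le> r - 1 / Suc k"
        \<comment> \<open>For \<open>T = 0\<close> the interval is a single rational point; density
          of the rationals inside it is available only for \<open>0 < T\<close>.\<close>
        proof (cases "T = 0")
          case True
          then show ?thesis using H by auto
        next
          case False
          then have "0 < T" using assms by simp
          then have "{0..T} \<subseteq> closure ({0..T} \<inter> \<rat>)"
            using rational_dense_Icc by blast
          moreover have "closure ({0..T} \<inter> \<rat>) \<subseteq> {0..T}"
            by (intro closure_minimal) auto
          ultimately have cl: "closure ({0..T} \<inter> \<rat>) = {0..T}" by blast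
          have c: "continuous_on {0..T} (\<lambda>u. \<bar>d u - \<Psi> x u\<bar>)"
            using d' sp[OF x] by (auto simp: mspace_path_metric intro!: continuous_intros)
          show ?thesis
          proof
            fix u assume "u \<in> {0..T}"
            then show "\<bar>d u - \<Psi> x u\<bar> \<le> r - 1 / Suc k"
              using continuous_le_on_closure[of "{0..T} \<inter> \<rat>" "\<lambda>u. \<bar>d u - \<Psi> x u\<bar>" u] c H cl by auto
          qed
        qed
      qed auto
      finally show ?thesis .
    qed
    then have ball_iff: "mdist (path_metric T) d (\<Psi> x) < r \<longleftrightarrow>
       (\<exists>k. \<forall>u\<in>{0..T} \<inter> \<rat>. \<bar>d u - \<Psi> x u\<bar> \<le> r - 1 / Suc k)" if "x \<in> space M" for x
      using that by blast
    have "\<Psi> -` mball_of (path_metric T) d r \<inter> space M = {x \<in> space M. mdist (path_metric T) d (\<Psi> x) < r}"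
      using sp d' by (auto simp: mball_of_def)
    also have "\<dots> =
       {x \<in> space M. \<exists>k. \<forall>u\<in>{0..T} \<inter> \<rat>. \<bar>d u - \<Psi> x u\<bar> \<le> r - 1 / Suc k}"
      using ball_iff by blast
    also have "\<dots> \<in> sets M"
    proof -
      have [measurable]: "(\<lambda>x. \<Psi> x u) \<in> borel_measurable M" if "u \<in> {0..T} \<inter> \<rat>" for u
        using ev that by auto
      have "countable ({0..T} \<inter> \<rat>)" using countable_rat by auto
      then show ?thesis by measurable
    qed
    finally show ?thesis .
  qed
  fix U assume "U \<in> {U. openin (mtopology_of (path_metric T)) U}"
  then have U: "openin (mtopology_of (path_metric T)) U" by simp
  define I where "I = {(d, n). d \<in> ?D \<and> mball_of (path_metric T) d (1 / real (Suc n)) \<subseteq> U}"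
  have "countable I"
    by (rule countable_subset[of _ "?D \<times> UNIV"]) (auto simp: I_def countable_rational_paths)
  have "U = (\<Union>(d, n)\<in>I. mball_of (path_metric T) d (1 / real (Suc n)))"
  proof (intro equalityI subsetI)
    fix x assume x: "x \<in> U"
    have xm: "x \<in> mspace (path_metric T)" using x openin_subset[OF U] by auto
    obtain d n where dn: "d \<in> ?D" "mdist (path_metric T) d x < 1 / Suc n" "mball_of (path_metric T) d (1 / Suc n) \<subseteq> U"
      using countable_ball_cover[OF assms(1) U x] by blast
    then have "(d, n) \<in> I" "x \<in> mball_of (path_metric T) d (1 / real (Suc n))"
      using xm rational_paths_subset by (auto simp: I_def mball_of_def in_mball)
    then show "x \<in> (\<Union>(d, n)\<in>I. mball_of (path_metric T) d (1 / real (Suc n)))" by blast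
  qed (auto simp: I_def)
  then have "\<Psi> -` U \<inter> space M = (\<Union>(d, n)\<in>I. \<Psi> -` mball_of (path_metric T) d (1 / real (Suc n)) \<inter> space M)"
    by auto
  also have "\<dots> \<in> sets M"
    using \<open>countable I\<close> ball by (intro sets.countable_UN'') (auto simp: I_def)
  finally show "\<Psi> -` U \<inter> space M \<in> sets M" .
qed

text \<open>Evaluation is 1-Lipschitz for the uniform metric, so it pulls open sets back to open
  sets.\<close>

lemma measurable_path_eval:
  assumes "0 \<le> T" "u \<in> {0..T}"
  shows "(\<lambda>\<eta>. \<eta> u) \<in> borel_measurable (path_borel T)"
proof (rule borel_measurableI)
  fix S :: "real set" assume S: "open S"
  interpret Metric_space "mspace (path_metric T)" "mdist (path_metric T)" by simp
  have "openin (mtopology_of (path_metric T)) ((\<lambda>\<eta>. \<eta> u) -` S \<inter> mspace (path_metric T))"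
    unfolding mtopology_of_def openin_mtopology
  proof (intro conjI allI impI)
    fix \<eta> assume \<eta>: "\<eta> \<in> (\<lambda>\<eta>. \<eta> u) -` S \<inter> mspace (path_metric T)"
    then obtain e where e: "e > 0" "\<And>y. dist y (\<eta> u) < e \<Longrightarrow> y \<in> S"
      using S open_dist by (metis IntD1 vimageD)
    have "mball \<eta> e \<subseteq> (\<lambda>\<eta>. \<eta> u) -` S \<inter> mspace (path_metric T)"
    proof
      fix \<zeta> assume z: "\<zeta> \<in> mball \<eta> e"
      then have "\<bar>\<eta> u - \<zeta> u\<bar> \<le> mdist (path_metric T) \<eta> \<zeta>"
        using mdist_path_le[OF assms(1), of \<eta> \<zeta> "mdist (path_metric T) \<eta> \<zeta>"] assms by auto
      then show "\<zeta> \<in> (\<lambda>\<eta>. \<eta> u) -` S \<inter> mspace (path_metric T)"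
        using z e(2)[of "\<zeta> u"] by (auto simp: dist_real_def)
    qed
    then show "\<exists>r>0. mball \<eta> r \<subseteq> (\<lambda>\<eta>. \<eta> u) -` S \<inter> mspace (path_metric T)"
      using e(1) by blast
  qed auto
  then show "(\<lambda>\<eta>. \<eta> u) -` S \<inter> space (path_borel T) \<in> sets (path_borel T)"
    by (simp add: space_path_borel sets_path_borel sigma_sets.Basic)
qed

text \<open>Both factors are second countable, so an open set of the product is a countable union of
  rectangles: intervals with rational end points times balls around rational polynomials.\<close>

lemma openin_prod_in_sets:
  assumes "0 \<le> T"
    and U: "openin (prod_topology (top_of_set {0..T}) (mtopology_of (path_metric T))) U"
  shows "U \<in> sets (restrict_space borel {0..T} \<Otimes>\<^sub>M path_borel T)"
proof -
  interpret Metric_space "mspace (path_metric T)" "mdist (path_metric T)" by simp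
  let ?D = "rational_paths T" and ?B = "\<lambda>d n. mball_of (path_metric T) d (1 / real (Suc n))"
  define I where "I = {(a, b, d, n). a \<in> \<rat> \<and> b \<in> \<rat> \<and> d \<in> ?D \<and> ({a<..<b} \<inter> {0..T}) \<times> ?B d n \<subseteq> U}"
  have "countable I"
    by (rule countable_subset[of _ "\<rat> \<times> \<rat> \<times> ?D \<times> UNIV"])
       (auto simp: I_def countable_rational_paths countable_rat)
  have sub: "U \<subseteq> {0..T} \<times> mspace (path_metric T)"
    using openin_subset[OF U] by simp
  have "U = (\<Union>(a, b, d, n)\<in>I. ({a<..<b} \<inter> {0..T}) \<times> ?B d n)"
  proof (intro equalityI subsetI)
    fix p assume p: "p \<in> U"
    obtain s \<eta> where s: "p = (s, \<eta>)" by (cases p)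
    obtain V W where VW: "openin (top_of_set {0..T}) V" "openin (mtopology_of (path_metric T)) W"
      "s \<in> V" "\<eta> \<in> W" "V \<times> W \<subseteq> U"
      using U[unfolded openin_prod_topology_alt, rule_format, OF p[unfolded s]] by auto
    obtain V' where V': "open V'" "V = {0..T} \<inter> V'" using VW(1) by (auto simp: openin_open)
    then obtain e where e: "e > 0" "ball s e \<subseteq> V'" using VW(3) open_contains_ball by blast
    obtain a where a: "a \<in> \<rat>" "s - e < a" "a < s"
      using Rats_dense_in_real[of "s - e" s] e by auto
    obtain b where b: "b \<in> \<rat>" "s < b" "b < s + e"
      using Rats_dense_in_real[of s "s + e"] e by auto
    have ab: "{a<..<b} \<inter> {0..T} \<subseteq> V"
    proof
      fix x assume x: "x \<in> {a<..<b} \<inter> {0..T}"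
      then have "x \<in> ball s e" using a b by (auto simp: dist_real_def)
      then show "x \<in> V" using e V' x by auto
    qed
    obtain d n where dn: "d \<in> ?D" "mdist (path_metric T) d \<eta> < 1 / Suc n" "?B d n \<subseteq> W"
      using countable_ball_cover[OF assms(1) VW(2,4)] by blast
    have "(a, b, d, n) \<in> I"
      unfolding I_def using a b dn ab VW(5) by blast
    moreover have "p \<in> ({a<..<b} \<inter> {0..T}) \<times> ?B d n"
      using s a b dn sub p rational_paths_subset by (auto simp: mball_of_def)
    ultimately show "p \<in> (\<Union>(a, b, d, n)\<in>I. ({a<..<b} \<inter> {0..T}) \<times> ?B d n)"
      by (intro UN_I[of "(a, b, d, n)"]) auto
  next
    fix p assume "p \<in> (\<Union>(a, b, d, n)\<in>I. ({a<..<b} \<inter> {0..T}) \<times> ?B d n)"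
    then obtain a b d n where "(a, b, d, n) \<in> I" "p \<in> ({a<..<b} \<inter> {0..T}) \<times> ?B d n"
      by auto
    then show "p \<in> U" unfolding I_def by auto
  qed
  also have "\<dots> \<in> sets (restrict_space borel {0..T} \<Otimes>\<^sub>M path_borel T)"
  proof (rule sets.countable_UN''[OF \<open>countable I\<close>], clarify)
    fix a b d n
    show "({a<..<b} \<inter> {0..T}) \<times> ?B d n \<in> sets (restrict_space borel {0..T} \<Otimes>\<^sub>M path_borel T)"
    proof (rule pair_measureI)
      show "{a<..<b} \<inter> {0..T} \<in> sets (restrict_space borel {0..T})"
        by (auto simp: sets_restrict_space)
      show "?B d n \<in> sets (path_borel T)"
        unfolding sets_path_borel using openin_mball_of by (intro sigma_sets.Basic) simp
    qed
  qed
  finally show ?thesis .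
qed

section \<open>Canonical filtration\<close>

lemma space_canonical_filtration [simp]: "space (canonical_filtration T P X t) = space P"
  and sets_canonical_filtration: "sets (canonical_filtration T P X t) =
    sigma_sets (space P) {X s -` A \<inter> space P |s A. s \<in> {0..min t T} \<and> A \<in> sets borel}"
proof -
  have "{X s -` A \<inter> space P |s A. s \<in> {0..min t T} \<and> A \<in> sets borel} \<subseteq> Pow (space P)"
    by auto
  then show "space (canonical_filtration T P X t) = space P"
    "sets (canonical_filtration T P X t) =
    sigma_sets (space P) {X s -` A \<inter> space P |s A. s \<in> {0..min t T} \<and> A \<in> sets borel}"
    by (simp_all add: canonical_filtration_def space_measure_of sets_measure_of)
qed

lemma canonical_filtration_eval:
  assumes "0 \<le> s" "s \<le> t" "s \<le> T"
  shows "X s \<in> borel_measurable (canonical_filtration T P X t)"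
proof (rule measurableI)
  fix A :: "real set" assume "A \<in> sets borel"
  then show "X s -` A \<inter> space (canonical_filtration T P X t) \<in> sets (canonical_filtration T P X t)"
    unfolding space_canonical_filtration sets_canonical_filtration
    using assms by (intro sigma_sets.Basic) auto
qed simp

lemma measurable_canonical_filtration:
  assumes "\<And>x. x \<in> space M \<Longrightarrow> f x \<in> space P"
    and "\<And>s. 0 \<le> s \<Longrightarrow> s \<le> t \<Longrightarrow> s \<le> T \<Longrightarrow> (\<lambda>x. X s (f x)) \<in> borel_measurable M"
  shows "f \<in> measurable M (canonical_filtration T P X t)"
  unfolding canonical_filtration_def
proof (rule measurable_measure_of)
  fix y assume "y \<in> {X s -` A \<inter> space P |s A. s \<in> {0..min t T} \<and> A \<in> sets borel}"
  then obtain s A where y: "y = X s -` A \<inter> space P" "0 \<le> s" "s \<le> t" "s \<le> T" "A \<in> sets borel" by auto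
  then have "f -` y \<inter> space M = (\<lambda>x. X s (f x)) -` A \<inter> space M"
    using assms(1) by auto
  also have "\<dots> \<in> sets M" by (rule measurable_sets[OF assms(2)[OF y(2-4)] y(5)])
  finally show "f -` y \<inter> space M \<in> sets M" .
qed (use assms in auto)

text \<open>Inclusions of sigma-algebras are proved through measurability of the identity, which
  only has to be checked on generators of the target.\<close>

lemma measurable_ident_subalgebra:
  assumes "(\<lambda>x. x) \<in> measurable M N" "space N = space M"
  shows "subalgebra M N"
  unfolding subalgebra_def
proof (intro conjI subsetI)
  fix A assume A: "A \<in> sets N"
  then have "(\<lambda>x. x) -` A \<inter> space M = A"
    using sets.sets_into_space[OF A] assms(2) by auto
  then show "A \<in> sets M" using measurable_sets[OF assms(1) A] by simp
qed (use assms in auto)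

lemma subalgebra_canonical_filtration:
  assumes "\<And>s. 0 \<le> s \<Longrightarrow> s \<le> t \<Longrightarrow> s \<le> T \<Longrightarrow> X s \<in> borel_measurable P"
  shows "subalgebra P (canonical_filtration T P X t)"
proof -
  have "(\<lambda>x. x) \<in> measurable P (canonical_filtration T P X t)"
    using assms by (intro measurable_canonical_filtration) auto
  then show ?thesis
    by (intro measurable_ident_subalgebra) auto
qed

abbreviation path_filtration :: "real \<Rightarrow> real \<Rightarrow> (real \<Rightarrow> real) measure" where
  "path_filtration T \<equiv> canonical_filtration T (path_borel T) (\<lambda>s \<eta>. \<eta> s)"

text \<open>The coordinates up to \<open>T\<close> generate all Borel sets of path space. So a
  statement about functionals of the path up to time \<open>T\<close> is one about the whole
  law.\<close>

lemma sets_path_filtration_T: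
  assumes "0 \<le> T"
  shows "sets (path_filtration T T) = sets (path_borel T)"
proof
  show "sets (path_filtration T T) \<subseteq> sets (path_borel T)"
    using subalgebra_canonical_filtration[of T T "\<lambda>s \<eta>. \<eta> s" "path_borel T"] measurable_path_eval[OF assms]
    by (auto simp: subalgebra_def)
  have "(\<lambda>x. x) \<in> measurable (path_filtration T T) (path_borel T)"
    using assms by (intro measurable_path_borel canonical_filtration_eval) (auto simp: space_path_borel)
  then show "sets (path_borel T) \<subseteq> sets (path_filtration T T)"
    using measurable_ident_subalgebra[of "path_filtration T T" "path_borel T"] by (simp add: subalgebra_def)
qed

lemma sets_path_filtration_mono:
  assumes "s \<le> t"
  shows "sets (path_filtration T s) \<subseteq> sets (path_filtration T t)"
  unfolding sets_canonical_filtration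
proof (rule sigma_sets_mono')
  show "{(\<lambda>\<eta>. \<eta> u) -` A \<inter> space (path_borel T) |u A. u \<in> {0..min s T} \<and> A \<in> sets borel} \<subseteq>
    {(\<lambda>\<eta>. \<eta> u) -` A \<inter> space (path_borel T) |u A. u \<in> {0..min t T} \<and> A \<in> sets borel}"
    using assms by (intro Collect_mono ex_mono impI) auto
qed

lemma measurable_path_filtration_mono:
  assumes "f \<in> borel_measurable (path_filtration T s)" "s \<le> t"
  shows "f \<in> borel_measurable (path_filtration T t)"
  using assms sets_path_filtration_mono[OF assms(2), of T] by (auto simp: measurable_def)

lemma measurable_path_filtration_path_borel:
  assumes "0 \<le> T" "f \<in> borel_measurable (path_filtration T s)"
  shows "f \<in> borel_measurable (path_borel T)"
  using assms subalgebra_canonical_filtration[of s T "\<lambda>s \<eta>. \<eta> s" "path_borel T"] measurable_path_eval[OF assms(1)]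
  by (auto simp: measurable_def subalgebra_def)

section \<open>Joint measurability in time and path\<close>

text \<open>Time is rounded to a grid, which leaves countably many evaluations; continuity of the
  paths gives convergence as the mesh shrinks.\<close>

lemma measurable_eval_joint:
  assumes "0 \<le> T"
  shows "(\<lambda>(u, \<eta>). \<eta> u) \<in> borel_measurable (borel \<Otimes>\<^sub>M path_borel T)"
proof -
  \<comment> \<open>Rounding down to the grid of mesh \<open>1 / Suc n\<close>, then clamping to the
    interval, where the paths are continuous.\<close>
  define a where "a = (\<lambda>n u. min T (max 0 (of_int \<lfloor>u * real (Suc n)\<rfloor> / real (Suc n))))"
  have a: "a n u \<in> {0..T}" for n u using assms by (auto simp: a_def)
  have lim: "(\<lambda>n. a n u) \<longlonglongrightarrow> u" if "u \<in> {0..T}" for u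
  proof -
    have "(\<lambda>n. of_int \<lfloor>u * real (Suc n)\<rfloor> / real (Suc n)) \<longlonglongrightarrow> u"
    proof (rule tendsto_sandwich[of "\<lambda>n. u - 1 / real (Suc n)" _ _ "\<lambda>n. u"])
      show "eventually (\<lambda>n. u - 1 / real (Suc n) \<le> of_int \<lfloor>u * real (Suc n)\<rfloor> / real (Suc n)) sequentially"
      proof (intro always_eventually allI)
        fix n
        have "u * real (Suc n) - 1 \<le> of_int \<lfloor>u * real (Suc n)\<rfloor>" by linarith
        then have "(u * real (Suc n) - 1) / real (Suc n) \<le> of_int \<lfloor>u * real (Suc n)\<rfloor> / real (Suc n)"
          by (intro divide_right_mono) auto
        then show "u - 1 / real (Suc n) \<le> of_int \<lfloor>u * real (Suc n)\<rfloor> / real (Suc n)"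
          by (simp add: diff_divide_distrib del: of_nat_Suc)
      qed
      show "eventually (\<lambda>n. of_int \<lfloor>u * real (Suc n)\<rfloor> / real (Suc n) \<le> u) sequentially"
        by (intro always_eventually allI) (simp add: divide_le_eq del: of_nat_Suc)
      have "(\<lambda>n. u - 1 / real (Suc n)) \<longlonglongrightarrow> u - 0"
        by (intro tendsto_intros LIMSEQ_Suc[OF lim_inverse_n'])
      then show "(\<lambda>n. u - 1 / real (Suc n)) \<longlonglongrightarrow> u" by simp
    qed auto
    then have "(\<lambda>n. a n u) \<longlonglongrightarrow> min T (max 0 u)"
      unfolding a_def by (intro tendsto_intros)
    then show ?thesis using that by simp
  qed
  have [measurable]: "(\<lambda>\<eta>. \<eta> (min T (max 0 (of_int i / real (Suc n))))) \<in> borel_measurable (path_borel T)" for i n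
    using assms by (intro measurable_path_eval) auto
  \<comment> \<open>Paths are extensional, so outside the interval they all take the value
    \<open>undefined\<close>. Giving the approximants this value makes them converge on the whole
    product space.\<close>
  have "(\<lambda>p :: real \<times> (real \<Rightarrow> real). if fst p \<in> {0..T} then snd p (a n (fst p)) else undefined) \<in> borel_measurable (borel \<Otimes>\<^sub>M path_borel T)" for n
  proof -
    have "(\<lambda>p. snd p (a n (fst p))) \<in> borel_measurable (borel \<Otimes>\<^sub>M path_borel T)"
      unfolding a_def
      by (rule measurable_compose_countable[where f="\<lambda>i p. snd p (min T (max 0 (of_int i / real (Suc n))))"])
         measurable
    then show ?thesis by measurable
  qed
  then have "(\<lambda>p. snd p (fst p)) \<in> borel_measurable (borel \<Otimes>\<^sub>M path_borel T)"
  proof (rule borel_measurable_LIMSEQ_real[rotated])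
    fix p :: "real \<times> (real \<Rightarrow> real)" assume p: "p \<in> space (borel \<Otimes>\<^sub>M path_borel T)"
    then have \<eta>: "snd p \<in> extensional {0..T}" "continuous_on {0..T} (snd p)"
      by (auto simp: space_pair_measure space_path_borel mspace_path_metric)
    show "(\<lambda>n. if fst p \<in> {0..T} then snd p (a n (fst p)) else undefined) \<longlonglongrightarrow> snd p (fst p)"
    proof (cases "fst p \<in> {0..T}")
      case True
      then have "(\<lambda>n. snd p (a n (fst p))) \<longlonglongrightarrow> snd p (fst p)"
        using \<eta>(2) lim a by (auto simp: continuous_on_sequentially o_def)
      then show ?thesis using True by simp
    qed (use \<eta>(1) in \<open>auto simp: extensional_def\<close>)
  qed
  then show ?thesis by (simp add: case_prod_beta')
qed

lemma stopped_path_in_mspace: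
  assumes "\<eta> \<in> mspace (path_metric T)" "t \<in> {0..T}"
  shows "stopped_path T t \<eta> \<in> mspace (path_metric T)"
proof -
  have "continuous_on {0..T} (\<lambda>s. \<eta> (min s t))"
  proof (rule continuous_on_compose2[where g=\<eta> and f="\<lambda>s. min s t" and t="{0..T}"])
    show "continuous_on {0..T} \<eta>" using assms by (simp add: mspace_path_metric)
    show "continuous_on {0..T} (\<lambda>s. min s t)" by (intro continuous_intros)
  qed (use assms in auto)
  then have "continuous_on {0..T} (stopped_path T t \<eta>)"
    by (rule continuous_on_eq) (simp add: stopped_path_def)
  then show ?thesis by (auto simp: mspace_path_metric stopped_path_def)
qed

text \<open>Open sets of stopped paths are traces of open sets of the product, and these lie in the
  product sigma-algebra; composing with \<Gamma> is therefore unproblematic once the pair takes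
  values in \<open>stopped_paths\<close>.\<close>

lemma measurable_stopped_paths_borel:
  assumes "0 \<le> T" and \<Gamma>: "\<Gamma> \<in> borel_measurable (stopped_paths_borel T)"
    and a: "a \<in> borel_measurable M" "\<And>x. x \<in> space M \<Longrightarrow> a x \<in> {0..T}"
    and b: "b \<in> measurable M (path_borel T)"
    and ab: "\<And>x. x \<in> space M \<Longrightarrow> (a x, b x) \<in> stopped_paths T"
  shows "(\<lambda>x. \<Gamma> (a x, b x)) \<in> borel_measurable M"
proof -
  let ?Y = "prod_topology (top_of_set {0..T}) (mtopology_of (path_metric T))"
  have ab': "(\<lambda>x. (a x, b x)) \<in> measurable M (restrict_space borel {0..T} \<Otimes>\<^sub>M path_borel T)"
    using a b by (intro measurable_Pair measurable_restrict_space2) auto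
  have sub: "stopped_paths T \<subseteq> topspace ?Y"
    using stopped_path_in_mspace by (auto simp: stopped_paths_def)
  have "(\<lambda>x. (a x, b x)) \<in> measurable M (stopped_paths_borel T)"
    unfolding stopped_paths_borel_def borel_of_def
  proof (rule measurable_measure_of)
    show "{U. openin (subtopology ?Y (stopped_paths T)) U} \<subseteq> Pow (topspace (subtopology ?Y (stopped_paths T)))"
      using openin_subset[of "subtopology ?Y (stopped_paths T)"] by blast
    show "(\<lambda>x. (a x, b x)) \<in> space M \<rightarrow> topspace (subtopology ?Y (stopped_paths T))"
      using ab sub by auto
    fix U assume "U \<in> {U. openin (subtopology ?Y (stopped_paths T)) U}"
    then obtain V where V: "openin ?Y V" "U = V \<inter> stopped_paths T"
      by (auto simp: openin_subtopology)
    then have "(\<lambda>x. (a x, b x)) -` U \<inter> space M = (\<lambda>x. (a x, b x)) -` V \<inter> space M"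
      using ab by auto
    also have "\<dots> \<in> sets M"
      using measurable_sets[OF ab' openin_prod_in_sets[OF assms(1) V(1)]] .
    finally show "(\<lambda>x. (a x, b x)) -` U \<inter> space M \<in> sets M" .
  qed
  then show ?thesis by (rule measurable_compose[OF _ \<Gamma>])
qed

text \<open>Agrees with \<open>extend_functional\<close> on the interval and vanishes outside it, so
  that it is bounded and jointly measurable for all real times.\<close>

definition drift :: "real \<Rightarrow> (real \<times> (real \<Rightarrow> real) \<Rightarrow> real) \<Rightarrow> real \<Rightarrow> (real \<Rightarrow> real) \<Rightarrow> real" where
  "drift T \<Gamma> u \<eta> = (if u \<in> {0..T} then \<Gamma> (u, stopped_path T u \<eta>) else 0)"

lemma stopped_path_eval_measurable:
  assumes "0 \<le> T"
  shows "(\<lambda>p. stopped_path T (fst p) (snd p)) \<in>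
    measurable (restrict_space (borel \<Otimes>\<^sub>M path_borel T) ({0..T} \<times> UNIV)) (path_borel T)"
proof (rule measurable_path_borel[OF assms])
  fix x assume "x \<in> space (restrict_space (borel \<Otimes>\<^sub>M path_borel T) ({0..T} \<times> UNIV))"
  then show "stopped_path T (fst x) (snd x) \<in> mspace (path_metric T)"
    using stopped_path_in_mspace
    by (auto simp: space_restrict_space space_pair_measure space_path_borel)
next
  fix u assume u: "u \<in> {0..T}"
  have "(\<lambda>p. (\<lambda>(u, \<eta>). \<eta> u) (min u (fst p), snd p)) \<in> borel_measurable (borel \<Otimes>\<^sub>M path_borel T)"
    by (rule measurable_compose[OF _ measurable_eval_joint[OF assms]]) simp
  then show "(\<lambda>x. stopped_path T (fst x) (snd x) u) \<in>
    borel_measurable (restrict_space (borel \<Otimes>\<^sub>M path_borel T) ({0..T} \<times> UNIV))"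
    using u by (intro measurable_restrict_space1) (simp add: stopped_path_def)
qed

lemma measurable_drift_joint:
  assumes "0 \<le> T" and \<Gamma>: "\<Gamma> \<in> borel_measurable (stopped_paths_borel T)"
  shows "(\<lambda>(u, \<eta>). drift T \<Gamma> u \<eta>) \<in> borel_measurable (borel \<Otimes>\<^sub>M path_borel T)"
proof -
  let ?M = "borel \<Otimes>\<^sub>M path_borel T"
  have "{0..T} \<times> UNIV \<inter> space ?M = {0..T} \<times> space (path_borel T)"
    by (auto simp: space_pair_measure)
  then have S: "{0..T} \<times> UNIV \<inter> space ?M \<in> sets ?M"
    by simp
  have "(\<lambda>p. \<Gamma> (fst p, stopped_path T (fst p) (snd p))) \<in> borel_measurable (restrict_space ?M ({0..T} \<times> UNIV))"
  proof (rule measurable_stopped_paths_borel[OF assms])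
    show "fst \<in> borel_measurable (restrict_space ?M ({0..T} \<times> UNIV))"
      by (intro measurable_restrict_space1) measurable
  next
    fix x assume "x \<in> space (restrict_space ?M ({0..T} \<times> UNIV))"
    then show "fst x \<in> {0..T}" "(fst x, stopped_path T (fst x) (snd x)) \<in> stopped_paths T"
      by (auto simp: space_restrict_space space_pair_measure space_path_borel stopped_paths_def)
  qed (rule stopped_path_eval_measurable[OF assms(1)])
  then have "(\<lambda>p. indicator ({0..T} \<times> UNIV) p *\<^sub>R \<Gamma> (fst p, stopped_path T (fst p) (snd p))) \<in> borel_measurable ?M"
    using S by (simp add: borel_measurable_restrict_space_iff)
  also have "(\<lambda>p. indicator ({0..T} \<times> UNIV) p *\<^sub>R \<Gamma> (fst p, stopped_path T (fst p) (snd p))) =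
    (\<lambda>(u, \<eta>). drift T \<Gamma> u \<eta>)"
    by (auto simp: drift_def indicator_def fun_eq_iff)
  finally show ?thesis .
qed

text \<open>Adaptedness: a path stopped at \<open>u\<close> is a function of its evaluations up to
  \<open>u\<close>. Joint measurability serves Fubini; this lemma keeps products with the drift
  among the functionals of the path up to \<open>t\<close>.\<close>

lemma measurable_drift:
  assumes "0 \<le> T" and \<Gamma>: "\<Gamma> \<in> borel_measurable (stopped_paths_borel T)" and "u \<le> t"
  shows "drift T \<Gamma> u \<in> borel_measurable (path_filtration T t)"
proof (cases "u \<in> {0..T}")
  case True
  have "(\<lambda>\<eta>. \<Gamma> (u, stopped_path T u \<eta>)) \<in> borel_measurable (path_filtration T t)"
  proof (rule measurable_stopped_paths_borel[OF assms(1,2)])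
    show "stopped_path T u \<in> measurable (path_filtration T t) (path_borel T)"
    proof (rule measurable_path_borel[OF assms(1)])
      fix s assume s: "s \<in> {0..T}"
      have "(\<lambda>\<eta>. \<eta> (min s u)) \<in> borel_measurable (path_filtration T t)"
        using canonical_filtration_eval[of "min s u" t T "\<lambda>s \<eta>. \<eta> s"] s True assms(3) by auto
      then show "(\<lambda>\<eta>. stopped_path T u \<eta> s) \<in> borel_measurable (path_filtration T t)"
        using s by (simp add: stopped_path_def)
    qed (use stopped_path_in_mspace True in \<open>auto simp: space_path_borel\<close>)
  qed (use True in \<open>auto simp: stopped_paths_def space_path_borel\<close>)
  then show ?thesis using True by (simp add: drift_def[abs_def])
next
  case False
  then have "drift T \<Gamma> u = (\<lambda>\<eta>. 0)" by (auto simp: drift_def)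
  then show ?thesis by simp
qed

section \<open>Gaussian test functions\<close>

lemma DERIV_gauss:
  fixes l x :: real
  shows "((\<lambda>x. exp (- (l * x\<^sup>2))) has_real_derivative - (2 * l * x) * exp (- (l * x\<^sup>2))) (at x within S)"
  by (auto intro!: derivative_eq_intros)

lemma DERIV_gauss':
  fixes l x :: real
  shows "((\<lambda>x. - (2 * l * x) * exp (- (l * x\<^sup>2))) has_real_derivative
    (4 * l\<^sup>2 * x\<^sup>2 - 2 * l) * exp (- (l * x\<^sup>2))) (at x within S)"
  by (auto intro!: derivative_eq_intros simp: power2_eq_square algebra_simps)

lemma C2_on_gauss: "C2_on S (\<lambda>x. exp (- (l * x\<^sup>2)))"
  unfolding C2_on_def
  by (rule exI[of _ "\<lambda>x. - (2 * l * x) * exp (- (l * x\<^sup>2))"],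
      rule exI[of _ "\<lambda>x. (4 * l\<^sup>2 * x\<^sup>2 - 2 * l) * exp (- (l * x\<^sup>2))"])
     (intro conjI ballI DERIV_gauss DERIV_gauss' continuous_intros)

lemma C2_on_cong:
  assumes "C2_on S f" "\<And>x. x \<in> S \<Longrightarrow> f x = h x"
  shows "C2_on S h"
proof -
  obtain f' f'' where f: "\<forall>x\<in>S. (f has_real_derivative f' x) (at x within S) \<and>
    (f' has_real_derivative f'' x) (at x within S)" "continuous_on S f''"
    using assms(1) unfolding C2_on_def by blast
  have "(h has_real_derivative f' x) (at x within S)" if "x \<in> S" for x
    by (rule has_field_derivative_transform_within[of f _ _ _ 1]) (use that f assms(2) in auto)
  then show ?thesis unfolding C2_on_def using f by blast
qed

lemma C2_on_const_minus:
  assumes "C2_on S f"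
  shows "C2_on S (\<lambda>x. c - f x)"
proof -
  obtain f' f'' where f: "\<forall>x\<in>S. (f has_real_derivative f' x) (at x within S) \<and>
    (f' has_real_derivative f'' x) (at x within S)" "continuous_on S f''"
    using assms(1) unfolding C2_on_def by blast
  then show ?thesis unfolding C2_on_def
    by (intro exI[of _ "\<lambda>x. - f' x"] exI[of _ "\<lambda>x. - f'' x"])
       (auto intro!: derivative_eq_intros continuous_intros)
qed

lemma bessel_gauss_1:
  "(\<lambda>x. exp (- (l * x\<^sup>2))) \<in> bessel_domain 1"
  "bessel_op 1 (\<lambda>x. exp (- (l * x\<^sup>2))) x = (2 * l\<^sup>2 * x\<^sup>2 - l) * exp (- (l * x\<^sup>2))"
proof -
  have d: "deriv (\<lambda>x. exp (- (l * x\<^sup>2))) = (\<lambda>x. - (2 * l * x) * exp (- (l * x\<^sup>2)))"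
    using DERIV_imp_deriv[OF DERIV_gauss] by blast
  have d2: "deriv (\<lambda>x. - (2 * l * x) * exp (- (l * x\<^sup>2))) = (\<lambda>x. (4 * l\<^sup>2 * x\<^sup>2 - 2 * l) * exp (- (l * x\<^sup>2)))"
    using DERIV_imp_deriv[OF DERIV_gauss'] by blast
  show "(\<lambda>x. exp (- (l * x\<^sup>2))) \<in> bessel_domain 1"
    by (simp add: bessel_domain_def C2_on_gauss d)
  show "bessel_op 1 (\<lambda>x. exp (- (l * x\<^sup>2))) x = (2 * l\<^sup>2 * x\<^sup>2 - l) * exp (- (l * x\<^sup>2))"
    unfolding bessel_op_def d d2 by (simp add: field_simps)
qed

text \<open>The extension required by (a) is \<open>- 2 l sgn(x) \<bar>x\<bar> powr \<delta>\<close>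
  times the Gaussian. It is continuous at the origin precisely because \<delta> is positive, so here
  the even extension of the Gaussian to the line is admissible.\<close>

lemma bessel_gauss_inner:
  assumes "0 < \<delta>" "\<delta> < 1"
  shows "(\<lambda>x. exp (- (l * x\<^sup>2))) \<in> bessel_domain \<delta>"
    "bessel_op \<delta> (\<lambda>x. exp (- (l * x\<^sup>2))) x = (2 * l\<^sup>2 * x\<^sup>2 - \<delta> * l) * exp (- (l * x\<^sup>2))"
proof -
  define E where "E = (\<lambda>x :: real. exp (- (l * x\<^sup>2)))"
  have DE: "(E has_real_derivative - (2 * l * x) * E x) (at x)" for x
    unfolding E_def by (rule DERIV_gauss)
  have dE: "deriv E x = - (2 * l * x) * E x" for x
    using DERIV_imp_deriv[OF DE] by blast
  define g where "g = (\<lambda>x :: real. if x \<le> 0 then 2 * l * \<bar>x\<bar> powr \<delta> * E x else - 2 * l * \<bar>x\<bar> powr \<delta> * E x)"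
  define G where "G = (\<lambda>x :: real. (4 * l\<^sup>2 * x\<^sup>2 - 2 * \<delta> * l) * E x)"
  have cE: "continuous_on S E" for S unfolding E_def by (intro continuous_intros)
  have cp: "continuous_on S (\<lambda>x. \<bar>x\<bar> powr \<delta>)" for S :: "real set"
    using assms by (intro continuous_on_powr' continuous_intros) auto
  have cg: "continuous_on UNIV g"
    unfolding g_def
  proof (rule continuous_on_cases_le)
    show "continuous_on {x \<in> UNIV. x \<le> 0} (\<lambda>x. 2 * l * \<bar>x\<bar> powr \<delta> * E x)"
      "continuous_on {x \<in> UNIV. 0 \<le> x} (\<lambda>x. - 2 * l * \<bar>x\<bar> powr \<delta> * E x)"
      by (intro continuous_on_mult continuous_on_const cE cp)+
  qed (use assms in auto)
  have cG: "continuous_on UNIV G" unfolding G_def by (intro continuous_intros cE)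
  have g: "g x = deriv E x * \<bar>x\<bar> powr (\<delta> - 1)" if "x \<noteq> 0" for x
  proof -
    have *: "\<bar>x\<bar> * \<bar>x\<bar> powr (\<delta> - 1) = \<bar>x\<bar> powr \<delta>" using that by (simp add: powr_mult_base)
    show ?thesis
    proof (cases "x < 0")
      case True
      then have "g x = 2 * l * E x * (\<bar>x\<bar> * \<bar>x\<bar> powr (\<delta> - 1))" by (simp only: * g_def) simp
      also have "\<dots> = 2 * l * E x * (- x * \<bar>x\<bar> powr (\<delta> - 1))" using True by (simp only: abs_of_neg)
      finally show ?thesis unfolding dE by (simp only: mult_minus_left mult_minus_right mult_ac)
    next
      case False
      then have "g x = - 2 * l * E x * (\<bar>x\<bar> * \<bar>x\<bar> powr (\<delta> - 1))" using that by (simp only: * g_def) simp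
      also have "\<dots> = - 2 * l * E x * (x * \<bar>x\<bar> powr (\<delta> - 1))" using False by (simp only: abs_of_nonneg not_less)
      finally show ?thesis unfolding dE by (simp only: mult_minus_left mult_minus_right mult_ac)
    qed
  qed
  have G: "G x = deriv g x * \<bar>x\<bar> powr (1 - \<delta>)" if x: "x \<noteq> 0" for x
  proof -
    define y where "y = \<bar>x\<bar>"
    have y: "0 < y" using x by (simp add: y_def)
    have p1: "y powr (\<delta> - 1) * y powr (1 - \<delta>) = 1" "y powr \<delta> * y powr (1 - \<delta>) = y"
      using y by (simp_all add: powr_add[symmetric])
    \<comment> \<open>\<open>g\<close> is odd, so its derivative is even and one formula in
      \<open>y = \<bar>x\<bar>\<close> covers both half-lines.\<close>
    define D where "D = - 2 * l * (\<delta> * y powr (\<delta> - 1) - 2 * l * y * y powr \<delta>) * E x"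
    have "(g has_real_derivative D) (at x)"
    proof (cases "x < 0")
      case True
      have "((\<lambda>x. 2 * l * (- x) powr \<delta> * E x) has_real_derivative
        2 * l * (- (\<delta> * (- x) powr (\<delta> - 1))) * E x + 2 * l * (- x) powr \<delta> * (- (2 * l * x) * E x)) (at x)"
        using True by (auto intro!: derivative_eq_intros DE)
      also have "2 * l * (- (\<delta> * (- x) powr (\<delta> - 1))) * E x + 2 * l * (- x) powr \<delta> * (- (2 * l * x) * E x) = D"
        using True by (simp add: D_def y_def algebra_simps)
      finally show ?thesis
        by (rule has_field_derivative_transform_within_open[of _ _ _ "{..<0}"]) (use True in \<open>auto simp: g_def\<close>)
    next
      case False
      then have x: "0 < x" using that by simp
      have "((\<lambda>x. - 2 * l * x powr \<delta> * E x) has_real_derivative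
        - 2 * l * (\<delta> * x powr (\<delta> - 1)) * E x + - 2 * l * x powr \<delta> * (- (2 * l * x) * E x)) (at x)"
        using x by (auto intro!: derivative_eq_intros DE)
      also have "- 2 * l * (\<delta> * x powr (\<delta> - 1)) * E x + - 2 * l * x powr \<delta> * (- (2 * l * x) * E x) = D"
        using x by (simp add: D_def y_def algebra_simps)
      finally show ?thesis
        by (rule has_field_derivative_transform_within_open[of _ _ _ "{0<..}"]) (use x in \<open>auto simp: g_def\<close>)
    qed
    then have "deriv g x = D" by (rule DERIV_imp_deriv)
    then have "deriv g x * \<bar>x\<bar> powr (1 - \<delta>) = D * y powr (1 - \<delta>)"
      by (simp add: y_def)
    also have "\<dots> =
      - 2 * l * (\<delta> * (y powr (\<delta> - 1) * y powr (1 - \<delta>)) - 2 * l * y * (y powr \<delta> * y powr (1 - \<delta>))) * E x"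
      by (simp add: D_def algebra_simps)
    also have "\<dots> = - 2 * l * (\<delta> - 2 * l * y\<^sup>2) * E x"
      by (simp add: p1 power2_eq_square)
    also have "\<dots> = G x"
      by (simp add: G_def y_def algebra_simps power2_eq_square)
    finally show ?thesis by simp
  qed
  have ext: "bessel_extensions \<delta> E g G"
    unfolding bessel_extensions_def using cg cG g G by blast
  have "E \<in> bessel_domain \<delta>"
    using assms ext C2_on_gauss[of _ l] cE[of UNIV] by (auto simp: bessel_domain_def E_def)
  then show "(\<lambda>x. exp (- (l * x\<^sup>2))) \<in> bessel_domain \<delta>" by (simp add: E_def)
  have "bessel_op \<delta> E x = G x / 2"
    using ext assms by (intro bessel_op_eq) auto
  then show "bessel_op \<delta> (\<lambda>x. exp (- (l * x\<^sup>2))) x = (2 * l\<^sup>2 * x\<^sup>2 - \<delta> * l) * exp (- (l * x\<^sup>2))"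
    by (simp add: E_def G_def algebra_simps)
qed

text \<open>For \<open>\<delta> = 0\<close> the even extension violates condition (a), as \<open>f' x / \<bar>x\<bar>\<close> jumps at the origin;
  the extension which is odd about the value at the origin works.\<close>

lemma bessel_gauss_0:
  fixes l :: real
  defines "h \<equiv> (\<lambda>x. if x \<le> 0 then 2 - exp (- (l * x\<^sup>2)) else exp (- (l * x\<^sup>2)))"
  shows "h \<in> bessel_domain 0"
    "0 \<le> x \<Longrightarrow> bessel_op 0 h x = 2 * l\<^sup>2 * x\<^sup>2 * exp (- (l * x\<^sup>2))"
proof -
  define E where "E = (\<lambda>x :: real. exp (- (l * x\<^sup>2)))"
  have h: "h = (\<lambda>x. if x \<le> 0 then 2 - E x else E x)" unfolding h_def E_def ..
  have DE: "(E has_real_derivative - (2 * l * x) * E x) (at x)" for x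
    unfolding E_def by (rule DERIV_gauss)
  have cE: "continuous_on S E" for S unfolding E_def by (intro continuous_intros)
  have E0: "E 0 = 1" by (simp add: E_def)
  \<comment> \<open>After the reflection the derivative of \<open>h\<close> is
    \<open>- 2 * l * \<bar>x\<bar> * E x\<close> on both sides, so dividing by
    \<open>\<bar>x\<bar>\<close> leaves a continuous even function.\<close>
  define g where "g = (\<lambda>x. - 2 * l * E x)"
  define G where "G = (\<lambda>x. 4 * l\<^sup>2 * (x * \<bar>x\<bar>) * E x)"
  have ch: "continuous_on UNIV h"
    unfolding h by (intro continuous_on_cases_le continuous_intros cE) (auto simp: E0)
  have dh: "deriv h x = - (2 * l * \<bar>x\<bar>) * E x" if x: "x \<noteq> 0" for x
  proof (cases "x < 0")
    case True
    have "((\<lambda>x. 2 - E x) has_real_derivative 2 * l * x * E x) (at x)"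
      by (auto intro!: derivative_eq_intros DE)
    then have "(h has_real_derivative 2 * l * x * E x) (at x)"
      by (rule has_field_derivative_transform_within_open[of _ _ _ "{..<0}"]) (use True in \<open>auto simp: h\<close>)
    then show ?thesis using DERIV_imp_deriv True by fastforce
  next
    case False
    have "(h has_real_derivative - (2 * l * x) * E x) (at x)"
      by (rule has_field_derivative_transform_within_open[OF DE, of "{0<..}"]) (use False x in \<open>auto simp: h\<close>)
    then show ?thesis using DERIV_imp_deriv False by fastforce
  qed
  have dg: "deriv g x = 4 * l\<^sup>2 * x * E x" for x
    unfolding g_def by (rule DERIV_imp_deriv) (auto intro!: derivative_eq_intros DE simp: power2_eq_square)
  have ext: "bessel_extensions 0 h g G"
    unfolding bessel_extensions_def
  proof (intro conjI allI impI)
    show "continuous_on UNIV g" "continuous_on UNIV G"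
      unfolding g_def G_def by (intro continuous_intros cE)+
    fix x :: real assume x: "x \<noteq> 0"
    show "g x = deriv h x * \<bar>x\<bar> powr (0 - 1)"
      using x by (simp add: dh g_def powr_minus)
    show "G x = deriv g x * \<bar>x\<bar> powr (1 - 0)" by (simp add: dg G_def)
  qed
  have "C2_on {0..} h"
    by (rule C2_on_cong[OF C2_on_gauss[of _ l]]) (auto simp: h E_def)
  moreover have "C2_on {..0} h"
    by (rule C2_on_cong[OF C2_on_const_minus[OF C2_on_gauss[of _ l], of _ 2]]) (auto simp: h E_def)
  ultimately show "h \<in> bessel_domain 0"
    using ext ch by (auto simp: bessel_domain_def)
  assume "0 \<le> x"
  then show "bessel_op 0 h x = 2 * l\<^sup>2 * x\<^sup>2 * exp (- (l * x\<^sup>2))"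
    using bessel_op_eq[OF ext, of x] by (simp add: G_def E_def power2_eq_square)
qed

text \<open>The three regimes of \<delta> need different extensions to the line, but on the
  half-line the operator has a single formula. The case distinction on \<delta> ends here.\<close>

lemma gauss_in_bessel_domain_nonneg:
  assumes "0 \<le> \<delta>" "\<delta> \<le> 1"
  shows "restrict (\<lambda>x. exp (- (l * x\<^sup>2))) {0..} \<in> bessel_domain_nonneg \<delta>"
    and "0 \<le> x \<Longrightarrow> bessel_op_nonneg \<delta> (restrict (\<lambda>x. exp (- (l * x\<^sup>2))) {0..}) x =
      (2 * l\<^sup>2 * x\<^sup>2 - \<delta> * l) * exp (- (l * x\<^sup>2))"
proof -
  let ?f = "restrict (\<lambda>x. exp (- (l * x\<^sup>2))) {0..}"
  have "\<exists>h\<in>bessel_domain \<delta>. restrict h {0..} = ?f \<and>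
    (\<forall>x\<ge>0. bessel_op \<delta> h x = (2 * l\<^sup>2 * x\<^sup>2 - \<delta> * l) * exp (- (l * x\<^sup>2)))"
  proof -
    consider "\<delta> = 0" | "\<delta> = 1" | "0 < \<delta>" "\<delta> < 1" using assms by linarith
    then show ?thesis
    proof cases
      case 1
      show ?thesis
      proof (intro bexI conjI allI impI)
        show "bessel_op \<delta> (\<lambda>x. if x \<le> 0 then 2 - exp (- (l * x\<^sup>2)) else exp (- (l * x\<^sup>2))) x =
          (2 * l\<^sup>2 * x\<^sup>2 - \<delta> * l) * exp (- (l * x\<^sup>2))" if "0 \<le> x" for x
          using bessel_gauss_0(2)[of x l] that 1 by simp
      qed (use bessel_gauss_0(1)[of l] 1 in \<open>auto simp: restrict_def fun_eq_iff\<close>)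
    next
      case 2
      then show ?thesis
        using bessel_gauss_1[of l] by auto
    next
      case 3
      then show ?thesis
        using bessel_gauss_inner[of \<delta> l] by (intro bexI[of _ "\<lambda>x. exp (- (l * x\<^sup>2))"]) auto
    qed
  qed
  then obtain h where h: "h \<in> bessel_domain \<delta>" "restrict h {0..} = ?f"
    "\<And>x. 0 \<le> x \<Longrightarrow> bessel_op \<delta> h x = (2 * l\<^sup>2 * x\<^sup>2 - \<delta> * l) * exp (- (l * x\<^sup>2))" by blast
  show "?f \<in> bessel_domain_nonneg \<delta>"
    unfolding bessel_domain_nonneg_def using h by (metis imageI)
  show "bessel_op_nonneg \<delta> ?f x = (2 * l\<^sup>2 * x\<^sup>2 - \<delta> * l) * exp (- (l * x\<^sup>2))" if "0 \<le> x"
    using bessel_op_nonneg_restrict[OF h(1)] h that by simp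
qed

lemma vector_derivative_gauss_nonneg:
  assumes "0 \<le> x"
  shows "vector_derivative (restrict (\<lambda>x. exp (- (l * x\<^sup>2))) {0..}) (at x within {0..}) =
    - (2 * l * x) * exp (- (l * x\<^sup>2))"
proof (rule vector_derivative_within)
  \<comment> \<open>The derivative relative to the half-line is unique because the half-line
    accumulates at each of its points from the right, the origin included.\<close>
  have "at_right x \<le> at x within {0..}" using assms by (intro at_le) auto
  then show "at x within {0..} \<noteq> bot"
    using trivial_limit_at_right_real[of x] by (metis bot.extremum_uniqueI)
  have "(restrict (\<lambda>x. exp (- (l * x\<^sup>2))) {0..} has_real_derivative - (2 * l * x) * exp (- (l * x\<^sup>2))) (at x within {0..})"
    by (rule has_field_derivative_transform_within[OF DERIV_gauss, of 1]) (use assms in auto)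
  then show "(restrict (\<lambda>x. exp (- (l * x\<^sup>2))) {0..} has_vector_derivative - (2 * l * x) * exp (- (l * x\<^sup>2))) (at x within {0..})"
    by (simp add: has_real_derivative_iff_has_vector_derivative)
qed

section \<open>The martingale problem on path space\<close>

text \<open>Half-open intervals are used for all time integrals: adjacent ones are disjoint, so the
  integrals add up.\<close>

lemma set_integrable_bounded:
  fixes f :: "real \<Rightarrow> real"
  assumes "f \<in> borel_measurable borel" "\<And>u. s < u \<Longrightarrow> u \<le> t \<Longrightarrow> \<bar>f u\<bar> \<le> B"
  shows "set_integrable lborel {s<..t} f"
  unfolding set_integrable_def
proof (rule integrableI_bounded_set[of "{s<..t}" _ _ B])
  show "emeasure lborel {s<..t} < \<infinity>" by (cases "s \<le> t") auto
qed (use assms in auto)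

lemma time_fubini:
  fixes f :: "real \<Rightarrow> 'a \<Rightarrow> real"
  assumes Q: "prob_space Q"
    and f: "(\<lambda>(u, x). f u x) \<in> borel_measurable (borel \<Otimes>\<^sub>M Q)"
    and B: "\<And>u x. s < u \<Longrightarrow> u \<le> t \<Longrightarrow> x \<in> space Q \<Longrightarrow> \<bar>f u x\<bar> \<le> B"
  shows "set_integrable lborel {s<..t} (\<lambda>u. \<integral>x. f u x \<partial>Q)"
    and "(\<integral>x. (LBINT u:{s<..t}. f u x) \<partial>Q) = (LBINT u:{s<..t}. (\<integral>x. f u x \<partial>Q))"
    and "integrable Q (\<lambda>x. LBINT u:{s<..t}. f u x)"
proof -
  interpret Q: prob_space Q by fact
  interpret pair_sigma_finite lborel Q ..
  have f': "(\<lambda>(u, x). f u x) \<in> borel_measurable (lborel \<Otimes>\<^sub>M Q)"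
    using f by (subst measurable_cong_sets[OF sets_pair_measure_cong[OF sets_lborel refl] refl])
  have int: "integrable (lborel \<Otimes>\<^sub>M Q) (\<lambda>(u, x). indicator {s<..t} u *\<^sub>R f u x)"
  proof (rule integrableI_bounded_set[of "{s<..t} \<times> space Q" _ _ B])
    show "(\<lambda>(u, x). indicator {s<..t} u *\<^sub>R f u x) \<in> borel_measurable (lborel \<Otimes>\<^sub>M Q)"
      using f' by measurable
    show "emeasure (lborel \<Otimes>\<^sub>M Q) ({s<..t} \<times> space Q) < \<infinity>"
      by (cases "s \<le> t") (auto simp: Q.emeasure_pair_measure_Times Q.emeasure_space_1)
    show "AE x in lborel \<Otimes>\<^sub>M Q. x \<in> {s<..t} \<times> space Q \<longrightarrow>
        norm (case x of (u, x) \<Rightarrow> indicator {s<..t} u *\<^sub>R f u x) \<le> B"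
      using B by auto
    show "AE x in lborel \<Otimes>\<^sub>M Q. x \<notin> {s<..t} \<times> space Q \<longrightarrow>
        (case x of (u, x) \<Rightarrow> indicator {s<..t} u *\<^sub>R f u x) = 0"
      by (rule AE_I2) (auto simp: space_pair_measure indicator_def)
  qed auto
  have "integrable lborel (\<lambda>u. \<integral>x. indicator {s<..t} u *\<^sub>R f u x \<partial>Q)"
    using integrable_fst'[OF int] by simp
  then show "set_integrable lborel {s<..t} (\<lambda>u. \<integral>x. f u x \<partial>Q)"
    by (simp add: set_integrable_def)
  show "(\<integral>x. (LBINT u:{s<..t}. f u x) \<partial>Q) = (LBINT u:{s<..t}. (\<integral>x. f u x \<partial>Q))"
    using Fubini_integral[OF int] by (simp add: set_lebesgue_integral_def)
  show "integrable Q (\<lambda>x. LBINT u:{s<..t}. f u x)"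
    using integrable_snd[OF int] by (simp add: set_lebesgue_integral_def)
qed

lemma set_integral_abs_bound:
  fixes f :: "real \<Rightarrow> real"
  assumes "f \<in> borel_measurable borel" "\<And>u. s < u \<Longrightarrow> u \<le> t \<Longrightarrow> \<bar>f u\<bar> \<le> B" "s \<le> t"
  shows "\<bar>LBINT u:{s<..t}. f u\<bar> \<le> B * (t - s)"
proof -
  have "\<bar>LBINT u:{s<..t}. f u\<bar> \<le> (LBINT u:{s<..t}. \<bar>f u\<bar>)"
    using set_integral_norm_bound[OF set_integrable_bounded[OF assms(1,2)]] by simp
  also have "\<dots> \<le> (LBINT u:{s<..t}. B)"
    by (rule set_integral_mono) (use assms in \<open>auto intro!: set_integrable_bounded\<close>)
  also have "\<dots> = B * (t - s)"
    using assms(3) by (simp add: set_integral_const)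
  finally show ?thesis .
qed

lemma abs_mult_le:
  fixes a b :: real
  assumes "\<bar>a\<bar> \<le> K" "\<bar>b\<bar> \<le> B"
  shows "\<bar>a * b\<bar> \<le> K * B"
  unfolding abs_mult using assms by (intro mult_mono) auto

lemma (in prob_space) abs_expectation_le:
  fixes h :: "'a \<Rightarrow> real"
  assumes "integrable M h" "\<And>x. x \<in> space M \<Longrightarrow> \<bar>h x\<bar> \<le> K"
  shows "\<bar>expectation h\<bar> \<le> K"
proof -
  have "\<bar>expectation h\<bar> \<le> expectation (\<lambda>x. \<bar>h x\<bar>)" by (rule integral_abs_bound)
  also have "\<dots> \<le> expectation (\<lambda>x. K)"
    using assms by (intro Bochner_Integration.integral_mono) auto
  finally show ?thesis by (simp add: prob_space)
qed

lemma measurable_section: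
  assumes "(\<lambda>(u, x). f u x) \<in> borel_measurable (borel \<Otimes>\<^sub>M M)"
  shows "f u \<in> borel_measurable M"
  using measurable_compose[OF measurable_Pair1' assms, of u] by simp

text \<open>For each localizing time the martingale property is tested against the bounded
  \<open>G\<close>. Boundedness of \<open>M\<close> and \<open>G\<close> then lets dominated
  convergence remove the localization.\<close>

lemma bounded_local_martingale_integral:
  assumes P: "prob_space P"
    and X: "\<And>u. 0 \<le> u \<Longrightarrow> u \<le> T \<Longrightarrow> X u \<in> borel_measurable P"
    and lm: "local_martingale_on T P (canonical_filtration T P X) M"
    and st: "0 \<le> s" "s \<le> t" "t \<le> T"
    and M: "\<And>u. 0 \<le> u \<Longrightarrow> u \<le> T \<Longrightarrow> M u \<in> borel_measurable P"
      "\<And>u \<omega>. 0 \<le> u \<Longrightarrow> u \<le> T \<Longrightarrow> \<omega> \<in> space P \<Longrightarrow> \<bar>M u \<omega>\<bar> \<le> B"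
    and G: "G \<in> borel_measurable (canonical_filtration T P X s)"
      "\<And>\<omega>. \<omega> \<in> space P \<Longrightarrow> \<bar>G \<omega>\<bar> \<le> K"
  shows "(\<integral>\<omega>. G \<omega> * M t \<omega> \<partial>P) = (\<integral>\<omega>. G \<omega> * M s \<omega> \<partial>P)"
proof -
  interpret prob_space P by fact
  let ?F = "canonical_filtration T P X"
  obtain \<tau> :: "nat \<Rightarrow> 'a \<Rightarrow> real" where \<tau>: "\<And>n \<omega>. \<omega> \<in> space P \<Longrightarrow> 0 \<le> \<tau> n \<omega>"
      "AE \<omega> in P. incseq (\<lambda>n. \<tau> n \<omega>) \<and> (\<exists>n. T \<le> \<tau> n \<omega>)"
      "\<And>n. martingale_on T P ?F (\<lambda>t \<omega>. M (min t (\<tau> n \<omega>)) \<omega>)"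
    using lm unfolding local_martingale_on_def by blast
  have sub: "subalgebra P (?F s)"
    using X st by (intro subalgebra_canonical_filtration) auto
  interpret finite_measure_subalgebra P "?F s"
    by unfold_locales (rule sub)
  have GP: "G \<in> borel_measurable P" using measurable_from_subalg[OF sub G(1)] .
  have int: "integrable P (\<lambda>\<omega>. M (min u (\<tau> n \<omega>)) \<omega>)" if "u \<in> {0..T}" for u n
    using \<tau>(3)[of n] that unfolding martingale_on_def by blast
  have bd: "\<bar>M (min u (\<tau> n \<omega>)) \<omega>\<bar> \<le> B" if "u \<in> {0..T}" "\<omega> \<in> space P" for u n \<omega>
    using M(2)[of "min u (\<tau> n \<omega>)" \<omega>] \<tau>(1) that by auto
  have eq: "(\<integral>\<omega>. G \<omega> * M (min t (\<tau> n \<omega>)) \<omega> \<partial>P) = (\<integral>\<omega>. G \<omega> * M (min s (\<tau> n \<omega>)) \<omega> \<partial>P)" for n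
  proof -
    let ?c = "real_cond_exp P (?F s) (\<lambda>\<omega>. M (min t (\<tau> n \<omega>)) \<omega>)"
    have "integrable P (\<lambda>\<omega>. G \<omega> * M (min t (\<tau> n \<omega>)) \<omega>)"
      using int[of t n] bd[of t _ n] GP G(2) st
      by (intro integrable_const_bound[of _ "K * B"]) (auto intro!: AE_I2 abs_mult_le)
    then have "(\<integral>\<omega>. G \<omega> * ?c \<omega> \<partial>P) = (\<integral>\<omega>. G \<omega> * M (min t (\<tau> n \<omega>)) \<omega> \<partial>P)"
      using int[of t n] st G(1) by (intro real_cond_exp_intg(2)) auto
    moreover have "AE \<omega> in P. ?c \<omega> = M (min s (\<tau> n \<omega>)) \<omega>"
      using \<tau>(3)[of n] st unfolding martingale_on_def by auto
    then have "(\<integral>\<omega>. G \<omega> * ?c \<omega> \<partial>P) = (\<integral>\<omega>. G \<omega> * M (min s (\<tau> n \<omega>)) \<omega> \<partial>P)"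
      using int[of s n] st GP by (intro integral_cong_AE) auto
    ultimately show ?thesis by simp
  qed
  have lim: "(\<lambda>n. \<integral>\<omega>. G \<omega> * M (min u (\<tau> n \<omega>)) \<omega> \<partial>P) \<longlonglongrightarrow> (\<integral>\<omega>. G \<omega> * M u \<omega> \<partial>P)" if u: "u \<in> {0..T}" for u
  proof (rule integral_dominated_convergence[where w="\<lambda>_. K * B"])
    show "AE \<omega> in P. (\<lambda>n. G \<omega> * M (min u (\<tau> n \<omega>)) \<omega>) \<longlonglongrightarrow> G \<omega> * M u \<omega>"
      using \<tau>(2)
    proof eventually_elim
      case (elim \<omega>)
      then obtain N where N: "T \<le> \<tau> N \<omega>" by blast
      \<comment> \<open>The localizing times increase and reach \<open>T\<close>, so the stopped
        value is not merely convergent but eventually equal to the unstopped one.\<close>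
      have "min u (\<tau> n \<omega>) = u" if "N \<le> n" for n
        using incseqD[OF conjunct1[OF elim] that] N u by auto
      then have "eventually (\<lambda>n. G \<omega> * M (min u (\<tau> n \<omega>)) \<omega> = G \<omega> * M u \<omega>) sequentially"
        unfolding eventually_sequentially by (intro exI[of _ N]) auto
      then show ?case by (rule tendsto_eventually)
    qed
    show "AE \<omega> in P. norm (G \<omega> * M (min u (\<tau> n \<omega>)) \<omega>) \<le> K * B" for n
      using bd[OF u] G(2) by (auto intro!: AE_I2 abs_mult_le)
  qed (use GP int[OF u] M(1) u in auto)
  show ?thesis
    using LIMSEQ_unique[OF lim[of t] lim[of s, folded eq]] st by auto
qed

text \<open>\<open>L^\<delta> f + g f'\<close> at the point \<open>x\<close> for
  \<open>f x = exp (- (l * x^2))\<close>, where the number \<open>g\<close> stands for the current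
  value of the drift.\<close>

definition gauss_gen :: "real \<Rightarrow> real \<Rightarrow> real \<Rightarrow> real \<Rightarrow> real" where
  "gauss_gen \<delta> l x g = (2 * l\<^sup>2 * x\<^sup>2 - \<delta> * l - 2 * l * x * g) * exp (- (l * x\<^sup>2))"

text \<open>Only the quadratic Taylor polynomial of \<open>exp\<close> is needed: in the constant, 2
  absorbs the term 1, and \<open>4 / l^2\<close> times \<open>(l * y)^2 / 2\<close> is the term
  \<open>2 * y^2\<close>.\<close>

lemma exp_moment_bound:
  fixes y l :: real
  assumes "0 < l" "0 \<le> y"
  shows "(1 + y)\<^sup>2 * exp (- (l * y)) \<le> 2 + 4 / l\<^sup>2"
proof -
  have e: "1 + l * y + (l * y)\<^sup>2 / 2 \<le> exp (l * y)"
    using assms by (intro exp_lower_Taylor_quadratic) auto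
  have "(1 + y)\<^sup>2 \<le> 2 * (1 + y\<^sup>2)"
    using zero_le_power2[of "1 - y"] by (simp add: power2_eq_square algebra_simps)
  also have "\<dots> \<le> (2 + 4 / l\<^sup>2) * (1 + l * y + (l * y)\<^sup>2 / 2)"
    using assms by (simp add: field_simps power2_eq_square)
  also have "\<dots> \<le> (2 + 4 / l\<^sup>2) * exp (l * y)"
    using e by (intro mult_left_mono) auto
  finally show ?thesis
    by (simp add: exp_minus field_simps)
qed

lemma one_plus_square_bounds:
  fixes x :: real
  shows "\<bar>x\<bar> \<le> 1 + x\<^sup>2" "x\<^sup>2 \<le> 1 + x\<^sup>2" "1 \<le> 1 + x\<^sup>2"
    "1 + x\<^sup>2 \<le> (1 + x\<^sup>2)\<^sup>2"
proof -
  have "0 \<le> (\<bar>x\<bar> - 1)\<^sup>2" by simp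
  then show "\<bar>x\<bar> \<le> 1 + x\<^sup>2" by (simp add: power2_eq_square algebra_simps)
  show "1 + x\<^sup>2 \<le> (1 + x\<^sup>2)\<^sup>2" by (rule self_le_power) auto
qed auto

text \<open>A bound uniform in \<open>x\<close> and in \<open>l \<ge> a\<close>. The weight has
  degree four in \<open>x\<close>, which is the degree of the derivative of \<open>gauss_gen\<close>
  in \<open>l\<close>.\<close>

lemma gauss_factor_bound:
  fixes l x :: real
  assumes "0 < a" "a \<le> l"
  shows "(1 + x\<^sup>2)\<^sup>2 * exp (- (l * x\<^sup>2)) \<le> 2 + 4 / a\<^sup>2"
proof -
  have "exp (- (l * x\<^sup>2)) \<le> exp (- (a * x\<^sup>2))" using assms by (simp add: mult_right_mono)
  then have "(1 + x\<^sup>2)\<^sup>2 * exp (- (l * x\<^sup>2)) \<le> (1 + x\<^sup>2)\<^sup>2 * exp (- (a * x\<^sup>2))"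
    by (intro mult_left_mono) auto
  also have "\<dots> \<le> 2 + 4 / a\<^sup>2" using exp_moment_bound[OF assms(1), of "x\<^sup>2"] by simp
  finally show ?thesis .
qed

lemma gauss_factor_bound':
  fixes l x z :: real
  assumes "0 < a" "a \<le> l" "\<bar>z\<bar> \<le> M * (1 + x\<^sup>2)\<^sup>2" "0 \<le> M"
  shows "\<bar>z * exp (- (l * x\<^sup>2))\<bar> \<le> M * (2 + 4 / a\<^sup>2)"
proof -
  have "\<bar>z * exp (- (l * x\<^sup>2))\<bar> \<le> M * (1 + x\<^sup>2)\<^sup>2 * exp (- (l * x\<^sup>2))"
    unfolding abs_mult using assms by (intro mult_mono) auto
  also have "\<dots> \<le> M * (2 + 4 / a\<^sup>2)"
    unfolding mult.assoc using gauss_factor_bound[OF assms(1,2)] assms by (intro mult_left_mono) auto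
  finally show ?thesis .
qed

lemma gauss_poly_bound:
  fixes l x g :: real
  assumes "0 < l" "l \<le> A" "0 \<le> \<delta>" "\<delta> \<le> 1" "\<bar>g\<bar> \<le> C"
  shows "\<bar>2 * l\<^sup>2 * x\<^sup>2 - \<delta> * l - 2 * l * x * g\<bar> \<le> (2 * A\<^sup>2 + A + 2 * A * C) * (1 + x\<^sup>2)"
proof -
  have "\<bar>2 * l\<^sup>2 * x\<^sup>2 - \<delta> * l - 2 * l * x * g\<bar> \<le> \<bar>2 * l\<^sup>2 * x\<^sup>2\<bar> + \<bar>\<delta> * l\<bar> + \<bar>2 * l * x * g\<bar>" by linarith
  also have "\<dots> \<le> 2 * A\<^sup>2 * (1 + x\<^sup>2) + A * (1 + x\<^sup>2) + 2 * (A * ((1 + x\<^sup>2) * C))"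
  proof (intro add_mono)
    have "l\<^sup>2 * x\<^sup>2 \<le> A\<^sup>2 * (1 + x\<^sup>2)"
      using assms by (intro mult_mono power_mono) auto
    then show "\<bar>2 * l\<^sup>2 * x\<^sup>2\<bar> \<le> 2 * A\<^sup>2 * (1 + x\<^sup>2)" by (simp add: abs_mult)
    have "\<delta> * l \<le> 1 * A" using assms by (intro mult_mono) auto
    also have "\<dots> \<le> A * (1 + x\<^sup>2)" using assms by simp
    finally show "\<bar>\<delta> * l\<bar> \<le> A * (1 + x\<^sup>2)" using assms by (simp add: abs_mult)
    have "l * (\<bar>x\<bar> * \<bar>g\<bar>) \<le> A * ((1 + x\<^sup>2) * C)"
      using one_plus_square_bounds(1)[of x] assms by (intro mult_mono) auto
    then show "\<bar>2 * l * x * g\<bar> \<le> 2 * (A * ((1 + x\<^sup>2) * C))" using assms(1) by (simp add: abs_mult)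
  qed
  also have "\<dots> = (2 * A\<^sup>2 + A + 2 * A * C) * (1 + x\<^sup>2)" by (simp add: algebra_simps)
  finally show ?thesis .
qed

lemma gauss_gen_bound:
  assumes "0 < a" "a \<le> l" "l \<le> A" "0 \<le> \<delta>" "\<delta> \<le> 1" "\<bar>g\<bar> \<le> C"
  shows "\<bar>gauss_gen \<delta> l x g\<bar> \<le> (2 * A\<^sup>2 + A + 2 * A * C) * (2 + 4 / a\<^sup>2)"
  unfolding gauss_gen_def
proof (rule gauss_factor_bound')
  show M: "0 \<le> 2 * A\<^sup>2 + A + 2 * A * C" using assms by (intro add_nonneg_nonneg mult_nonneg_nonneg) auto
  have "\<bar>2 * l\<^sup>2 * x\<^sup>2 - \<delta> * l - 2 * l * x * g\<bar> \<le> (2 * A\<^sup>2 + A + 2 * A * C) * (1 + x\<^sup>2)"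
    using assms by (intro gauss_poly_bound) auto
  also have "\<dots> \<le> (2 * A\<^sup>2 + A + 2 * A * C) * (1 + x\<^sup>2)\<^sup>2"
    using M one_plus_square_bounds(4)[of x] by (intro mult_left_mono) auto
  finally show "\<bar>2 * l\<^sup>2 * x\<^sup>2 - \<delta> * l - 2 * l * x * g\<bar> \<le> (2 * A\<^sup>2 + A + 2 * A * C) * (1 + x\<^sup>2)\<^sup>2" .
qed (use assms in auto)

lemma measurable_gauss_gen [measurable]:
  assumes [measurable]: "h \<in> borel_measurable M" "f \<in> borel_measurable M" "g \<in> borel_measurable M"
  shows "(\<lambda>x. gauss_gen \<delta> (h x) (f x) (g x)) \<in> borel_measurable M"
  unfolding gauss_gen_def by measurable

lemma sample_path_in_mspace:
  assumes "continuous_on {0..T} (\<lambda>t. X t \<omega>)"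
  shows "sample_path T X \<omega> \<in> mspace (path_metric T)"
proof -
  have "continuous_on {0..T} (sample_path T X \<omega>)"
    by (rule continuous_on_eq[OF assms]) (simp add: sample_path_def)
  then show ?thesis by (simp add: mspace_path_metric sample_path_def)
qed

lemma drift_bound:
  assumes "\<And>p. p \<in> stopped_paths T \<Longrightarrow> \<bar>\<Gamma> p\<bar> \<le> C" "0 \<le> C" "\<eta> \<in> space (path_borel T)"
  shows "\<bar>drift T \<Gamma> u \<eta>\<bar> \<le> C"
proof (cases "u \<in> {0..T}")
  case True
  then have "(u, stopped_path T u \<eta>) \<in> stopped_paths T"
    using assms(3) by (auto simp: stopped_paths_def space_path_borel)
  then show ?thesis using assms True by (simp add: drift_def)
qed (use assms in \<open>auto simp: drift_def\<close>)

locale bounded_drift =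
  fixes T \<delta> C :: real and \<Gamma> :: "real \<times> (real \<Rightarrow> real) \<Rightarrow> real"
  assumes T: "0 < T" and \<delta>: "0 \<le> \<delta>" "\<delta> \<le> 1"
    and \<Gamma>: "\<Gamma> \<in> borel_measurable (stopped_paths_borel T)"
    and C: "\<And>p. p \<in> stopped_paths T \<Longrightarrow> \<bar>\<Gamma> p\<bar> \<le> C" "0 < C"
begin

abbreviation b :: "real \<Rightarrow> (real \<Rightarrow> real) \<Rightarrow> real" where
  "b \<equiv> drift T \<Gamma>"

lemma b_bound: "\<eta> \<in> space (path_borel T) \<Longrightarrow> \<bar>b u \<eta>\<bar> \<le> C"
  using C by (intro drift_bound) auto

lemma b_joint: "(\<lambda>(u, \<eta>). b u \<eta>) \<in> borel_measurable (borel \<Otimes>\<^sub>M path_borel T)"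
  using T \<Gamma> by (intro measurable_drift_joint) auto

lemma eval_joint: "(\<lambda>(u, \<eta>). \<eta> u) \<in> borel_measurable (borel \<Otimes>\<^sub>M path_borel T)"
  using T by (intro measurable_eval_joint) auto

lemma pair_measurable [measurable]:
  "(\<lambda>p. snd p (fst p)) \<in> borel_measurable (borel \<Otimes>\<^sub>M path_borel T)"
  "(\<lambda>p. b (fst p) (snd p)) \<in> borel_measurable (borel \<Otimes>\<^sub>M path_borel T)"
  using eval_joint b_joint by (simp_all add: case_prod_beta')

lemma gauss_gen_joint:
  "(\<lambda>(u, \<eta>). gauss_gen \<delta> l (\<eta> u) (b u \<eta>)) \<in> borel_measurable (borel \<Otimes>\<^sub>M path_borel T)"
  unfolding case_prod_beta' by measurable

text \<open>The martingale problem reduced to expectations on path space: Gaussian test functions,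
  increments tested against bounded functionals of the past. As a property of the law it makes
  solutions on different probability spaces comparable; start and sign are dealt with
  separately.\<close>

definition gauss_solution :: "(real \<Rightarrow> real) measure \<Rightarrow> bool" where
  "gauss_solution Q \<longleftrightarrow> prob_space Q \<and> sets Q = sets (path_borel T) \<and>
    (\<forall>l s t G K. 0 < l \<and> 0 \<le> s \<and> s \<le> t \<and> t \<le> T \<and> G \<in> borel_measurable (path_filtration T s) \<and>
       (\<forall>\<eta>\<in>space (path_borel T). \<bar>G \<eta>\<bar> \<le> K) \<longrightarrow>
       (\<integral>\<eta>. G \<eta> * (exp (- (l * (\<eta> t)\<^sup>2)) - exp (- (l * (\<eta> s)\<^sup>2))) \<partial>Q) =
       (LBINT u:{s<..t}. (\<integral>\<eta>. G \<eta> * gauss_gen \<delta> l (\<eta> u) (b u \<eta>) \<partial>Q)))"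

text \<open>The process of the martingale problem is a bounded functional of the sample path, so the
  identity for bounded local martingales can be pushed forward along \<open>sample_path\<close>;
  Fubini then moves the expectation inside the time integral.\<close>

lemma gauss_solution_path_law:
  assumes sol: "solves_martingale_problem T \<delta> \<Gamma> x0 P X" and x0: "0 \<le> x0"
  shows "gauss_solution (path_law T P X)"
proof -
  interpret P: prob_space P using sol by (simp add: solves_martingale_problem_def)
  let ?S = "sample_path T X" and ?Q = "path_law T P X"
  have X: "\<And>t. t \<in> {0..T} \<Longrightarrow> X t \<in> borel_measurable P"
    "\<And>\<omega>. \<omega> \<in> space P \<Longrightarrow> continuous_on {0..T} (\<lambda>t. X t \<omega>)"
    "\<And>\<omega> t. \<omega> \<in> space P \<Longrightarrow> t \<in> {0..T} \<Longrightarrow> 0 \<le> X t \<omega>"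
    using sol by (auto simp: solves_martingale_problem_def)
  have S[measurable]: "?S \<in> measurable P (path_borel T)"
  proof (rule measurable_path_borel)
    fix u assume "u \<in> {0..T}"
    then show "(\<lambda>\<omega>. ?S \<omega> u) \<in> borel_measurable P" using X(1)[of u] by (simp add: sample_path_def)
  qed (use T sample_path_in_mspace[OF X(2)] in auto)
  have setsQ[simp, measurable_cong]: "sets ?Q = sets (path_borel T)" by (simp add: path_law_def)
  have Q: "prob_space ?Q" unfolding path_law_def by (rule P.prob_space_distr[OF S])
  then interpret Q: prob_space ?Q .
  have spQ: "space ?Q = space (path_borel T)" by (rule sets_eq_imp_space_eq) simp
  have intQ: "(\<integral>\<eta>. f \<eta> \<partial>?Q) = (\<integral>\<omega>. f (?S \<omega>) \<partial>P)" if "f \<in> borel_measurable (path_borel T)" for f :: "_ \<Rightarrow> real"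
    unfolding path_law_def by (rule integral_distr[OF S that])
  have jQ: "measurable (borel \<Otimes>\<^sub>M ?Q) N = measurable (borel \<Otimes>\<^sub>M path_borel T) N" for N
    by (intro measurable_cong_sets sets_pair_measure_cong) simp_all
  have "(\<integral>\<eta>. G \<eta> * (exp (- (l * (\<eta> t)\<^sup>2)) - exp (- (l * (\<eta> s)\<^sup>2))) \<partial>?Q) =
       (LBINT u:{s<..t}. (\<integral>\<eta>. G \<eta> * gauss_gen \<delta> l (\<eta> u) (b u \<eta>) \<partial>?Q))"
    if l: "0 < l" and st: "0 \<le> s" "s \<le> t" "t \<le> T" and G: "G \<in> borel_measurable (path_filtration T s)"
      and K: "\<forall>\<eta>\<in>space (path_borel T). \<bar>G \<eta>\<bar> \<le> K" for l s t G K
  proof -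
    define B where "B = (2 * l\<^sup>2 + l + 2 * l * C) * (2 + 4 / l\<^sup>2)"
    have B0: "0 \<le> B" using l C by (auto simp: B_def intro!: mult_nonneg_nonneg add_nonneg_nonneg)
    have gB: "\<bar>gauss_gen \<delta> l x g\<bar> \<le> B" if "\<bar>g\<bar> \<le> C" for x g
      unfolding B_def by (rule gauss_gen_bound[OF l order_refl order_refl \<delta> that])
    define A where "A = (\<lambda>u \<eta>. gauss_gen \<delta> l (\<eta> u) (b u \<eta>))"
    have AB: "\<bar>A u \<eta>\<bar> \<le> B" if "\<eta> \<in> space (path_borel T)" for u \<eta>
      unfolding A_def by (rule gB[OF b_bound[OF that]])
    have Aj: "(\<lambda>(u, \<eta>). A u \<eta>) \<in> borel_measurable (borel \<Otimes>\<^sub>M path_borel T)"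
      unfolding A_def by (rule gauss_gen_joint)
    have sec: "(\<lambda>u. f u \<eta>) \<in> borel_measurable borel"
      if "(\<lambda>(u, \<eta>). f u \<eta>) \<in> borel_measurable (borel \<Otimes>\<^sub>M path_borel T)" "\<eta> \<in> space (path_borel T)"
      for f :: "real \<Rightarrow> (real \<Rightarrow> real) \<Rightarrow> real" and \<eta>
      using measurable_compose[OF measurable_Pair2'[OF that(2)] that(1)] by simp
    \<comment> \<open>The process of the martingale problem, written as a functional on path
      space.\<close>
    define N where "N = (\<lambda>u \<eta>. exp (- (l * (\<eta> u)\<^sup>2)) - exp (- (l * x0\<^sup>2)) - (LBINT v:{0<..u}. A v \<eta>))"
    have Im: "(\<lambda>\<eta>. LBINT v:{r<..u}. A v \<eta>) \<in> borel_measurable (path_borel T)" for r u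
    proof -
      \<comment> \<open>Measurability of the time integral is a by-product of Fubini under the law,
        whose sigma-algebra is that of path space.\<close>
      have "integrable ?Q (\<lambda>\<eta>. LBINT v:{r<..u}. A v \<eta>)"
        using Aj AB by (intro time_fubini(3)[OF Q, where B=B]) (simp_all add: jQ spQ)
      then have "(\<lambda>\<eta>. LBINT v:{r<..u}. A v \<eta>) \<in> borel_measurable ?Q" by (rule borel_measurable_integrable)
      then show ?thesis by (simp add: measurable_cong_sets[OF setsQ refl])
    qed
    have ev: "(\<lambda>\<eta>. \<eta> u) \<in> borel_measurable (path_borel T)" if "u \<in> {0..T}" for u
      using T that by (intro measurable_path_eval) auto
    have Nm: "N u \<in> borel_measurable (path_borel T)" if "u \<in> {0..T}" for u
      unfolding N_def using Im ev[OF that] by (intro borel_measurable_diff borel_measurable_const) auto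
    have Nb: "\<bar>N u \<eta>\<bar> \<le> 2 + B * T" if "u \<in> {0..T}" "\<eta> \<in> space (path_borel T)" for u \<eta>
    proof -
      have "\<bar>LBINT v:{0<..u}. A v \<eta>\<bar> \<le> B * (u - 0)"
        using that sec[OF Aj that(2)] AB[OF that(2)] by (intro set_integral_abs_bound) auto
      also have "\<dots> \<le> B * T" using B0 that by (intro mult_left_mono) auto
      finally have 1: "\<bar>LBINT v:{0<..u}. A v \<eta>\<bar> \<le> B * T" .
      have "0 < exp (- (l * x\<^sup>2))" "exp (- (l * x\<^sup>2)) \<le> 1" for x using l by auto
      from this[of "\<eta> u"] this[of x0] 1 show ?thesis unfolding N_def by linarith
    qed
    let ?f = "restrict (\<lambda>x. exp (- (l * x\<^sup>2))) {0..}"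
    have mp: "mp_process T \<delta> \<Gamma> x0 X ?f u \<omega> = N u (?S \<omega>)" if u: "u \<in> {0..T}" and \<omega>: "\<omega> \<in> space P" for u \<omega>
    proof -
      let ?\<eta> = "?S \<omega>"
      have \<eta>: "?\<eta> \<in> space (path_borel T)" using measurable_space[OF S \<omega>] .
      have \<eta>X: "?\<eta> v = X v \<omega>" if "v \<in> {0..u}" for v using that u by (simp add: sample_path_def)
      have nn: "0 \<le> X v \<omega>" if "v \<in> {0..u}" for v using X(3)[OF \<omega>] that u by simp
      have m1: "(\<lambda>v. ?\<eta> v) \<in> borel_measurable borel" by (rule sec[OF eval_joint \<eta>])
      \<comment> \<open>\<open>A1\<close> is the operator part, i.e. drift value 0, and
        \<open>A2\<close> the drift part, matching the two integrals of \<open>mp_process\<close>.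
        Integrability of \<open>A2\<close> follows by subtraction.\<close>
      define A1 where "A1 = (\<lambda>v. gauss_gen \<delta> l (?\<eta> v) 0)"
      define A2 where "A2 = (\<lambda>v. - (2 * l * ?\<eta> v) * exp (- (l * (?\<eta> v)\<^sup>2)) * b v ?\<eta>)"
      have A12: "A v ?\<eta> = A1 v + A2 v" for v
        by (simp add: A_def A1_def A2_def gauss_gen_def algebra_simps)
      have A1i: "set_integrable lborel {0<..u} A1"
        unfolding A1_def using m1 gB[of 0] C by (intro set_integrable_bounded[of _ _ _ B]) auto
      have "set_integrable lborel {0<..u} (\<lambda>v. A v ?\<eta>)"
        using sec[OF Aj \<eta>] AB[OF \<eta>] by (intro set_integrable_bounded[of _ _ _ B]) auto
      from set_integral_diff(1)[OF this A1i] have A2i: "set_integrable lborel {0<..u} A2"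
        by (simp add: A12)
      \<comment> \<open>\<open>mp_process\<close> integrates over closed intervals; the left end
        point is a null set.\<close>
      have z: "(LBINT v:{0..u}. h v) = (LBINT v:{0<..u}. h v)" for h :: "real \<Rightarrow> real"
        unfolding set_lebesgue_integral_def
        by (rule integral_discrete_difference[of "{0}"]) (auto simp: indicator_def)
      have "(LBINT v:{0..u}. bessel_op_nonneg \<delta> ?f (X v \<omega>)) = (LBINT v:{0..u}. A1 v)"
        using gauss_in_bessel_domain_nonneg(2)[OF \<delta> nn] \<eta>X
        by (intro set_lebesgue_integral_cong) (auto simp: A1_def gauss_gen_def)
      moreover have "(LBINT v:{0..u}. vector_derivative ?f (at (X v \<omega>) within {0..}) *
                        extend_functional T \<Gamma> v ?\<eta>) = (LBINT v:{0..u}. A2 v)"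
        using vector_derivative_gauss_nonneg[OF nn] \<eta>X u
        by (intro set_lebesgue_integral_cong) (auto simp: A2_def drift_def extend_functional_def)
      ultimately have "mp_process T \<delta> \<Gamma> x0 X ?f u \<omega> =
         ?f (X u \<omega>) - ?f x0 - (LBINT v:{0<..u}. A1 v) - (LBINT v:{0<..u}. A2 v)"
        by (simp only: mp_process_def z)
      also have "\<dots> = N u ?\<eta>"
        using set_integral_add(2)[OF A1i A2i] x0 nn[of u] \<eta>X[of u] u by (simp add: N_def A12)
      finally show ?thesis .
    qed
    have GP: "G \<in> borel_measurable (path_borel T)"
      using T by (intro measurable_path_filtration_path_borel[OF _ G]) auto
    have "(\<integral>\<omega>. G (?S \<omega>) * mp_process T \<delta> \<Gamma> x0 X ?f t \<omega> \<partial>P) = (\<integral>\<omega>. G (?S \<omega>) * mp_process T \<delta> \<Gamma> x0 X ?f s \<omega> \<partial>P)"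
    proof (rule bounded_local_martingale_integral[where B="2 + B * T" and K=K])
      show "prob_space P" by (rule P.prob_space_axioms)
      show "local_martingale_on T P (canonical_filtration T P X) (mp_process T \<delta> \<Gamma> x0 X ?f)"
        using sol gauss_in_bessel_domain_nonneg(1)[OF \<delta>] by (simp add: solves_martingale_problem_def)
      show "mp_process T \<delta> \<Gamma> x0 X ?f u \<in> borel_measurable P" if "0 \<le> u" "u \<le> T" for u
        using measurable_compose[OF S Nm[of u]] mp[of u] that by (subst measurable_cong[where g="\<lambda>\<omega>. N u (?S \<omega>)"]) auto
      \<comment> \<open>Functionals of the path up to \<open>s\<close> pull back to the canonical
        filtration of \<open>X\<close> at \<open>s\<close>, which makes \<open>G\<close> an
        admissible test variable on the original space.\<close>
      have "?S \<in> measurable (canonical_filtration T P X s) (path_filtration T s)"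
      proof (rule measurable_canonical_filtration)
        fix v assume v: "0 \<le> v" "v \<le> s" "v \<le> T"
        then show "(\<lambda>\<omega>. ?S \<omega> v) \<in> borel_measurable (canonical_filtration T P X s)"
          using canonical_filtration_eval[of v s T X P] by (simp add: sample_path_def)
      qed (use measurable_space[OF S] in simp)
      then show "(\<lambda>\<omega>. G (?S \<omega>)) \<in> borel_measurable (canonical_filtration T P X s)"
        by (rule measurable_compose[OF _ G])
      show "\<bar>mp_process T \<delta> \<Gamma> x0 X ?f u \<omega>\<bar> \<le> 2 + B * T" if "0 \<le> u" "u \<le> T" "\<omega> \<in> space P" for u \<omega>
        unfolding mp[of u \<omega>, OF _ that(3), unfolded atLeastAtMost_iff, OF conjI[OF that(1,2)]]
        using that Nb measurable_space[OF S] by simp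
    qed (use X(1) st K measurable_space[OF S] in auto)
    then have "(\<integral>\<omega>. G (?S \<omega>) * N t (?S \<omega>) \<partial>P) = (\<integral>\<omega>. G (?S \<omega>) * N s (?S \<omega>) \<partial>P)"
      using st by (simp add: mp cong: Bochner_Integration.integral_cong)
    then have e: "(\<integral>\<eta>. G \<eta> * N t \<eta> \<partial>?Q) = (\<integral>\<eta>. G \<eta> * N s \<eta> \<partial>?Q)"
      using intQ[of "\<lambda>\<eta>. G \<eta> * N t \<eta>"] intQ[of "\<lambda>\<eta>. G \<eta> * N s \<eta>"] GP Nm st by auto
    have Nd: "N t \<eta> - N s \<eta> = exp (- (l * (\<eta> t)\<^sup>2)) - exp (- (l * (\<eta> s)\<^sup>2)) - (LBINT u:{s<..t}. A u \<eta>)"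
      if "\<eta> \<in> space (path_borel T)" for \<eta>
    proof -
      have "{0<..t} = {0<..s} \<union> {s<..t}" using st by auto
      moreover have "set_integrable lborel {r<..u} (\<lambda>v. A v \<eta>)" for r u
        using sec[OF Aj that] AB[OF that] by (intro set_integrable_bounded[of _ _ _ B]) auto
      ultimately have "(LBINT u:{0<..t}. A u \<eta>) = (LBINT u:{0<..s}. A u \<eta>) + (LBINT u:{s<..t}. A u \<eta>)"
        by (simp add: set_integral_Un)
      then show ?thesis by (simp add: N_def)
    qed
    have iN: "integrable ?Q (\<lambda>\<eta>. G \<eta> * N u \<eta>)" if "u \<in> {0..T}" for u
      using K Nb[OF that] Nm[OF that] GP spQ
      by (intro Q.integrable_const_bound[of _ "K * (2 + B * T)"]) (auto intro!: AE_I2 abs_mult_le)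
    have iE: "integrable ?Q (\<lambda>\<eta>. G \<eta> * (exp (- (l * (\<eta> t)\<^sup>2)) - exp (- (l * (\<eta> s)\<^sup>2))))"
    proof (rule Q.integrable_const_bound[of _ "K * 2"])
      have "\<bar>exp (- (l * x\<^sup>2)) - exp (- (l * y\<^sup>2))\<bar> \<le> 2" for x y
      proof -
        have "0 < exp (- (l * x\<^sup>2))" "exp (- (l * x\<^sup>2)) \<le> 1" for x using l by auto
        from this[of x] this[of y] show ?thesis by linarith
      qed
      then show "AE \<eta> in ?Q. norm (G \<eta> * (exp (- (l * (\<eta> t)\<^sup>2)) - exp (- (l * (\<eta> s)\<^sup>2)))) \<le> K * 2"
        using K spQ by (auto intro!: AE_I2 abs_mult_le)
      show "(\<lambda>\<eta>. G \<eta> * (exp (- (l * (\<eta> t)\<^sup>2)) - exp (- (l * (\<eta> s)\<^sup>2)))) \<in> borel_measurable ?Q"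
        using GP ev[of s] ev[of t] st by auto
    qed
    have "0 = (\<integral>\<eta>. G \<eta> * N t \<eta> - G \<eta> * N s \<eta> \<partial>?Q)"
      using e iN st by (subst Bochner_Integration.integral_diff) auto
    also have "\<dots> = (\<integral>\<eta>. G \<eta> * (exp (- (l * (\<eta> t)\<^sup>2)) - exp (- (l * (\<eta> s)\<^sup>2))) - (LBINT u:{s<..t}. G \<eta> * A u \<eta>) \<partial>?Q)"
      using Nd spQ by (intro Bochner_Integration.integral_cong) (auto simp: right_diff_distrib[symmetric])
    also have "\<dots> = (\<integral>\<eta>. G \<eta> * (exp (- (l * (\<eta> t)\<^sup>2)) - exp (- (l * (\<eta> s)\<^sup>2))) \<partial>?Q) -
      (LBINT u:{s<..t}. (\<integral>\<eta>. G \<eta> * A u \<eta> \<partial>?Q))"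
    proof -
      have GA: "(\<lambda>(u, \<eta>). G \<eta> * A u \<eta>) \<in> borel_measurable (borel \<Otimes>\<^sub>M ?Q)"
        unfolding jQ using Aj GP by measurable
      have GAB: "\<bar>G \<eta> * A u \<eta>\<bar> \<le> K * B" if "\<eta> \<in> space ?Q" for u \<eta>
        using that K AB spQ by (intro abs_mult_le) auto
      note F = time_fubini[OF Q GA GAB, of s t]
      show ?thesis using iE F(2,3) by (subst Bochner_Integration.integral_diff) auto
    qed
    finally show ?thesis by (simp add: A_def)
  qed
  then show ?thesis unfolding gauss_solution_def using Q setsQ by blast
qed

end

section \<open>Time-dependent Gaussian functions\<close>

lemma DERIV_0_quadratic:
  fixes K :: "real \<Rightarrow> real"
  assumes "\<And>y. y \<in> S \<Longrightarrow> \<bar>K y - K s\<bar> \<le> L * (y - s)\<^sup>2"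
  shows "(K has_real_derivative 0) (at s within S)"
  unfolding has_field_derivative_iff
proof (rule Lim_null_comparison)
  show "eventually (\<lambda>y. norm ((K y - K s) / (y - s)) \<le> L * \<bar>y - s\<bar>) (at s within S)"
    unfolding eventually_at_topological
  proof (intro exI[of _ UNIV] conjI ballI impI)
    fix y assume y: "y \<noteq> s" "y \<in> S"
    have "\<bar>K y - K s\<bar> \<le> L * \<bar>y - s\<bar> * \<bar>y - s\<bar>"
      using assms[OF y(2)] by (simp add: power2_eq_square mult.assoc abs_mult_self_eq)
    then show "norm ((K y - K s) / (y - s)) \<le> L * \<bar>y - s\<bar>"
      using y(1) by (simp add: divide_le_eq abs_divide)
  qed auto
  have "((\<lambda>y. L * \<bar>y - s\<bar>) \<longlongrightarrow> L * \<bar>s - s\<bar>) (at s within S)"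
    by (intro tendsto_intros)
  then show "((\<lambda>y. L * \<bar>y - s\<bar>) \<longlongrightarrow> 0) (at s within S)" by simp
qed

text \<open>A chain rule for \<open>t \<mapsto> F t t\<close> in which \<open>F\<close> is only absolutely continuous in its first
  argument: the Lipschitz condition replaces continuity of the density \<open>\<beta>\<close> in time.\<close>

lemma diagonal_chain_rule:
  fixes F \<beta> :: "real \<Rightarrow> real \<Rightarrow> real" and \<gamma> :: "real \<Rightarrow> real"
  assumes "r \<le> q"
    and inc: "\<And>s t x. r \<le> s \<Longrightarrow> s \<le> t \<Longrightarrow> t \<le> q \<Longrightarrow> x \<in> {r..q} \<Longrightarrow> F t x - F s x = (LBINT u:{s<..t}. \<beta> u x)"
    and \<beta>m: "\<And>x. (\<lambda>u. \<beta> u x) \<in> borel_measurable borel" and \<beta>d: "(\<lambda>u. \<beta> u u) \<in> borel_measurable borel"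
    and \<beta>b: "\<And>u x. u \<in> {r..q} \<Longrightarrow> x \<in> {r..q} \<Longrightarrow> \<bar>\<beta> u x\<bar> \<le> B"
    and lip: "\<And>u x y. u \<in> {r..q} \<Longrightarrow> x \<in> {r..q} \<Longrightarrow> y \<in> {r..q} \<Longrightarrow> \<bar>\<beta> u x - \<beta> u y\<bar> \<le> L * \<bar>x - y\<bar>"
    and deriv: "\<And>x. x \<in> {r..q} \<Longrightarrow> ((\<lambda>y. F x y) has_real_derivative \<gamma> x) (at x within {r..q})"
    and \<gamma>m: "\<gamma> \<in> borel_measurable borel" and \<gamma>b: "\<And>x. x \<in> {r..q} \<Longrightarrow> \<bar>\<gamma> x\<bar> \<le> B"
  shows "F q q - F r r = (LBINT u:{r<..q}. \<beta> u u + \<gamma> u)"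
proof -
  define I where "I = (\<lambda>t. LBINT u:{r<..t}. \<beta> u u)"
  \<comment> \<open>The diagonal of \<open>F\<close> need not be differentiable, since
    \<open>I\<close> need not be. Subtracting \<open>I\<close> removes the rough part: up to an
    error quadratic in the time step, \<open>J\<close> moves like \<open>F s\<close> near
    \<open>s\<close>.\<close>
  define J where "J = (\<lambda>t. F t t - I t)"
  have int: "set_integrable lborel {s<..t} (\<lambda>u. \<beta> u x)" if "r \<le> s" "t \<le> q" "x \<in> {r..q}" for s t x
    using that \<beta>m \<beta>b by (intro set_integrable_bounded[of _ _ _ B]) auto
  have intd: "set_integrable lborel {s<..t} (\<lambda>u. \<beta> u u)" if "r \<le> s" "t \<le> q" for s t
    using that \<beta>d \<beta>b by (intro set_integrable_bounded[of _ _ _ B]) auto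
  have I: "I t - I s = (LBINT u:{s<..t}. \<beta> u u)" if "r \<le> s" "s \<le> t" "t \<le> q" for s t
  proof -
    have "{r<..t} = {r<..s} \<union> {s<..t}" using that by auto
    then show ?thesis using that intd by (simp add: I_def set_integral_Un)
  qed
  have L0: "0 \<le> L" if "r < q"
  proof -
    have "0 \<le> L * \<bar>r - q\<bar>" using lip[of r r q] that abs_ge_zero order_trans by fastforce
    then show ?thesis using that by (simp add: zero_le_mult_iff)
  qed
  \<comment> \<open>One factor \<open>t - s\<close> is the Lipschitz error of freezing the second
    argument, the other the length of integration. Both end points are allowed for \<open>x\<close>
    so that \<open>s\<close> can be approached from either side.\<close>
  have R: "\<bar>(F t x - F s x) - (I t - I s)\<bar> \<le> L * (t - s)\<^sup>2"
    if st: "r \<le> s" "s \<le> t" "t \<le> q" and x: "x = s \<or> x = t" for s t x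
  proof (cases "s = t")
    case False
    then have "0 \<le> L" using L0 st by auto
    have x': "x \<in> {r..q}" "\<And>u. u \<in> {s..t} \<Longrightarrow> \<bar>x - u\<bar> \<le> t - s" using x st by auto
    have "(F t x - F s x) - (I t - I s) = (LBINT u:{s<..t}. \<beta> u x) - (LBINT u:{s<..t}. \<beta> u u)"
      using inc[OF st x'(1)] I[OF st] by simp
    also have "\<dots> = (LBINT u:{s<..t}. \<beta> u x - \<beta> u u)"
      using int[OF st(1,3) x'(1)] intd[OF st(1,3)] by simp
    also have "\<bar>\<dots>\<bar> \<le> (L * (t - s)) * (t - s)"
    proof (rule set_integral_abs_bound)
      fix u assume u: "s < u" "u \<le> t"
      have "\<bar>\<beta> u x - \<beta> u u\<bar> \<le> L * \<bar>x - u\<bar>" using u st x' by (intro lip) auto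
      also have "\<dots> \<le> L * (t - s)" using \<open>0 \<le> L\<close> u x'(2)[of u] by (intro mult_left_mono) auto
      finally show "\<bar>\<beta> u x - \<beta> u u\<bar> \<le> L * (t - s)" .
    qed (use \<beta>m \<beta>d st in auto)
    finally show ?thesis by (simp add: power2_eq_square mult.assoc)
  qed simp
  have J: "(J has_real_derivative \<gamma> s) (at s within {r..q})" if s: "s \<in> {r..q}" for s
  proof -
    have "((\<lambda>y. J y - F s y) has_real_derivative 0) (at s within {r..q})"
    proof (rule DERIV_0_quadratic)
      fix y assume y: "y \<in> {r..q}"
      have e: "(J y - F s y) - (J s - F s s) = (F y y - F s y) - (I y - I s)" by (simp add: J_def)
      show "\<bar>(J y - F s y) - (J s - F s s)\<bar> \<le> L * (y - s)\<^sup>2"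
      proof (cases "s \<le> y")
        case True
        then show ?thesis unfolding e using R[of s y y] s y by simp
      next
        case False
        then have "\<bar>(F s y - F y y) - (I s - I y)\<bar> \<le> L * (s - y)\<^sup>2" using R[of y s y] s y by simp
        moreover have "(F y y - F s y) - (I y - I s) = - ((F s y - F y y) - (I s - I y))" by simp
        ultimately show ?thesis unfolding e by (simp only: abs_minus_cancel power2_commute[of y s])
      qed
    qed
    from DERIV_add[OF this deriv[OF s]] show ?thesis by simp
  qed
  \<comment> \<open>\<gamma> need not be continuous, so the fundamental theorem is applied to the
    gauge integral; measurability and boundedness turn it into a Lebesgue integral.\<close>
  have "(\<gamma> has_integral J q - J r) {r..q}"
    using assms(1) J by (intro fundamental_theorem_of_calculus)
      (auto simp: has_real_derivative_iff_has_vector_derivative)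
  then have "J q - J r = integral {r..q} \<gamma>" by (simp add: integral_unique)
  also have "\<dots> = (LBINT u:{r..q}. \<gamma> u)"
  proof (rule set_borel_integral_eq_integral(2)[symmetric])
    show "set_integrable lborel {r..q} \<gamma>"
      unfolding set_integrable_def
      using \<gamma>m \<gamma>b assms(1) by (intro integrableI_bounded_set[of "{r..q}" _ _ B]) auto
  qed
  also have "\<dots> = (LBINT u:{r<..q}. \<gamma> u)"
    unfolding set_lebesgue_integral_def
    by (rule integral_discrete_difference[of "{r}"]) (auto simp: indicator_def)
  finally have "F q q - F r r = (LBINT u:{r<..q}. \<beta> u u) + (LBINT u:{r<..q}. \<gamma> u)"
    using assms(1) by (simp add: J_def I_def set_lebesgue_integral_def)
  also have "\<dots> = (LBINT u:{r<..q}. \<beta> u u + \<gamma> u)"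
    using intd[of r q] \<gamma>m \<gamma>b assms(1)
    by (intro set_integral_add(2)[symmetric] set_integrable_bounded[of \<gamma> _ _ B]) auto
  finally show ?thesis .
qed

text \<open>The bound on the derivative makes each path function Lipschitz, which dominates the
  difference quotients.\<close>

lemma DERIV_expectation:
  fixes f f' :: "real \<Rightarrow> 'a \<Rightarrow> real"
  assumes Q: "prob_space Q" and s: "s \<in> {r..q}"
    and f: "\<And>x. x \<in> {r..q} \<Longrightarrow> integrable Q (f x)" and f'm: "f' s \<in> borel_measurable Q"
    and d: "\<And>x \<eta>. x \<in> {r..q} \<Longrightarrow> \<eta> \<in> space Q \<Longrightarrow> ((\<lambda>x. f x \<eta>) has_real_derivative f' x \<eta>) (at x within {r..q})"
    and b: "\<And>x \<eta>. x \<in> {r..q} \<Longrightarrow> \<eta> \<in> space Q \<Longrightarrow> \<bar>f' x \<eta>\<bar> \<le> B"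
  shows "((\<lambda>x. \<integral>\<eta>. f x \<eta> \<partial>Q) has_real_derivative (\<integral>\<eta>. f' s \<eta> \<partial>Q)) (at s within {r..q})"
proof -
  interpret prob_space Q by fact
  have lip: "\<bar>f x \<eta> - f s \<eta>\<bar> \<le> B * \<bar>x - s\<bar>" if "x \<in> {r..q}" "\<eta> \<in> space Q" for x \<eta>
    using field_differentiable_bound[of "{r..q}" "\<lambda>x. f x \<eta>" "\<lambda>x. f' x \<eta>" B x s] d b s that by auto
  show ?thesis
    unfolding has_field_derivative_iff tendsto_at_iff_sequentially
  proof (intro allI impI, unfold o_def)
    fix X :: "nat \<Rightarrow> real" assume X: "\<forall>i. X i \<in> {r..q} - {s}" "X \<longlonglongrightarrow> s"
    have "(\<lambda>n. \<integral>\<eta>. (f (X n) \<eta> - f s \<eta>) / (X n - s) \<partial>Q) \<longlonglongrightarrow> (\<integral>\<eta>. f' s \<eta> \<partial>Q)"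
    proof (rule integral_dominated_convergence[where w="\<lambda>_. B"])
      show "AE \<eta> in Q. (\<lambda>n. (f (X n) \<eta> - f s \<eta>) / (X n - s)) \<longlonglongrightarrow> f' s \<eta>"
        using d[OF s] X unfolding has_field_derivative_iff tendsto_at_iff_sequentially o_def
        by (intro AE_I2) auto
      show "AE \<eta> in Q. norm ((f (X n) \<eta> - f s \<eta>) / (X n - s)) \<le> B" for n
        using lip[of "X n"] X(1) by (intro AE_I2) (auto simp: divide_le_eq abs_divide)
    qed (use f f'm X s in auto)
    moreover have "(\<integral>\<eta>. (f (X n) \<eta> - f s \<eta>) / (X n - s) \<partial>Q) =
      ((\<integral>\<eta>. f (X n) \<eta> \<partial>Q) - (\<integral>\<eta>. f s \<eta> \<partial>Q)) / (X n - s)" for n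
      using f[of "X n"] f[OF s] X(1) by simp
    ultimately show "(\<lambda>n. ((\<integral>\<eta>. f (X n) \<eta> \<partial>Q) - (\<integral>\<eta>. f s \<eta> \<partial>Q)) / (X n - s)) \<longlonglongrightarrow> (\<integral>\<eta>. f' s \<eta> \<partial>Q)"
      by (simp only:)
  qed
qed

text \<open>For the driftless process started from \<open>x\<close> at time \<open>s\<close>, \<open>gflow \<delta> q l s x\<close> is the expectation of
  \<open>exp (- l X\<^sub>q\<^sup>2)\<close>: with \<open>p = riccati q l\<close> and the factor \<open>k\<close> in front of the exponential, the backward equation
  amounts to \<open>p' = 2 p\<^sup>2\<close> and \<open>k' = \<delta> p k\<close>.\<close>

definition riccati :: "real \<Rightarrow> real \<Rightarrow> real \<Rightarrow> real" where
  "riccati q l s = l / (1 + 2 * l * (q - s))"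

definition gflow :: "real \<Rightarrow> real \<Rightarrow> real \<Rightarrow> real \<Rightarrow> real \<Rightarrow> real" where
  "gflow \<delta> q l s x = (1 + 2 * l * (q - s)) powr (- \<delta> / 2) * exp (- (riccati q l s * x\<^sup>2))"

text \<open>The lower bound does not depend on \<open>s\<close> and \<open>q\<close> and is positive
  for \<open>l > 0\<close>, so the Gaussian estimates hold uniformly along the whole flow.\<close>

lemma riccati_bounds:
  assumes "0 \<le> l" "0 \<le> s" "s \<le> q" "q \<le> T"
  shows "0 \<le> riccati q l s" "riccati q l s \<le> l" "l / (1 + 2 * l * T) \<le> riccati q l s"
proof -
  have 1: "1 \<le> 1 + 2 * l * (q - s)" using assms by simp
  have 2: "1 + 2 * l * (q - s) \<le> 1 + 2 * l * T" using assms by (simp add: mult_left_mono)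
  show "0 \<le> riccati q l s" unfolding riccati_def using 1 assms by simp
  show "riccati q l s \<le> l"
    unfolding riccati_def using less_le_trans[OF zero_less_one 1] assms mult_left_mono[OF 1, of l]
    by (simp add: divide_le_eq)
  show "l / (1 + 2 * l * T) \<le> riccati q l s"
    unfolding riccati_def using 1 2 assms by (intro divide_left_mono mult_pos_pos) linarith+
qed

lemma DERIV_riccati:
  assumes "0 \<le> l" "s \<le> q"
  shows "(riccati q l has_real_derivative 2 * (riccati q l s)\<^sup>2) (at s within S)"
proof -
  have "1 + 2 * l * (q - s) > 0" using assms by (intro add_pos_nonneg) auto
  then show ?thesis
    unfolding riccati_def by (auto intro!: derivative_eq_intros simp: power2_eq_square)
qed

lemma DERIV_gflow_factor:
  assumes "0 \<le> l" "s \<le> q"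
  shows "((\<lambda>s. (1 + 2 * l * (q - s)) powr (- \<delta> / 2)) has_real_derivative
     \<delta> * riccati q l s * (1 + 2 * l * (q - s)) powr (- \<delta> / 2)) (at s within S)"
proof -
  have pos: "1 + 2 * l * (q - s) > 0" using assms by (intro add_pos_nonneg) auto
  have "((\<lambda>s. (1 + 2 * l * (q - s)) powr (- \<delta> / 2)) has_real_derivative
     (- \<delta> / 2) * (1 + 2 * l * (q - s)) powr (- \<delta> / 2 - 1) * (- (2 * l))) (at s)"
    using pos by (auto intro!: derivative_eq_intros)
  also have "(1 + 2 * l * (q - s)) powr (- \<delta> / 2 - 1) = (1 + 2 * l * (q - s)) powr (- \<delta> / 2) / (1 + 2 * l * (q - s))"
    using pos by (simp add: powr_diff)
  finally show ?thesis
    by (rule has_field_derivative_at_within[THEN DERIV_cong]) (use pos in \<open>simp add: riccati_def field_simps\<close>)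
qed

lemma gflow_q [simp]: "gflow \<delta> q l q x = exp (- (l * x\<^sup>2))"
  by (simp add: gflow_def riccati_def)

text \<open>The parameter 0 gives the constant 1. Hence identities for products of two flows contain
  those for a single flow.\<close>

lemma gflow_0 [simp]: "gflow \<delta> q 0 s x = 1"
  by (simp add: gflow_def riccati_def)

lemma gflow_factor_bounds:
  fixes l s q \<delta> :: real
  assumes "0 \<le> l" "s \<le> q" "0 \<le> \<delta>"
  shows "0 \<le> (1 + 2 * l * (q - s)) powr (- \<delta> / 2)" "(1 + 2 * l * (q - s)) powr (- \<delta> / 2) \<le> 1"
proof -
  have "1 \<le> 1 + 2 * l * (q - s)" using assms by simp
  then show "(1 + 2 * l * (q - s)) powr (- \<delta> / 2) \<le> 1"
    using assms powr_mono[of "- \<delta> / 2" 0 "1 + 2 * l * (q - s)"] by (simp split: if_splits)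
qed simp

lemma gflow_bounds:
  assumes "0 \<le> l" "0 \<le> s" "s \<le> q" "0 \<le> \<delta>"
  shows "0 \<le> gflow \<delta> q l s x" "gflow \<delta> q l s x \<le> 1"
proof -
  show "0 \<le> gflow \<delta> q l s x" by (simp add: gflow_def)
  have "exp (- (riccati q l s * x\<^sup>2)) \<le> 1" using riccati_bounds(1)[OF assms(1-3) order_refl] by simp
  then show "gflow \<delta> q l s x \<le> 1"
    unfolding gflow_def using gflow_factor_bounds[OF assms(1,3,4)] by (intro mult_le_one) auto
qed

lemma measurable_gflow [measurable]:
  assumes [measurable]: "h \<in> borel_measurable M" "f \<in> borel_measurable M"
  shows "(\<lambda>x. gflow \<delta> q l (h x) (f x)) \<in> borel_measurable M" "(\<lambda>x. riccati q l (h x)) \<in> borel_measurable M"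
  unfolding gflow_def riccati_def by measurable

text \<open>The derivative of \<open>gauss_gen\<close> in its parameter \<open>l\<close>. It
  supplies the Lipschitz condition of the diagonal chain rule, as the parameter moves along the
  flow.\<close>

definition gauss_gen' :: "real \<Rightarrow> real \<Rightarrow> real \<Rightarrow> real \<Rightarrow> real" where
  "gauss_gen' \<delta> l x g = (4 * l * x\<^sup>2 - \<delta> - 2 * x * g - x\<^sup>2 * (2 * l\<^sup>2 * x\<^sup>2 - \<delta> * l - 2 * l * x * g)) * exp (- (l * x\<^sup>2))"

lemma DERIV_gauss_gen:
  "((\<lambda>l. gauss_gen \<delta> l x g) has_real_derivative gauss_gen' \<delta> l x g) (at l within S)"
  unfolding gauss_gen_def gauss_gen'_def
  by (auto intro!: derivative_eq_intros simp: algebra_simps power2_eq_square)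

lemma gauss_gen'_bound:
  assumes "0 < a" "a \<le> l" "l \<le> A" "0 \<le> \<delta>" "\<delta> \<le> 1" "\<bar>g\<bar> \<le> C"
  shows "\<bar>gauss_gen' \<delta> l x g\<bar> \<le> (4 * A + 1 + 2 * C + (2 * A\<^sup>2 + A + 2 * A * C)) * (2 + 4 / a\<^sup>2)"
  unfolding gauss_gen'_def
proof (rule gauss_factor_bound')
  let ?W = "1 + x\<^sup>2" and ?M = "2 * A\<^sup>2 + A + 2 * A * C"
  have C: "0 \<le> C" "0 \<le> A" using assms by linarith+
  show M: "0 \<le> 4 * A + 1 + 2 * C + ?M" using C by (intro add_nonneg_nonneg mult_nonneg_nonneg) auto
  have "\<bar>x\<^sup>2 * (2 * l\<^sup>2 * x\<^sup>2 - \<delta> * l - 2 * l * x * g)\<bar> \<le> ?W * (?M * ?W)"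
    using assms by (intro abs_mult_le gauss_poly_bound) auto
  moreover have "\<bar>4 * l * x\<^sup>2\<bar> \<le> 4 * A * ?W"
    unfolding abs_mult using assms by (intro mult_mono) auto
  moreover have "\<bar>2 * x * g\<bar> \<le> 2 * ?W * C"
    using one_plus_square_bounds(1)[of x] assms by (intro abs_mult_le) auto
  moreover have "\<bar>\<delta>\<bar> \<le> ?W" using assms one_plus_square_bounds(3)[of x] by linarith
  ultimately have "\<bar>4 * l * x\<^sup>2 - \<delta> - 2 * x * g - x\<^sup>2 * (2 * l\<^sup>2 * x\<^sup>2 - \<delta> * l - 2 * l * x * g)\<bar>
    \<le> (4 * A * ?W + ?W + 2 * ?W * C) + ?M * ?W\<^sup>2"
    by (simp only: power2_eq_square[of ?W] mult_ac)
  also have "4 * A * ?W + ?W + 2 * ?W * C = (4 * A + 1 + 2 * C) * ?W" by (simp add: algebra_simps)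
  also have "\<dots> \<le> (4 * A + 1 + 2 * C) * ?W\<^sup>2"
    using C one_plus_square_bounds(4)[of x] by (intro mult_left_mono) auto
  finally show "\<bar>4 * l * x\<^sup>2 - \<delta> - 2 * x * g - x\<^sup>2 * (2 * l\<^sup>2 * x\<^sup>2 - \<delta> * l - 2 * l * x * g)\<bar>
    \<le> (4 * A + 1 + 2 * C + ?M) * ?W\<^sup>2"
    by (simp add: algebra_simps)
qed (use assms in auto)

context bounded_drift
begin

lemma gauss_solutionD:
  assumes "gauss_solution Q"
  shows "prob_space Q" "sets Q = sets (path_borel T)" "space Q = space (path_borel T)"
    "measurable (borel \<Otimes>\<^sub>M Q) N = measurable (borel \<Otimes>\<^sub>M path_borel T) N"
    "measurable Q N = measurable (path_borel T) N"
proof -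
  show "prob_space Q" and s: "sets Q = sets (path_borel T)" using assms by (auto simp: gauss_solution_def)
  show "space Q = space (path_borel T)" by (rule sets_eq_imp_space_eq[OF s])
  show "measurable (borel \<Otimes>\<^sub>M Q) N = measurable (borel \<Otimes>\<^sub>M path_borel T) N"
    by (intro measurable_cong_sets sets_pair_measure_cong) (simp_all add: s)
  show "measurable Q N = measurable (path_borel T) N"
    by (intro measurable_cong_sets) (simp_all add: s)
qed

lemma gauss_solution_identity:
  assumes "gauss_solution Q" "0 < l" "0 \<le> s" "s \<le> t" "t \<le> T" "G \<in> borel_measurable (path_filtration T s)"
    "\<And>\<eta>. \<eta> \<in> space (path_borel T) \<Longrightarrow> \<bar>G \<eta>\<bar> \<le> K"
  shows "(\<integral>\<eta>. G \<eta> * (exp (- (l * (\<eta> t)\<^sup>2)) - exp (- (l * (\<eta> s)\<^sup>2))) \<partial>Q) =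
       (LBINT u:{s<..t}. (\<integral>\<eta>. G \<eta> * gauss_gen \<delta> l (\<eta> u) (b u \<eta>) \<partial>Q))"
  using assms unfolding gauss_solution_def by blast

text \<open>A product of two flows is again a Gaussian, with prefactor \<open>k\<close> and exponent
  \<open>a\<close>, the sum of the two Riccati solutions. By \<open>k' = \<delta> a k\<close> the
  terms with \<delta> cancel; what survives is the product of the two spatial derivatives and the
  drift term.\<close>

lemma gflow_identity:
  assumes Q: "gauss_solution Q" and st: "0 \<le> s" "s \<le> q" "q \<le> T" and l: "0 \<le> l" "0 \<le> l'"
    and G: "G \<in> borel_measurable (path_filtration T s)"
    and K: "\<And>\<eta>. \<eta> \<in> space (path_borel T) \<Longrightarrow> \<bar>G \<eta>\<bar> \<le> K"
  shows "(\<integral>\<eta>. G \<eta> * (gflow \<delta> q l q (\<eta> q) * gflow \<delta> q l' q (\<eta> q)) \<partial>Q) -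
     (\<integral>\<eta>. G \<eta> * (gflow \<delta> q l s (\<eta> s) * gflow \<delta> q l' s (\<eta> s)) \<partial>Q) =
     (LBINT u:{s<..q}. (\<integral>\<eta>. G \<eta> * (gflow \<delta> q l u (\<eta> u) * gflow \<delta> q l' u (\<eta> u) *
        (4 * riccati q l u * riccati q l' u * (\<eta> u)\<^sup>2
         - 2 * (riccati q l u + riccati q l' u) * \<eta> u * b u \<eta>)) \<partial>Q))"
\<comment> \<open>With both parameters 0 everything is constant. Otherwise the exponent
  \<open>a\<close> stays away from 0, on which all bounds below rest.\<close>
proof (cases "l = 0 \<and> l' = 0")
  case True
  then show ?thesis by (simp add: riccati_def)
next
  case False
  interpret Q: prob_space Q using gauss_solutionD(1)[OF Q] .
  note spQ = gauss_solutionD(3)[OF Q] and jQ = gauss_solutionD(4)[OF Q] and mQ = gauss_solutionD(5)[OF Q]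
  define a where "a = (\<lambda>x. riccati q l x + riccati q l' x)"
  define a' where "a' = (\<lambda>x. 2 * (riccati q l x)\<^sup>2 + 2 * (riccati q l' x)\<^sup>2)"
  define k where "k = (\<lambda>x. (1 + 2 * l * (q - x)) powr (- \<delta> / 2) * (1 + 2 * l' * (q - x)) powr (- \<delta> / 2))"
  \<comment> \<open>A lower bound of \<open>a\<close>, positive because at least one of
    \<open>l\<close> and \<open>l'\<close> is.\<close>
  define a0 where "a0 = l / (1 + 2 * l * T) + l' / (1 + 2 * l' * T)"
  define A where "A = l + l'"
  have A0: "0 < A" using False l by (auto simp: A_def)
  have a0: "0 < a0"
  proof -
    have "0 < l / (1 + 2 * l * T) \<or> 0 < l' / (1 + 2 * l' * T)"
      using False l T by (auto simp: zero_less_divide_iff add_pos_nonneg)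
    moreover have "0 \<le> l / (1 + 2 * l * T)" "0 \<le> l' / (1 + 2 * l' * T)" using l T by simp_all
    ultimately show ?thesis unfolding a0_def by linarith
  qed
  have x0: "0 \<le> x" "x \<le> q" if "x \<in> {s..q}" for x using that st by auto
  have a: "a0 \<le> a x" "a x \<le> A" if "x \<in> {s..q}" for x
    using riccati_bounds[OF l(1) x0[OF that] st(3)] riccati_bounds[OF l(2) x0[OF that] st(3)]
    by (simp_all add: a_def a0_def A_def)
  have k: "0 \<le> k x" "k x \<le> 1" if "x \<in> {s..q}" for x
    using gflow_factor_bounds[OF l(1) x0(2)[OF that] \<delta>(1)] gflow_factor_bounds[OF l(2) x0(2)[OF that] \<delta>(1)]
    by (auto simp: k_def intro!: mult_le_one mult_nonneg_nonneg)
  have a'b: "\<bar>a' x\<bar> \<le> 2 * A\<^sup>2" if "x \<in> {s..q}" for x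
  proof -
    have "(riccati q l x)\<^sup>2 \<le> l\<^sup>2" "(riccati q l' x)\<^sup>2 \<le> l'\<^sup>2"
      using riccati_bounds[OF l(1) x0[OF that] st(3)] riccati_bounds[OF l(2) x0[OF that] st(3)]
      by (auto intro!: power_mono)
    moreover have "l\<^sup>2 + l'\<^sup>2 \<le> A\<^sup>2" using l by (simp add: A_def power2_eq_square algebra_simps)
    ultimately show ?thesis by (simp add: a'_def)
  qed
  have Da: "(a has_real_derivative a' x) (at x within {s..q})" if "x \<in> {s..q}" for x
    unfolding a_def a'_def using DERIV_riccati[OF l(1) x0(2)[OF that]] DERIV_riccati[OF l(2) x0(2)[OF that]]
    by (intro DERIV_add)
  have Dk: "(k has_real_derivative \<delta> * a x * k x) (at x within {s..q})" if "x \<in> {s..q}" for x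
    unfolding k_def a_def
    by (rule DERIV_cong[OF DERIV_mult[OF DERIV_gflow_factor[OF l(1) x0(2)[OF that]] DERIV_gflow_factor[OF l(2) x0(2)[OF that]]]])
       (simp add: algebra_simps)
  have k'b: "\<bar>\<delta> * a x * k x\<bar> \<le> A" if "x \<in> {s..q}" for x
  proof -
    have "\<bar>\<delta> * a x * k x\<bar> \<le> (1 * A) * 1"
      using \<delta> a[OF that] a0 k[OF that] by (intro abs_mult_le) auto
    then show ?thesis by simp
  qed
  have am[measurable]: "a \<in> borel_measurable borel" "a' \<in> borel_measurable borel"
    unfolding a_def a'_def riccati_def by measurable
  have km[measurable]: "k \<in> borel_measurable borel" unfolding k_def by measurable
  have GP: "G \<in> borel_measurable (path_borel T)"
    using T by (intro measurable_path_filtration_path_borel[OF _ G]) auto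
  define W where "W = 2 + 4 / a0\<^sup>2"
  define B where "B = (2 * A\<^sup>2 + A + 2 * A * C) * W"
  define B' where "B' = (4 * A + 1 + 2 * C + (2 * A\<^sup>2 + A + 2 * A * C)) * W"
  have gb: "\<bar>gauss_gen \<delta> (a x) z g\<bar> \<le> B" if "x \<in> {s..q}" "\<bar>g\<bar> \<le> C" for x z g
    unfolding B_def W_def using a[OF that(1)] a0 \<delta> that(2) by (intro gauss_gen_bound) auto
  have gb': "\<bar>gauss_gen' \<delta> (a x) z g\<bar> \<le> B'" if "x \<in> {s..q}" "\<bar>g\<bar> \<le> C" for x z g
    unfolding B'_def W_def using a[OF that(1)] a0 \<delta> that(2) by (intro gauss_gen'_bound) auto
  define f where "f = (\<lambda>x z. k x * exp (- (a x * z\<^sup>2)))"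
  define f' where "f' = (\<lambda>x z. (\<delta> * a x * k x - k x * a' x * z\<^sup>2) * exp (- (a x * z\<^sup>2)))"
  have Df: "((\<lambda>x. f x z) has_real_derivative f' x z) (at x within {s..q})" if "x \<in> {s..q}" for x z
    unfolding f_def f'_def
    by (auto intro!: derivative_eq_intros Da[OF that] Dk[OF that] simp: algebra_simps)
  have fb: "\<bar>f x z\<bar> \<le> 1" if "x \<in> {s..q}" for x z
    unfolding f_def using k[OF that] a[OF that] a0 by (auto simp: abs_mult intro!: mult_le_one)
  have f'b: "\<bar>f' x z\<bar> \<le> (A + 2 * A\<^sup>2) * W" if x: "x \<in> {s..q}" for x z
    unfolding f'_def W_def
  proof (rule gauss_factor_bound'[OF a0 a(1)[OF x]])
    have 1: "1 \<le> (1 + z\<^sup>2)\<^sup>2" "z\<^sup>2 \<le> (1 + z\<^sup>2)\<^sup>2" using one_plus_square_bounds[of z] by linarith+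
    have "\<bar>\<delta> * a x * k x - k x * a' x * z\<^sup>2\<bar> \<le> \<bar>\<delta> * a x * k x\<bar> + \<bar>(k x * a' x) * z\<^sup>2\<bar>" by linarith
    also have "\<dots> \<le> A * (1 + z\<^sup>2)\<^sup>2 + (1 * (2 * A\<^sup>2)) * (1 + z\<^sup>2)\<^sup>2"
    proof (rule add_mono)
      show "\<bar>\<delta> * a x * k x\<bar> \<le> A * (1 + z\<^sup>2)\<^sup>2"
        using k'b[OF x] mult_left_mono[OF 1(1) less_imp_le[OF A0]] by linarith
      show "\<bar>(k x * a' x) * z\<^sup>2\<bar> \<le> (1 * (2 * A\<^sup>2)) * (1 + z\<^sup>2)\<^sup>2"
        using k[OF x] a'b[OF x] 1 by (intro abs_mult_le) auto
    qed
    finally show "\<bar>\<delta> * a x * k x - k x * a' x * z\<^sup>2\<bar> \<le> (A + 2 * A\<^sup>2) * (1 + z\<^sup>2)\<^sup>2"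
      by (simp add: algebra_simps)
  qed (use A0 in auto)
  \<comment> \<open>Two clocks: \<open>u\<close> is the time at which the path is read,
    \<open>x\<close> the time at which the Gaussian parameters are taken. \<beta> is the change in
    the former with frozen parameters, \<gamma> the change in the latter on the diagonal.\<close>
  define F where "F = (\<lambda>u x. \<integral>\<eta>. G \<eta> * f x (\<eta> u) \<partial>Q)"
  define \<beta> where "\<beta> = (\<lambda>u x. \<integral>\<eta>. G \<eta> * (k x * gauss_gen \<delta> (a x) (\<eta> u) (b u \<eta>)) \<partial>Q)"
  define \<gamma> where "\<gamma> = (\<lambda>x. \<integral>\<eta>. G \<eta> * f' x (\<eta> x) \<partial>Q)"
  note GP[measurable]
  have j1: "(\<lambda>(u, \<eta>). G \<eta> * (k x * gauss_gen \<delta> (a x) (\<eta> u) (b u \<eta>))) \<in> borel_measurable (borel \<Otimes>\<^sub>M Q)" for x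
    unfolding jQ case_prod_beta' by measurable
  have j2: "(\<lambda>(u, \<eta>). G \<eta> * (k u * gauss_gen \<delta> (a u) (\<eta> u) (b u \<eta>))) \<in> borel_measurable (borel \<Otimes>\<^sub>M Q)"
    unfolding jQ case_prod_beta' by measurable
  have j3: "(\<lambda>(u, \<eta>). G \<eta> * f' u (\<eta> u)) \<in> borel_measurable (borel \<Otimes>\<^sub>M Q)"
    unfolding jQ case_prod_beta' f'_def by measurable
  have ev: "(\<lambda>\<eta>. \<eta> u) \<in> borel_measurable Q" if "u \<in> {s..q}" for u
    unfolding mQ using T that st by (intro measurable_path_eval) auto
  have bb: "\<bar>b u \<eta>\<bar> \<le> C" if "\<eta> \<in> space Q" for u \<eta> using b_bound that spQ by simp
  have K': "\<bar>G \<eta>\<bar> \<le> K" if "\<eta> \<in> space Q" for \<eta> using K that spQ by simp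
  have kgb: "\<bar>k x * gauss_gen \<delta> (a x) z g\<bar> \<le> B" if "x \<in> {s..q}" "\<bar>g\<bar> \<le> C" for x z g
    using abs_mult_le[of "k x" 1, OF _ gb[OF that]] k[OF that(1)] by simp
  have expb: "\<bar>\<integral>\<eta>. h \<eta> \<partial>Q\<bar> \<le> M" if "\<And>\<eta>. \<eta> \<in> space Q \<Longrightarrow> \<bar>h \<eta>\<bar> \<le> M" "h \<in> borel_measurable Q" for h :: "_ \<Rightarrow> real" and M
    using that by (intro Q.abs_expectation_le Q.integrable_const_bound[of _ M]) (auto intro!: AE_I2)
  have int1: "integrable Q (\<lambda>\<eta>. G \<eta> * f x (\<eta> u))" if "x \<in> {s..q}" "u \<in> {s..q}" for x u
  proof (rule Q.integrable_const_bound[of _ "K * 1"])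
    show "AE \<eta> in Q. norm (G \<eta> * f x (\<eta> u)) \<le> K * 1"
      using K' fb[OF that(1)] by (intro AE_I2) (auto intro!: abs_mult_le simp del: mult_1_right)
    show "(\<lambda>\<eta>. G \<eta> * f x (\<eta> u)) \<in> borel_measurable Q"
      using ev[OF that(2)] GP unfolding f_def mQ by measurable
  qed
  have "F q q - F s s = (LBINT u:{s<..q}. \<beta> u u + \<gamma> u)"
  proof (rule diagonal_chain_rule[where F=F and \<beta>=\<beta> and \<gamma>=\<gamma> and B="max (K * B) (K * ((A + 2 * A\<^sup>2) * W))" and L="K * (A * B + 1 * (B' * (2 * A\<^sup>2)))"])
    show "s \<le> q" by fact
    show "(\<lambda>u. \<beta> u x) \<in> borel_measurable borel" for x
      unfolding \<beta>_def using j1 by (rule Q.borel_measurable_lebesgue_integral)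
    show "(\<lambda>u. \<beta> u u) \<in> borel_measurable borel"
      unfolding \<beta>_def using j2 by (rule Q.borel_measurable_lebesgue_integral)
    show "\<gamma> \<in> borel_measurable borel"
      unfolding \<gamma>_def using j3 by (rule Q.borel_measurable_lebesgue_integral)
  next
    fix u x assume "u \<in> {s..q}" "x \<in> {s..q}"
    then have "\<bar>\<beta> u x\<bar> \<le> K * B"
      unfolding \<beta>_def using K' kgb bb measurable_section[OF j1] by (intro expb abs_mult_le) auto
    then show "\<bar>\<beta> u x\<bar> \<le> max (K * B) (K * ((A + 2 * A\<^sup>2) * W))" by simp
  next
    fix x assume "x \<in> {s..q}"
    then have "\<bar>\<gamma> x\<bar> \<le> K * ((A + 2 * A\<^sup>2) * W)"
      unfolding \<gamma>_def using K' f'b measurable_section[OF j3] by (intro expb abs_mult_le) auto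
    then show "\<bar>\<gamma> x\<bar> \<le> max (K * B) (K * ((A + 2 * A\<^sup>2) * W))" by simp
  next
    fix x assume x: "x \<in> {s..q}"
    show "((\<lambda>y. F x y) has_real_derivative \<gamma> x) (at x within {s..q})"
      unfolding F_def \<gamma>_def
    proof (rule DERIV_expectation[where f="\<lambda>y \<eta>. G \<eta> * f y (\<eta> x)" and f'="\<lambda>y \<eta>. G \<eta> * f' y (\<eta> x)" and B="K * ((A + 2 * A\<^sup>2) * W)"])
      show "prob_space Q" by (rule Q.prob_space_axioms)
      show "(\<lambda>\<eta>. G \<eta> * f' x (\<eta> x)) \<in> borel_measurable Q" by (rule measurable_section[OF j3])
      show "((\<lambda>y. G \<eta> * f y (\<eta> x)) has_real_derivative G \<eta> * f' y (\<eta> x)) (at y within {s..q})" if "y \<in> {s..q}" for y \<eta>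
        using Df[OF that] by (rule DERIV_cmult)
      show "\<bar>G \<eta> * f' y (\<eta> x)\<bar> \<le> K * ((A + 2 * A\<^sup>2) * W)" if "y \<in> {s..q}" "\<eta> \<in> space Q" for y \<eta>
        using K' f'b that by (intro abs_mult_le) auto
    qed (use x int1 in auto)
  next
    fix u x y assume u: "u \<in> {s..q}" and x: "x \<in> {s..q}" and y: "y \<in> {s..q}"
    let ?h = "\<lambda>x \<eta>. k x * gauss_gen \<delta> (a x) (\<eta> u) (b u \<eta>)"
    have hl: "\<bar>?h x \<eta> - ?h y \<eta>\<bar> \<le> (A * B + 1 * (B' * (2 * A\<^sup>2))) * \<bar>x - y\<bar>" if \<eta>: "\<eta> \<in> space Q" for \<eta>
      unfolding real_norm_def[symmetric]
    proof (rule field_differentiable_bound[of "{s..q}" _ "\<lambda>z. (\<delta> * a z * k z) * gauss_gen \<delta> (a z) (\<eta> u) (b u \<eta>) +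
          k z * (gauss_gen' \<delta> (a z) (\<eta> u) (b u \<eta>) * a' z)"])
      fix z assume z: "z \<in> {s..q}"
      show "((\<lambda>z. ?h z \<eta>) has_field_derivative (\<delta> * a z * k z) * gauss_gen \<delta> (a z) (\<eta> u) (b u \<eta>) +
          k z * (gauss_gen' \<delta> (a z) (\<eta> u) (b u \<eta>) * a' z)) (at z within {s..q})"
        by (rule DERIV_cong[OF DERIV_mult[OF Dk[OF z] DERIV_chain2[OF DERIV_gauss_gen Da[OF z]]]])
          (simp add: algebra_simps)
      have "\<bar>(\<delta> * a z * k z) * gauss_gen \<delta> (a z) (\<eta> u) (b u \<eta>)\<bar> \<le> A * B"
        using k'b[OF z] gb[OF z bb[OF \<eta>]] by (intro abs_mult_le)
      moreover have "\<bar>k z * (gauss_gen' \<delta> (a z) (\<eta> u) (b u \<eta>) * a' z)\<bar> \<le> 1 * (B' * (2 * A\<^sup>2))"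
        using k[OF z] gb'[OF z bb[OF \<eta>]] a'b[OF z] by (intro abs_mult_le) auto
      ultimately show "norm ((\<delta> * a z * k z) * gauss_gen \<delta> (a z) (\<eta> u) (b u \<eta>) +
          k z * (gauss_gen' \<delta> (a z) (\<eta> u) (b u \<eta>) * a' z)) \<le> A * B + 1 * (B' * (2 * A\<^sup>2))"
        unfolding real_norm_def by linarith
    qed (use x y in auto)
    have ig: "integrable Q (\<lambda>\<eta>. G \<eta> * ?h z \<eta>)" if "z \<in> {s..q}" for z
      using K' kgb[OF that] bb measurable_section[OF j1]
      by (intro Q.integrable_const_bound[of _ "K * B"]) (auto intro!: AE_I2 abs_mult_le)
    have "\<beta> u x - \<beta> u y = (\<integral>\<eta>. G \<eta> * (?h x \<eta> - ?h y \<eta>) \<partial>Q)"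
      unfolding \<beta>_def using ig[OF x] ig[OF y] by (simp add: right_diff_distrib)
    also have "\<bar>\<dots>\<bar> \<le> K * ((A * B + 1 * (B' * (2 * A\<^sup>2))) * \<bar>x - y\<bar>)"
      using K' hl borel_measurable_integrable[OF ig[OF x]] borel_measurable_integrable[OF ig[OF y]]
      by (intro expb abs_mult_le) (auto simp: right_diff_distrib)
    finally show "\<bar>\<beta> u x - \<beta> u y\<bar> \<le> K * (A * B + 1 * (B' * (2 * A\<^sup>2))) * \<bar>x - y\<bar>"
      by (simp only: mult.assoc)
  next
    fix r t x assume rt: "s \<le> r" "r \<le> t" "t \<le> q" and x: "x \<in> {s..q}"
    \<comment> \<open>With parameters frozen at \<open>x\<close> the prefactor is a constant and can
      be absorbed into the test variable.\<close>
    have G': "(\<lambda>\<eta>. G \<eta> * k x) \<in> borel_measurable (path_filtration T r)"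
      using measurable_path_filtration_mono[OF G rt(1)] by measurable
    have "(\<integral>\<eta>. (G \<eta> * k x) * (exp (- (a x * (\<eta> t)\<^sup>2)) - exp (- (a x * (\<eta> r)\<^sup>2))) \<partial>Q) =
       (LBINT u:{r<..t}. (\<integral>\<eta>. (G \<eta> * k x) * gauss_gen \<delta> (a x) (\<eta> u) (b u \<eta>) \<partial>Q))"
    proof (rule gauss_solution_identity[OF Q _ _ rt(2) _ G', where K="K * 1"])
      show "\<bar>G \<eta> * k x\<bar> \<le> K * 1" if "\<eta> \<in> space (path_borel T)" for \<eta>
        using K[OF that] k[OF x] by (intro abs_mult_le) auto
    qed (use a[OF x] a0 rt st in auto)
    moreover have "F t x - F r x = (\<integral>\<eta>. G \<eta> * f x (\<eta> t) - G \<eta> * f x (\<eta> r) \<partial>Q)"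
      unfolding F_def using int1 x rt by (subst Bochner_Integration.integral_diff) auto
    ultimately show "F t x - F r x = (LBINT u:{r<..t}. \<beta> u x)"
      by (simp add: \<beta>_def f_def algebra_simps)
  qed
  moreover have "\<beta> u u + \<gamma> u = (\<integral>\<eta>. G \<eta> * (gflow \<delta> q l u (\<eta> u) * gflow \<delta> q l' u (\<eta> u) *
        (4 * riccati q l u * riccati q l' u * (\<eta> u)\<^sup>2
         - 2 * (riccati q l u + riccati q l' u) * \<eta> u * b u \<eta>)) \<partial>Q)" if u: "u \<in> {s..q}" for u
  proof -
    have "integrable Q (\<lambda>\<eta>. G \<eta> * (k u * gauss_gen \<delta> (a u) (\<eta> u) (b u \<eta>)))"
      using K' kgb[OF u] bb measurable_section[OF j1]
      by (intro Q.integrable_const_bound[of _ "K * B"]) (auto intro!: AE_I2 abs_mult_le)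
    moreover have "integrable Q (\<lambda>\<eta>. G \<eta> * f' u (\<eta> u))"
      using K' f'b[OF u] measurable_section[OF j3]
      by (intro Q.integrable_const_bound[of _ "K * ((A + 2 * A\<^sup>2) * W)"]) (auto intro!: AE_I2 abs_mult_le)
    ultimately have "\<beta> u u + \<gamma> u = (\<integral>\<eta>. G \<eta> * (k u * gauss_gen \<delta> (a u) (\<eta> u) (b u \<eta>)) + G \<eta> * f' u (\<eta> u) \<partial>Q)"
      unfolding \<beta>_def \<gamma>_def by simp
    also have "\<dots> = (\<integral>\<eta>. G \<eta> * (gflow \<delta> q l u (\<eta> u) * gflow \<delta> q l' u (\<eta> u) *
        (4 * riccati q l u * riccati q l' u * (\<eta> u)\<^sup>2
         - 2 * (riccati q l u + riccati q l' u) * \<eta> u * b u \<eta>)) \<partial>Q)"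
    proof (intro Bochner_Integration.integral_cong refl)
      fix \<eta>
      have e: "gflow \<delta> q l u (\<eta> u) * gflow \<delta> q l' u (\<eta> u) = k u * exp (- (a u * (\<eta> u)\<^sup>2))"
        by (simp add: gflow_def k_def a_def exp_add[symmetric] algebra_simps)
      \<comment> \<open>The squares produced by the operator cancel against the Riccati equations;
        only the mixed product remains.\<close>
      have "2 * (a u)\<^sup>2 - a' u = 4 * riccati q l u * riccati q l' u"
        by (simp add: a_def a'_def power2_eq_square algebra_simps)
      then have e2: "4 * riccati q l u * riccati q l' u * (\<eta> u)\<^sup>2 = (2 * (a u)\<^sup>2 - a' u) * (\<eta> u)\<^sup>2" by simp
      show "G \<eta> * (k u * gauss_gen \<delta> (a u) (\<eta> u) (b u \<eta>)) + G \<eta> * f' u (\<eta> u) =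
         G \<eta> * (gflow \<delta> q l u (\<eta> u) * gflow \<delta> q l' u (\<eta> u) *
        (4 * riccati q l u * riccati q l' u * (\<eta> u)\<^sup>2
         - 2 * (riccati q l u + riccati q l' u) * \<eta> u * b u \<eta>))"
        unfolding e e2 gauss_gen_def f'_def a_def[symmetric] by (simp add: algebra_simps a_def)
    qed
    finally show ?thesis .
  qed
  moreover have "F x x = (\<integral>\<eta>. G \<eta> * (gflow \<delta> q l x (\<eta> x) * gflow \<delta> q l' x (\<eta> x)) \<partial>Q)" for x
    unfolding F_def f_def by (intro Bochner_Integration.integral_cong refl)
      (simp add: gflow_def k_def a_def exp_add[symmetric] algebra_simps)
  ultimately show ?thesis
    by (simp add: set_lebesgue_integral_cong[of "{s<..q}" lborel "\<lambda>u. \<beta> u u + \<gamma> u"] del: gflow_q)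
qed

end

section \<open>Martingale representation of cylinder functionals\<close>

text \<open>A product of Gaussian factors at the times in \<open>S\<close>, one weight per
  time.\<close>

definition cexp :: "real set \<Rightarrow> (real \<Rightarrow> real) \<Rightarrow> (real \<Rightarrow> real) \<Rightarrow> real" where
  "cexp S c \<eta> = exp (- (\<Sum>s\<in>S. c s * (\<eta> s)\<^sup>2))"

text \<open>The linear span of products of Gaussians at times up to \<open>t\<close>. Since the
  weights add under multiplication it is an algebra, which the density argument needs.\<close>

inductive_set cyl :: "real \<Rightarrow> ((real \<Rightarrow> real) \<Rightarrow> real) set" for t where
  zero: "(\<lambda>_. 0) \<in> cyl t"
| add: "finite S \<Longrightarrow> S \<subseteq> {0..t} \<Longrightarrow> (\<And>s. 0 \<le> c s) \<Longrightarrow> \<Phi> \<in> cyl t \<Longrightarrow> (\<lambda>\<eta>. a * cexp S c \<eta> + \<Phi> \<eta>) \<in> cyl t"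

lemma cexp_bounds:
  assumes "\<And>s. 0 \<le> c s"
  shows "0 \<le> cexp S c \<eta>" "cexp S c \<eta> \<le> 1"
  using assms by (auto simp: cexp_def intro!: sum_nonneg)

lemma measurable_cexp:
  assumes "finite S" "S \<subseteq> {0..t}" "t \<le> T"
  shows "cexp S c \<in> borel_measurable (path_filtration T t)"
proof -
  have [measurable]: "(\<lambda>\<eta>. \<eta> s) \<in> borel_measurable (path_filtration T t)" if "s \<in> S" for s
    using that assms by (intro canonical_filtration_eval) auto
  show ?thesis unfolding cexp_def by measurable
qed

text \<open>Padding with zero weights brings several terms to a common set of times.\<close>

lemma cexp_superset:
  assumes "finite S'" "S \<subseteq> S'"
  shows "cexp S c = cexp S' (\<lambda>s. if s \<in> S then c s else 0)"
proof
  fix \<eta>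
  have "(\<Sum>s\<in>S. c s * (\<eta> s)\<^sup>2) = (\<Sum>s\<in>S'. (if s \<in> S then c s else 0) * (\<eta> s)\<^sup>2)"
    using assms by (intro sum.mono_neutral_cong_left) auto
  then show "cexp S c \<eta> = cexp S' (\<lambda>s. if s \<in> S then c s else 0) \<eta>" by (simp add: cexp_def)
qed

lemma cexp_mult: "cexp S c \<eta> * cexp S d \<eta> = cexp S (\<lambda>s. c s + d s) \<eta>"
  by (simp add: cexp_def exp_add[symmetric] sum.distrib algebra_simps)

lemma cyl_scaled_cexp:
  assumes "finite S" "S \<subseteq> {0..t}" "\<And>s. 0 \<le> c s"
  shows "(\<lambda>\<eta>. a * cexp S c \<eta>) \<in> cyl t"
  using cyl.add[OF assms cyl.zero, of a] by simp

lemma cyl_plus: "\<Phi> \<in> cyl t \<Longrightarrow> \<Psi> \<in> cyl t \<Longrightarrow> (\<lambda>\<eta>. \<Phi> \<eta> + \<Psi> \<eta>) \<in> cyl t"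
  by (induction rule: cyl.induct) (auto simp: add.assoc intro: cyl.add)

lemma cyl_sum:
  assumes "finite I" "\<And>i. i \<in> I \<Longrightarrow> \<Phi> i \<in> cyl t"
  shows "(\<lambda>\<eta>. \<Sum>i\<in>I. \<Phi> i \<eta>) \<in> cyl t"
  using assms by (induction rule: finite_induct) (auto intro: cyl.zero cyl_plus)

lemma cyl_cexp_times:
  assumes "\<Phi> \<in> cyl t" "finite S" "S \<subseteq> {0..t}" "\<And>s. 0 \<le> c s"
  shows "(\<lambda>\<eta>. a * cexp S c \<eta> * \<Phi> \<eta>) \<in> cyl t"
  using assms(1)
proof induction
  case zero
  then show ?case by (simp add: cyl.zero)
next
  case (add S' c' \<Phi> a')
  let ?U = "S \<union> S'" and ?d = "\<lambda>s. (if s \<in> S then c s else 0) + (if s \<in> S' then c' s else 0)"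
  have "cexp S c \<eta> * cexp S' c' \<eta> = cexp ?U ?d \<eta>" for \<eta>
    using assms(2) add(1) cexp_superset[of ?U S c] cexp_superset[of ?U S' c'] by (simp add: cexp_mult)
  then have e: "(\<lambda>\<eta>. a * cexp S c \<eta> * (a' * cexp S' c' \<eta> + \<Phi> \<eta>)) =
    (\<lambda>\<eta>. (a * a') * cexp ?U ?d \<eta> + a * cexp S c \<eta> * \<Phi> \<eta>)"
    by (simp add: fun_eq_iff algebra_simps)
  show ?case unfolding e using assms add by (intro cyl.add) auto
qed

lemma cyl_mult: "\<Phi> \<in> cyl t \<Longrightarrow> \<Psi> \<in> cyl t \<Longrightarrow> (\<lambda>\<eta>. \<Phi> \<eta> * \<Psi> \<eta>) \<in> cyl t"
proof (induction rule: cyl.induct)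
  case (add S c \<Phi> a)
  then have "(\<lambda>\<eta>. a * cexp S c \<eta> * \<Psi> \<eta> + \<Phi> \<eta> * \<Psi> \<eta>) \<in> cyl t"
    by (intro cyl_plus cyl_cexp_times) auto
  then show ?case by (simp add: distrib_right)
qed (simp add: cyl.zero)

lemma cyl_bounded: "\<Phi> \<in> cyl t \<Longrightarrow> \<exists>K. \<forall>\<eta>. \<bar>\<Phi> \<eta>\<bar> \<le> K"
proof (induction rule: cyl.induct)
  case (add S c \<Phi> a)
  then obtain K where K: "\<And>\<eta>. \<bar>\<Phi> \<eta>\<bar> \<le> K" by blast
  have "\<bar>a * cexp S c \<eta>\<bar> \<le> \<bar>a\<bar> * 1" for \<eta>
    using cexp_bounds[of c] add(3) by (intro abs_mult_le) auto
  then have "\<bar>a * cexp S c \<eta> + \<Phi> \<eta>\<bar> \<le> \<bar>a\<bar> * 1 + K" for \<eta>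
    using K by (intro order_trans[OF abs_triangle_ineq add_mono])
  then show ?case by blast
qed auto

lemma cyl_measurable:
  assumes "\<Phi> \<in> cyl t" "t \<le> T"
  shows "\<Phi> \<in> borel_measurable (path_filtration T t)"
  using assms
proof (induction rule: cyl.induct)
  case (add S c \<Phi> a)
  note measurable_cexp[OF add(1,2) assms(2), measurable] add.IH[OF assms(2), measurable]
  show ?case by measurable
qed simp

text \<open>All terms share one time set, so the backward recursion can eliminate a time from all of
  them simultaneously.\<close>

lemma cyl_normal_form:
  assumes "\<Phi> \<in> cyl t"
  shows "\<exists>S n a c. finite S \<and> S \<subseteq> {0..t} \<and> (\<forall>j s. 0 \<le> c j s) \<and>
    \<Phi> = (\<lambda>\<eta>. \<Sum>j<(n::nat). a j * cexp S (c j) \<eta>)"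
  using assms
proof induction
  case zero
  show ?case by (intro exI[of _ "{}"] exI[of _ 0] exI[of _ "\<lambda>_. 0"] exI[of _ "\<lambda>_ _. 0"]) auto
next
  case (add S c \<Phi> a)
  then obtain S' n a' c' where S': "finite S'" "S' \<subseteq> {0..t}" "\<forall>j s. 0 \<le> c' j s"
    and \<Phi>: "\<Phi> = (\<lambda>\<eta>. \<Sum>j<(n::nat). a' j * cexp S' (c' j) \<eta>)" by blast
  define U where "U = S \<union> S'"
  define d where "d = (\<lambda>j s. if j = n then (if s \<in> S then c s else 0) else (if s \<in> S' then c' j s else (0 :: real)))"
  have U: "finite U" "S \<subseteq> U" "S' \<subseteq> U" using add S' by (auto simp: U_def)
  have "a * cexp S c \<eta> + \<Phi> \<eta> = (\<Sum>j<Suc n. (a'(n := a)) j * cexp U (d j) \<eta>)" for \<eta>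
  proof -
    have "cexp S' (c' j) = cexp U (d j)" if "j < n" for j
      using cexp_superset[OF U(1,3), of "c' j"] that by (simp add: d_def)
    moreover have "cexp S c = cexp U (d n)"
      using cexp_superset[OF U(1,2), of c] by (simp add: d_def)
    ultimately show ?thesis by (simp add: \<Phi>)
  qed
  then show ?case
    using add S' U by (intro exI[of _ U] exI[of _ "Suc n"] exI[of _ "a'(n := a)"] exI[of _ d])
      (auto simp: d_def U_def)
qed

context bounded_drift
begin

text \<open>From \<open>\<bar>x\<bar> \<le> 1 + x^2\<close>: the summand 1 contributes at most
  \<open>p\<close>, the summand \<open>x^2\<close> at most 1 by \<open>y \<le> exp y\<close>. The
  bound includes \<open>p = 0\<close>.\<close>

lemma riccati_exp_bound:
  fixes p x :: real
  assumes "0 \<le> p"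
  shows "\<bar>p * x * exp (- (p * x\<^sup>2))\<bar> \<le> p + 1"
proof -
  have "p * x\<^sup>2 * exp (- (p * x\<^sup>2)) \<le> 1"
  proof -
    have "p * x\<^sup>2 \<le> exp (p * x\<^sup>2)" using exp_ge_add_one_self[of "p * x\<^sup>2"] by linarith
    then show ?thesis by (simp add: exp_minus field_simps)
  qed
  moreover have "p * exp (- (p * x\<^sup>2)) \<le> p" using assms by (simp add: mult_left_le)
  moreover have "p * \<bar>x\<bar> * exp (- (p * x\<^sup>2)) \<le> p * (1 + x\<^sup>2) * exp (- (p * x\<^sup>2))"
    using one_plus_square_bounds(1)[of x] assms by (intro mult_right_mono mult_left_mono) auto
  ultimately show ?thesis using assms by (simp add: abs_mult algebra_simps)
qed

text \<open>The derivative of \<open>gflow\<close> in the space variable. It is the integrand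
  \<open>w\<close> that belongs to a single flow.\<close>

definition gflow_grad :: "real \<Rightarrow> real \<Rightarrow> real \<Rightarrow> real \<Rightarrow> real" where
  "gflow_grad q l u x = - 2 * riccati q l u * x * gflow \<delta> q l u x"

lemma gflow_grad_bound:
  assumes "0 \<le> l" "0 \<le> u" "u \<le> q"
  shows "\<bar>gflow_grad q l u x\<bar> \<le> 2 * (l + 1)"
proof -
  let ?p = "riccati q l u" and ?c = "(1 + 2 * l * (q - u)) powr (- \<delta> / 2)"
  have p: "0 \<le> ?p" "?p \<le> l" using riccati_bounds[OF assms order_refl] by auto
  have "\<bar>?c * (?p * x * exp (- (?p * x\<^sup>2)))\<bar> \<le> 1 * (?p + 1)"
    using gflow_factor_bounds[OF assms(1,3) \<delta>(1)] riccati_exp_bound[OF p(1)] by (intro abs_mult_le) auto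
  moreover have "gflow_grad q l u x = - 2 * (?c * (?p * x * exp (- (?p * x\<^sup>2))))"
    by (simp add: gflow_grad_def gflow_def)
  ultimately show ?thesis using p by (simp only: abs_mult) simp
qed

text \<open>Written with spatial derivatives, the identity for a product of flows reads
  \<open>w w' + (w e' + e w') b\<close>, which is Ito's product rule in expectation. Two independent
  families of parameters allow it to serve both for \<open>v\<close> and for its square.\<close>

lemma gflow_sum_identity:
  fixes I :: "'i set" and H :: "'i \<Rightarrow> (real \<Rightarrow> real) \<Rightarrow> real"
  assumes Q: "gauss_solution Q" and st: "0 \<le> s" "s \<le> q" "q \<le> T" and "finite I"
    and l: "\<And>i. i \<in> I \<Longrightarrow> 0 \<le> l i" "\<And>i. i \<in> I \<Longrightarrow> 0 \<le> l' i"
    and H: "\<And>i. i \<in> I \<Longrightarrow> H i \<in> borel_measurable (path_filtration T s)"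
    and K: "\<And>i \<eta>. i \<in> I \<Longrightarrow> \<eta> \<in> space (path_borel T) \<Longrightarrow> \<bar>H i \<eta>\<bar> \<le> K i"
  defines "e \<equiv> \<lambda>i u \<eta>. gflow \<delta> q (l i) u (\<eta> u)" and "e' \<equiv> \<lambda>i u \<eta>. gflow \<delta> q (l' i) u (\<eta> u)"
    and "w \<equiv> \<lambda>i u \<eta>. gflow_grad q (l i) u (\<eta> u)" and "w' \<equiv> \<lambda>i u \<eta>. gflow_grad q (l' i) u (\<eta> u)"
  shows "(\<integral>\<eta>. (\<Sum>i\<in>I. H i \<eta> * (e i q \<eta> * e' i q \<eta>)) \<partial>Q) -
     (\<integral>\<eta>. (\<Sum>i\<in>I. H i \<eta> * (e i s \<eta> * e' i s \<eta>)) \<partial>Q) =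
     (LBINT u:{s<..q}. (\<integral>\<eta>. (\<Sum>i\<in>I. H i \<eta> * (w i u \<eta> * w' i u \<eta> + (w i u \<eta> * e' i u \<eta> + e i u \<eta> * w' i u \<eta>) * b u \<eta>)) \<partial>Q))"
proof -
  interpret Q: prob_space Q using gauss_solutionD(1)[OF Q] .
  note spQ = gauss_solutionD(3)[OF Q] and jQ = gauss_solutionD(4)[OF Q] and mQ = gauss_solutionD(5)[OF Q]
  define D where "D = (\<lambda>i u \<eta>. H i \<eta> * (w i u \<eta> * w' i u \<eta> + (w i u \<eta> * e' i u \<eta> + e i u \<eta> * w' i u \<eta>) * b u \<eta>))"
  have HP: "H i \<in> borel_measurable (path_borel T)" if "i \<in> I" for i
    using T by (intro measurable_path_filtration_path_borel[OF _ H[OF that]]) auto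
  have Dj: "(\<lambda>(u, \<eta>). D i u \<eta>) \<in> borel_measurable (borel \<Otimes>\<^sub>M Q)" if "i \<in> I" for i
  proof -
    note HP[OF that, measurable]
    have [measurable]: "(\<lambda>p. e i (fst p) (snd p)) \<in> borel_measurable (borel \<Otimes>\<^sub>M path_borel T)"
      "(\<lambda>p. e' i (fst p) (snd p)) \<in> borel_measurable (borel \<Otimes>\<^sub>M path_borel T)"
      "(\<lambda>p. w i (fst p) (snd p)) \<in> borel_measurable (borel \<Otimes>\<^sub>M path_borel T)"
      "(\<lambda>p. w' i (fst p) (snd p)) \<in> borel_measurable (borel \<Otimes>\<^sub>M path_borel T)"
      unfolding e_def e'_def w_def w'_def gflow_grad_def by measurable
    show ?thesis unfolding jQ case_prod_beta' D_def by measurable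
  qed
  have Db: "\<bar>D i u \<eta>\<bar> \<le> K i * ((2 * (l i + 1)) * (2 * (l' i + 1)) + ((2 * (l i + 1)) * 1 + 1 * (2 * (l' i + 1))) * C)"
    if "i \<in> I" "u \<in> {s..q}" "\<eta> \<in> space Q" for i u \<eta>
  proof -
    have u: "0 \<le> u" "u \<le> q" using that(2) st by auto
    have "\<bar>w i u \<eta>\<bar> \<le> 2 * (l i + 1)" "\<bar>w' i u \<eta>\<bar> \<le> 2 * (l' i + 1)"
      unfolding w_def w'_def using l[OF that(1)] u by (intro gflow_grad_bound; simp)+
    moreover have "\<bar>e i u \<eta>\<bar> \<le> 1" "\<bar>e' i u \<eta>\<bar> \<le> 1"
      unfolding e_def e'_def using gflow_bounds l[OF that(1)] u \<delta> by auto
    ultimately have "\<bar>w i u \<eta> * w' i u \<eta>\<bar> \<le> (2 * (l i + 1)) * (2 * (l' i + 1))"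
      "\<bar>w i u \<eta> * e' i u \<eta>\<bar> \<le> (2 * (l i + 1)) * 1" "\<bar>e i u \<eta> * w' i u \<eta>\<bar> \<le> 1 * (2 * (l' i + 1))"
      by (auto intro!: abs_mult_le simp only:)
    moreover from this have "\<bar>(w i u \<eta> * e' i u \<eta> + e i u \<eta> * w' i u \<eta>) * b u \<eta>\<bar> \<le>
       ((2 * (l i + 1)) * 1 + 1 * (2 * (l' i + 1))) * C"
      using b_bound[of \<eta> u] that(3) spQ by (intro abs_mult_le) auto
    ultimately have "\<bar>w i u \<eta> * w' i u \<eta> + (w i u \<eta> * e' i u \<eta> + e i u \<eta> * w' i u \<eta>) * b u \<eta>\<bar> \<le>
       (2 * (l i + 1)) * (2 * (l' i + 1)) + ((2 * (l i + 1)) * 1 + 1 * (2 * (l' i + 1))) * C"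
      by (intro order_trans[OF abs_triangle_ineq add_mono])
    then show ?thesis
      unfolding D_def using K[OF that(1), of \<eta>] that(3) spQ by (intro abs_mult_le) auto
  qed
  have i1: "integrable Q (\<lambda>\<eta>. H i \<eta> * (e i u \<eta> * e' i u \<eta>))" if "i \<in> I" "u \<in> {s..q}" for i u
  proof (rule Q.integrable_const_bound[of _ "K i * (1 * 1)"])
    have u: "0 \<le> u" "u \<le> q" using that(2) st by auto
    show "AE \<eta> in Q. norm (H i \<eta> * (e i u \<eta> * e' i u \<eta>)) \<le> K i * (1 * 1)"
      unfolding e_def e'_def real_norm_def using K[OF that(1)] gflow_bounds l[OF that(1)] u \<delta> spQ
      by (intro AE_I2 abs_mult_le) auto
    have "(\<lambda>\<eta>. \<eta> u) \<in> borel_measurable (path_borel T)"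
      using u st T by (intro measurable_path_eval) auto
    then show "(\<lambda>\<eta>. H i \<eta> * (e i u \<eta> * e' i u \<eta>)) \<in> borel_measurable Q"
      unfolding mQ e_def e'_def using HP[OF that(1)] by measurable
  qed
  have i2: "integrable Q (D i u)" if "i \<in> I" "u \<in> {s..q}" for i u
    using Db[OF that] measurable_section[OF Dj[OF that(1)]]
    by (intro Q.integrable_const_bound) (auto intro!: AE_I2)
  have "(\<integral>\<eta>. (\<Sum>i\<in>I. H i \<eta> * (e i q \<eta> * e' i q \<eta>)) \<partial>Q) - (\<integral>\<eta>. (\<Sum>i\<in>I. H i \<eta> * (e i s \<eta> * e' i s \<eta>)) \<partial>Q) =
    (\<Sum>i\<in>I. (\<integral>\<eta>. H i \<eta> * (e i q \<eta> * e' i q \<eta>) \<partial>Q) - (\<integral>\<eta>. H i \<eta> * (e i s \<eta> * e' i s \<eta>) \<partial>Q))"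
    using i1 st by (simp add: sum_subtractf)
  also have "\<dots> = (\<Sum>i\<in>I. LBINT u:{s<..q}. (\<integral>\<eta>. D i u \<eta> \<partial>Q))"
  proof (rule sum.cong[OF refl])
    fix i assume i: "i \<in> I"
    have D: "H i \<eta> * (gflow \<delta> q (l i) u (\<eta> u) * gflow \<delta> q (l' i) u (\<eta> u) *
        (4 * riccati q (l i) u * riccati q (l' i) u * (\<eta> u)\<^sup>2
         - 2 * (riccati q (l i) u + riccati q (l' i) u) * \<eta> u * b u \<eta>)) = D i u \<eta>" for u \<eta>
      by (simp add: D_def w_def w'_def e_def e'_def gflow_grad_def algebra_simps power2_eq_square)
    show "(\<integral>\<eta>. H i \<eta> * (e i q \<eta> * e' i q \<eta>) \<partial>Q) - (\<integral>\<eta>. H i \<eta> * (e i s \<eta> * e' i s \<eta>) \<partial>Q) =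
       (LBINT u:{s<..q}. (\<integral>\<eta>. D i u \<eta> \<partial>Q))"
      using gflow_identity[OF Q st l[OF i] H[OF i] K[OF i]] unfolding D e_def e'_def .
  qed
  also have "\<dots> = (LBINT u:{s<..q}. (\<Sum>i\<in>I. \<integral>\<eta>. D i u \<eta> \<partial>Q))"
  proof -
    have "set_integrable lborel {s<..q} (\<lambda>u. \<integral>\<eta>. D i u \<eta> \<partial>Q)" if i: "i \<in> I" for i
      by (rule time_fubini(1)[OF Q.prob_space_axioms Dj[OF i]], rule Db[OF i]) auto
    then show ?thesis
      unfolding set_lebesgue_integral_def set_integrable_def scaleR_right.sum
      by (intro Bochner_Integration.integral_sum[symmetric])
  qed
  also have "\<dots> = (LBINT u:{s<..q}. \<integral>\<eta>. (\<Sum>i\<in>I. D i u \<eta>) \<partial>Q)"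
    using i2 by (intro set_lebesgue_integral_cong) (auto intro!: Bochner_Integration.integral_sum[symmetric])
  finally show ?thesis unfolding D_def .
qed

text \<open>These are the expectations of Ito's formula for \<open>v\<close> and \<open>v\<^sup>2\<close> when \<open>dv = w dW + w b dt\<close>,
  i.e. when \<open>v\<close> is a martingale in the absence of the drift \<open>b\<close>.\<close>

definition represents :: "real \<Rightarrow> real \<Rightarrow> (real \<Rightarrow> (real \<Rightarrow> real) \<Rightarrow> real) \<Rightarrow> (real \<Rightarrow> (real \<Rightarrow> real) \<Rightarrow> real) \<Rightarrow> real \<Rightarrow> bool" where
  "represents t q v w B \<longleftrightarrow>
     (\<lambda>(u, \<eta>). v u \<eta>) \<in> borel_measurable (borel \<Otimes>\<^sub>M path_borel T) \<and>
     (\<lambda>(u, \<eta>). w u \<eta>) \<in> borel_measurable (borel \<Otimes>\<^sub>M path_borel T) \<and>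
     (\<forall>u\<in>{t..q}. w u \<in> borel_measurable (path_filtration T q)) \<and>
     (\<forall>u\<in>{t..q}. \<forall>\<eta>\<in>space (path_borel T). \<bar>v u \<eta>\<bar> \<le> B \<and> \<bar>w u \<eta>\<bar> \<le> B) \<and>
     (\<forall>Q s. gauss_solution Q \<longrightarrow> s \<in> {t..q} \<longrightarrow>
       (\<integral>\<eta>. v q \<eta> \<partial>Q) - (\<integral>\<eta>. v s \<eta> \<partial>Q) = (LBINT u:{s<..q}. (\<integral>\<eta>. w u \<eta> * b u \<eta> \<partial>Q)) \<and>
       (\<integral>\<eta>. (v q \<eta>)\<^sup>2 \<partial>Q) - (\<integral>\<eta>. (v s \<eta>)\<^sup>2 \<partial>Q) =
         (LBINT u:{s<..q}. (\<integral>\<eta>. (w u \<eta>)\<^sup>2 + 2 * v u \<eta> * w u \<eta> * b u \<eta> \<partial>Q)))"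

lemma represents_const:
  assumes "\<Phi> \<in> borel_measurable (path_borel T)" "\<And>\<eta>. \<eta> \<in> space (path_borel T) \<Longrightarrow> \<bar>\<Phi> \<eta>\<bar> \<le> B"
  shows "represents t q (\<lambda>_. \<Phi>) (\<lambda>_ _. 0) B"
proof -
  have "(\<lambda>p. \<Phi> (snd p)) \<in> borel_measurable (borel \<Otimes>\<^sub>M path_borel T)"
    using assms(1) by measurable
  moreover have "0 \<le> B" if "\<eta> \<in> space (path_borel T)" for \<eta>
    using assms(2)[OF that] by linarith
  ultimately show ?thesis unfolding represents_def using assms(2) by (auto simp: case_prod_beta')
qed

text \<open>The coefficients \<open>G i\<close> are known at time \<open>r\<close>, so on this
  interval only the Gaussian factors evolve, and both moments follow from the identity for sums of
  products.\<close>

lemma represents_gflow: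
  fixes J :: "'i set" and G :: "'i \<Rightarrow> (real \<Rightarrow> real) \<Rightarrow> real"
  assumes st: "0 \<le> r" "r \<le> q" "q \<le> T" and J: "finite J"
    and l: "\<And>i. i \<in> J \<Longrightarrow> 0 \<le> l i"
    and G: "\<And>i. i \<in> J \<Longrightarrow> G i \<in> borel_measurable (path_filtration T r)"
    and K: "\<And>i \<eta>. i \<in> J \<Longrightarrow> \<eta> \<in> space (path_borel T) \<Longrightarrow> \<bar>G i \<eta>\<bar> \<le> K i"
  shows "\<exists>B. represents r q (\<lambda>u \<eta>. \<Sum>i\<in>J. G i \<eta> * gflow \<delta> q (l i) u (\<eta> u))
     (\<lambda>u \<eta>. \<Sum>i\<in>J. G i \<eta> * gflow_grad q (l i) u (\<eta> u)) B"
proof -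
  let ?e = "\<lambda>i u \<eta>. gflow \<delta> q (l i) u (\<eta> u)" and ?w = "\<lambda>i u \<eta>. gflow_grad q (l i) u (\<eta> u)"
  define v where "v = (\<lambda>u \<eta>. \<Sum>i\<in>J. G i \<eta> * ?e i u \<eta>)"
  define w where "w = (\<lambda>u \<eta>. \<Sum>i\<in>J. G i \<eta> * ?w i u \<eta>)"
  define B where "B = (\<Sum>i\<in>J. K i * (2 * (l i + 1)))"
  have [measurable]: "G i \<in> borel_measurable (path_borel T)" if "i \<in> J" for i
    using T by (intro measurable_path_filtration_path_borel[OF _ G[OF that]]) auto
  have "represents r q v w B"
    unfolding represents_def
  proof (intro conjI ballI allI impI)
    show "(\<lambda>(u, \<eta>). v u \<eta>) \<in> borel_measurable (borel \<Otimes>\<^sub>M path_borel T)"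
      unfolding v_def case_prod_beta' by measurable
    show "(\<lambda>(u, \<eta>). w u \<eta>) \<in> borel_measurable (borel \<Otimes>\<^sub>M path_borel T)"
      unfolding w_def case_prod_beta' gflow_grad_def by measurable
  next
    fix u assume u: "u \<in> {r..q}"
    have "(\<lambda>\<eta>. \<eta> u) \<in> borel_measurable (path_filtration T q)"
      using u st by (intro canonical_filtration_eval) auto
    moreover have "G i \<in> borel_measurable (path_filtration T q)" if "i \<in> J" for i
      using measurable_path_filtration_mono[OF G[OF that] st(2)] .
    ultimately show "w u \<in> borel_measurable (path_filtration T q)"
      unfolding w_def gflow_grad_def by measurable
  next
    fix u \<eta> assume u: "u \<in> {r..q}" and \<eta>: "\<eta> \<in> space (path_borel T)"
    then have u': "0 \<le> u" "u \<le> q" using st by auto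
    have "\<bar>v u \<eta>\<bar> \<le> (\<Sum>i\<in>J. \<bar>G i \<eta> * ?e i u \<eta>\<bar>)" unfolding v_def by (rule sum_abs)
    also have "\<dots> \<le> B"
      unfolding B_def
    proof (intro sum_mono abs_mult_le)
      fix i assume i: "i \<in> J"
      show "\<bar>G i \<eta>\<bar> \<le> K i" using K i \<eta> by blast
      show "\<bar>?e i u \<eta>\<bar> \<le> 2 * (l i + 1)"
        using gflow_bounds[OF l[OF i] u' \<delta>(1), of "\<eta> u"] l[OF i] by (simp add: abs_le_iff)
    qed
    finally show "\<bar>v u \<eta>\<bar> \<le> B" .
    have "\<bar>w u \<eta>\<bar> \<le> (\<Sum>i\<in>J. \<bar>G i \<eta> * ?w i u \<eta>\<bar>)" unfolding w_def by (rule sum_abs)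
    also have "\<dots> \<le> B"
      unfolding B_def using K \<eta> gflow_grad_bound[OF l u'] by (intro sum_mono abs_mult_le) auto
    finally show "\<bar>w u \<eta>\<bar> \<le> B" .
  next
    fix Q s assume Q: "gauss_solution Q" and s: "s \<in> {r..q}"
    have s': "0 \<le> s" "s \<le> q" using s st by auto
    have Gs: "G i \<in> borel_measurable (path_filtration T s)" if "i \<in> J" for i
      using measurable_path_filtration_mono[OF G[OF that]] s by auto
    \<comment> \<open>Taking 0 as second parameter makes the second flow 1 with vanishing
      derivative, which turns the product identity into the one for \<open>v\<close> itself.\<close>
    have g0: "gflow_grad q 0 u x = 0" for u x by (simp add: gflow_grad_def riccati_def)
    show "(\<integral>\<eta>. v q \<eta> \<partial>Q) - (\<integral>\<eta>. v s \<eta> \<partial>Q) = (LBINT u:{s<..q}. (\<integral>\<eta>. w u \<eta> * b u \<eta> \<partial>Q))"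
      using gflow_sum_identity[OF Q s' st(3) J l _ Gs K, where l'="\<lambda>_. 0"]
      by (simp add: g0 v_def w_def sum_distrib_right mult.assoc del: gflow_q)
    have sq: "(\<Sum>i\<in>J. f i) * (\<Sum>i\<in>J. g i) = (\<Sum>p\<in>J \<times> J. f (fst p) * g (snd p))" for f g :: "'i \<Rightarrow> real"
      by (simp add: sum_product sum.cartesian_product case_prod_beta')
    \<comment> \<open>The square of the sum is a sum over pairs, an instance of the same identity
      with index set \<open>J \<times> J\<close>.\<close>
    have v2: "(v u \<eta>)\<^sup>2 = (\<Sum>p\<in>J \<times> J. (G (fst p) \<eta> * G (snd p) \<eta>) * (?e (fst p) u \<eta> * ?e (snd p) u \<eta>))" for u \<eta>
      unfolding v_def power2_eq_square sq by (simp add: mult_ac)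
    have w2: "(w u \<eta>)\<^sup>2 + 2 * v u \<eta> * w u \<eta> * b u \<eta> = (\<Sum>p\<in>J \<times> J. (G (fst p) \<eta> * G (snd p) \<eta>) *
      (?w (fst p) u \<eta> * ?w (snd p) u \<eta> + (?w (fst p) u \<eta> * ?e (snd p) u \<eta> + ?e (fst p) u \<eta> * ?w (snd p) u \<eta>) * b u \<eta>))" for u \<eta>
    proof -
      have "(w u \<eta>)\<^sup>2 + 2 * v u \<eta> * w u \<eta> * b u \<eta> = w u \<eta> * w u \<eta> + (w u \<eta> * v u \<eta> + v u \<eta> * w u \<eta>) * b u \<eta>"
        by (simp add: power2_eq_square algebra_simps)
      then show ?thesis
        unfolding v_def w_def sq
        by (simp only: sum_distrib_right sum.distrib[symmetric]) (intro sum.cong refl, simp add: algebra_simps)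
    qed
    show "(\<integral>\<eta>. (v q \<eta>)\<^sup>2 \<partial>Q) - (\<integral>\<eta>. (v s \<eta>)\<^sup>2 \<partial>Q) =
         (LBINT u:{s<..q}. (\<integral>\<eta>. (w u \<eta>)\<^sup>2 + 2 * v u \<eta> * w u \<eta> * b u \<eta> \<partial>Q))"
      unfolding v2 w2
    proof (rule gflow_sum_identity[OF Q s' st(3), where l="\<lambda>p. l (fst p)" and l'="\<lambda>p. l (snd p)"
          and K="\<lambda>p. K (fst p) * K (snd p)" and I="J \<times> J" and H="\<lambda>p \<eta>. G (fst p) \<eta> * G (snd p) \<eta>"])
      show "\<bar>G (fst p) \<eta> * G (snd p) \<eta>\<bar> \<le> K (fst p) * K (snd p)"
        if "p \<in> J \<times> J" "\<eta> \<in> space (path_borel T)" for p \<eta>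
        using that K by (intro abs_mult_le) auto
    qed (use J l Gs in \<open>auto intro!: borel_measurable_times\<close>)
  qed
  then show ?thesis unfolding v_def w_def by blast
qed

text \<open>The left sides telescope because the two values agree at \<open>r\<close>, and the time
  integrals add over adjacent intervals. At \<open>r\<close> itself the first piece is
  chosen.\<close>

lemma represents_glue:
  assumes 1: "represents t r v1 w1 B1" and 2: "represents r q v2 w2 B2"
    and eq: "v1 r = v2 r" and tq: "t \<le> r" "r \<le> q"
  shows "represents t q (\<lambda>u. if u \<le> r then v1 u else v2 u) (\<lambda>u. if u \<le> r then w1 u else w2 u) (max B1 B2)"
    (is "represents t q ?v ?w ?B")
proof -
  note 1 = 1[unfolded represents_def] and 2 = 2[unfolded represents_def]
  have vq: "?v q = v2 q" using eq tq by auto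
  have [measurable]: "(\<lambda>p. v1 (fst p) (snd p)) \<in> borel_measurable (borel \<Otimes>\<^sub>M path_borel T)"
    "(\<lambda>p. w1 (fst p) (snd p)) \<in> borel_measurable (borel \<Otimes>\<^sub>M path_borel T)"
    "(\<lambda>p. v2 (fst p) (snd p)) \<in> borel_measurable (borel \<Otimes>\<^sub>M path_borel T)"
    "(\<lambda>p. w2 (fst p) (snd p)) \<in> borel_measurable (borel \<Otimes>\<^sub>M path_borel T)"
    using 1 2 by (auto simp: case_prod_beta')
  have j: "(\<lambda>(u, \<eta>). (if u \<le> r then f u else g u) \<eta>) = (\<lambda>p. if fst p \<le> r then f (fst p) (snd p) else g (fst p) (snd p))"
    for f g :: "real \<Rightarrow> (real \<Rightarrow> real) \<Rightarrow> real" by auto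
  have bd: "\<bar>?v u \<eta>\<bar> \<le> ?B \<and> \<bar>?w u \<eta>\<bar> \<le> ?B" if "u \<in> {t..q}" "\<eta> \<in> space (path_borel T)" for u \<eta>
  proof (cases "u \<le> r")
    case True
    then have "\<bar>v1 u \<eta>\<bar> \<le> B1 \<and> \<bar>w1 u \<eta>\<bar> \<le> B1" using 1 that by auto
    then show ?thesis using True by auto
  next
    case False
    then have "\<bar>v2 u \<eta>\<bar> \<le> B2 \<and> \<bar>w2 u \<eta>\<bar> \<le> B2" using 2 that by auto
    then show ?thesis using False by auto
  qed
  have mw: "?w u \<in> borel_measurable (path_filtration T q)" if "u \<in> {t..q}" for u
    using 1 2 that tq measurable_path_filtration_mono[of "w1 u" T r q] by auto
  show ?thesis
    unfolding represents_def j
  proof (intro conjI ballI allI impI)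
    fix Q s assume Q: "gauss_solution Q" and s: "s \<in> {t..q}"
    interpret Q: prob_space Q using gauss_solutionD(1)[OF Q] .
    note spQ = gauss_solutionD(3)[OF Q] and jQ = gauss_solutionD(4)[OF Q] and mQ = gauss_solutionD(5)[OF Q]
    \<comment> \<open>The identities for \<open>v\<close> and for its square have the same shape, a
      function \<open>f\<close> of \<open>v\<close> and a density \<open>h\<close>; the additivity
      argument is made once for both.\<close>
    have combine: "(\<integral>\<eta>. f (v2 q \<eta>) \<partial>Q) - (\<integral>\<eta>. f (?v s \<eta>) \<partial>Q) = (LBINT u:{s<..q}. (\<integral>\<eta>. h (?v u \<eta>) (?w u \<eta>) (b u \<eta>) \<partial>Q))"
      if I1: "\<And>s. s \<in> {t..r} \<Longrightarrow> (\<integral>\<eta>. f (v1 r \<eta>) \<partial>Q) - (\<integral>\<eta>. f (v1 s \<eta>) \<partial>Q) = (LBINT u:{s<..r}. (\<integral>\<eta>. h (v1 u \<eta>) (w1 u \<eta>) (b u \<eta>) \<partial>Q))"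
        and I2: "\<And>s. s \<in> {r..q} \<Longrightarrow> (\<integral>\<eta>. f (v2 q \<eta>) \<partial>Q) - (\<integral>\<eta>. f (v2 s \<eta>) \<partial>Q) = (LBINT u:{s<..q}. (\<integral>\<eta>. h (v2 u \<eta>) (w2 u \<eta>) (b u \<eta>) \<partial>Q))"
        and hj: "(\<lambda>(u, \<eta>). h (?v u \<eta>) (?w u \<eta>) (b u \<eta>)) \<in> borel_measurable (borel \<Otimes>\<^sub>M Q)"
        and hb: "\<And>u \<eta>. u \<in> {t..q} \<Longrightarrow> \<eta> \<in> space Q \<Longrightarrow> \<bar>h (?v u \<eta>) (?w u \<eta>) (b u \<eta>)\<bar> \<le> M"
      for f :: "real \<Rightarrow> real" and h :: "real \<Rightarrow> real \<Rightarrow> real \<Rightarrow> real" and M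
    proof (cases "s \<le> r")
      case False
      then show ?thesis using I2[of s] s by (auto intro!: set_lebesgue_integral_cong)
    next
      case True
      have un: "{s<..q} = {s<..r} \<union> {r<..q}" using True tq by auto
      have int: "set_integrable lborel {x<..y} (\<lambda>u. \<integral>\<eta>. h (?v u \<eta>) (?w u \<eta>) (b u \<eta>) \<partial>Q)" if "t \<le> x" "y \<le> q" for x y
        using hb that by (intro time_fubini(1)[OF Q.prob_space_axioms, where B=M and f="\<lambda>u \<eta>. h (?v u \<eta>) (?w u \<eta>) (b u \<eta>)"] hj) auto
      have "(LBINT u:{s<..q}. (\<integral>\<eta>. h (?v u \<eta>) (?w u \<eta>) (b u \<eta>) \<partial>Q)) =
        (LBINT u:{s<..r}. (\<integral>\<eta>. h (?v u \<eta>) (?w u \<eta>) (b u \<eta>) \<partial>Q)) + (LBINT u:{r<..q}. (\<integral>\<eta>. h (?v u \<eta>) (?w u \<eta>) (b u \<eta>) \<partial>Q))"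
        unfolding un using s tq by (intro set_integral_Un int) auto
      also have "(LBINT u:{s<..r}. (\<integral>\<eta>. h (?v u \<eta>) (?w u \<eta>) (b u \<eta>) \<partial>Q)) = (\<integral>\<eta>. f (v1 r \<eta>) \<partial>Q) - (\<integral>\<eta>. f (v1 s \<eta>) \<partial>Q)"
        using I1[of s] True s by (auto intro!: set_lebesgue_integral_cong)
      also have "(LBINT u:{r<..q}. (\<integral>\<eta>. h (?v u \<eta>) (?w u \<eta>) (b u \<eta>) \<partial>Q)) = (\<integral>\<eta>. f (v2 q \<eta>) \<partial>Q) - (\<integral>\<eta>. f (v2 r \<eta>) \<partial>Q)"
        unfolding I2[of r, unfolded atLeastAtMost_iff, OF conjI[OF order_refl tq(2)]]
        by (auto intro!: set_lebesgue_integral_cong)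
      finally show ?thesis using True eq by simp
    qed
    show "(\<integral>\<eta>. ?v q \<eta> \<partial>Q) - (\<integral>\<eta>. ?v s \<eta> \<partial>Q) = (LBINT u:{s<..q}. (\<integral>\<eta>. ?w u \<eta> * b u \<eta> \<partial>Q))"
      unfolding vq
    proof (rule combine[of "\<lambda>x. x" "\<lambda>v w b. w * b" "?B * C"])
      show "(\<lambda>(u, \<eta>). ?w u \<eta> * b u \<eta>) \<in> borel_measurable (borel \<Otimes>\<^sub>M Q)"
        unfolding jQ case_prod_beta' if_distribR by measurable
      show "\<bar>?w u \<eta> * b u \<eta>\<bar> \<le> ?B * C" if "u \<in> {t..q}" "\<eta> \<in> space Q" for u \<eta>
        using bd[OF that(1)] b_bound that(2) spQ by (intro abs_mult_le) auto
    qed (use 1 2 Q in auto)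
    show "(\<integral>\<eta>. (?v q \<eta>)\<^sup>2 \<partial>Q) - (\<integral>\<eta>. (?v s \<eta>)\<^sup>2 \<partial>Q) =
         (LBINT u:{s<..q}. (\<integral>\<eta>. (?w u \<eta>)\<^sup>2 + 2 * ?v u \<eta> * ?w u \<eta> * b u \<eta> \<partial>Q))"
      unfolding vq
    proof (rule combine[of "\<lambda>x. x\<^sup>2" "\<lambda>v w b. w\<^sup>2 + 2 * v * w * b" "?B * ?B + 2 * ?B * ?B * C"])
      show "(\<lambda>(u, \<eta>). (?w u \<eta>)\<^sup>2 + 2 * ?v u \<eta> * ?w u \<eta> * b u \<eta>) \<in> borel_measurable (borel \<Otimes>\<^sub>M Q)"
        unfolding jQ case_prod_beta' if_distribR by measurable
      show "\<bar>(?w u \<eta>)\<^sup>2 + 2 * ?v u \<eta> * ?w u \<eta> * b u \<eta>\<bar> \<le> ?B * ?B + 2 * ?B * ?B * C" if "u \<in> {t..q}" "\<eta> \<in> space Q" for u \<eta>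
      proof -
        have vb: "\<bar>?v u \<eta>\<bar> \<le> ?B" and wb: "\<bar>?w u \<eta>\<bar> \<le> ?B" and bb: "\<bar>b u \<eta>\<bar> \<le> C"
          using bd[OF that(1)] b_bound that(2) spQ by auto
        have "\<bar>?w u \<eta> * ?w u \<eta>\<bar> \<le> ?B * ?B" "\<bar>2 * ?v u \<eta> * ?w u \<eta> * b u \<eta>\<bar> \<le> 2 * ?B * ?B * C"
          by (rule abs_mult_le[OF wb wb]) (rule abs_mult_le[OF abs_mult_le[OF abs_mult_le[OF _ vb] wb] bb], simp)
        then show ?thesis unfolding power2_eq_square by linarith
      qed
    qed (use 1 2 Q in auto)
  qed (use mw bd in \<open>auto simp: if_distribR\<close>)
qed

text \<open>Backward recursion over the evaluation times after \<open>t\<close>. The factor at the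
  latest time flows back to the preceding time, where it is again a Gaussian and merges with the
  weight there; after the latest time the process is constant. The recursion ends at
  \<open>t\<close> with a cylinder functional up to \<open>t\<close>.\<close>

lemma represents_sum_cexp:
  assumes "finite A" and t: "0 \<le> t"
  shows "A \<subseteq> {t<..q} \<Longrightarrow> t \<le> q \<Longrightarrow> q \<le> T \<Longrightarrow> finite S \<Longrightarrow> S \<subseteq> {0..t} \<Longrightarrow> (\<And>j s. 0 \<le> c j s) \<Longrightarrow>
    \<exists>v w B. represents t q v w B \<and> v q = (\<lambda>\<eta>. \<Sum>j<(n::nat). a j * cexp (S \<union> A) (c j) \<eta>) \<and> v t \<in> cyl t"
  using assms(1)
proof (induction A arbitrary: q S a c rule: finite_linorder_max_induct)
  case empty
  let ?\<Phi> = "\<lambda>\<eta>. \<Sum>j<n. a j * cexp S (c j) \<eta>"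
  have \<Phi>: "?\<Phi> \<in> cyl t" using empty by (intro cyl_sum cyl_scaled_cexp) auto
  then obtain B where "\<And>\<eta>. \<bar>?\<Phi> \<eta>\<bar> \<le> B" using cyl_bounded by blast
  moreover have "?\<Phi> \<in> borel_measurable (path_borel T)"
    using T empty(2,3) by (intro measurable_path_filtration_path_borel[OF _ cyl_measurable[OF \<Phi>]]) auto
  ultimately have "represents t q (\<lambda>_. ?\<Phi>) (\<lambda>_ _. 0) B" by (intro represents_const) auto
  then show ?case using \<Phi> by (intro exI[of _ "\<lambda>_. ?\<Phi>"] exI[of _ "\<lambda>_ _. 0"] exI[of _ B]) auto
next
  case (insert b' A)
  \<comment> \<open>The preceding evaluation time, or \<open>t\<close> if none is left. In the
    latter case \<open>r\<close> may not occur in \<open>S\<close>, hence \<open>insert t S\<close>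
    in the induction step.\<close>
  define r where "r = (if A = {} then t else Max A)"
  have bq: "t < b'" "b' \<le> q" using insert.prems by auto
  have r: "t \<le> r" "r < b'" "A \<subseteq> {t<..r}" "r \<in> insert t S \<union> A"
  proof -
    have "t \<le> r \<and> r < b' \<and> r \<in> insert t S \<union> A"
    proof (cases "A = {}")
      case False
      then have "Max A \<in> A" using insert.hyps by simp
      then have "t < Max A" "Max A < b'" "Max A \<in> A"
        using subsetD[OF insert.prems(1)] insert.hyps(2) by fastforce+
      then show ?thesis using False by (simp add: r_def)
    qed (use bq in \<open>auto simp: r_def\<close>)
    then show "t \<le> r" "r < b'" "r \<in> insert t S \<union> A" by auto
    show "A \<subseteq> {t<..r}" using insert.hyps insert.prems by (auto simp: r_def)
  qed
  define G where "G = (\<lambda>j \<eta>. a j * cexp (S \<union> A) (c j) \<eta>)"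
  define l where "l = (\<lambda>j. c j b')"
  define a' where "a' = (\<lambda>j. a j * (1 + 2 * l j * (b' - r)) powr (- \<delta> / 2))"
  \<comment> \<open>The old weights together with the weight which the flowed factor deposits at
    \<open>r\<close>; its scalar prefactor goes into \<open>a'\<close>.\<close>
  define c' where "c' = (\<lambda>j s. (if s \<in> S \<union> A then c j s else 0) + (if s = r then riccati b' (l j) r else 0))"
  have fin: "finite (S \<union> A)" using insert by auto
  have SA: "S \<union> A \<subseteq> {0..r}"
  proof -
    have "{0..t} \<subseteq> {0..r}" "{t<..r} \<subseteq> {0..r}" using r(1) t by auto
    then show ?thesis using r(3) insert.prems(5) by blast
  qed
  have rT: "r \<le> T" using r bq insert.prems by auto
  have cG: "\<bar>G j \<eta>\<bar> \<le> \<bar>a j\<bar> * 1" for j \<eta>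
    unfolding G_def using cexp_bounds[of "c j"] insert.prems by (intro abs_mult_le) auto
  have mG: "G j \<in> borel_measurable (path_filtration T r)" for j
    unfolding G_def using measurable_cexp[OF fin SA rT] by measurable
  obtain B2 where B2: "represents r b' (\<lambda>u \<eta>. \<Sum>j<n. G j \<eta> * gflow \<delta> b' (l j) u (\<eta> u))
     (\<lambda>u \<eta>. \<Sum>j<n. G j \<eta> * gflow_grad b' (l j) u (\<eta> u)) B2"
    using represents_gflow[of r b' "{..<n}" l G "\<lambda>j. \<bar>a j\<bar> * 1"] r bq t insert.prems mG cG
    by (auto simp: l_def)
  let ?v2 = "\<lambda>u \<eta>. \<Sum>j<n. G j \<eta> * gflow \<delta> b' (l j) u (\<eta> u)"
  let ?\<Phi> = "\<lambda>\<eta>. \<Sum>j<n. a j * cexp (S \<union> insert b' A) (c j) \<eta>"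
  \<comment> \<open>\<open>b'\<close> is a new time, so its factor splits off the product and
    appears exactly once.\<close>
  have nb: "b' \<notin> S \<union> A" using insert.hyps insert.prems bq by fastforce
  have v2b: "?v2 b' = ?\<Phi>"
    using fin nb by (auto simp: fun_eq_iff G_def l_def cexp_def exp_add[symmetric] mult.assoc intro!: sum.cong)
  have v2r: "?v2 r = (\<lambda>\<eta>. \<Sum>j<n. a' j * cexp (insert t S \<union> A) (c' j) \<eta>)"
  proof (intro ext sum.cong refl)
    fix \<eta> j
    have "(\<Sum>s\<in>insert t S \<union> A. c' j s * (\<eta> s)\<^sup>2) =
      (\<Sum>s\<in>insert t S \<union> A. (if s \<in> S \<union> A then c j s else 0) * (\<eta> s)\<^sup>2) +
      (\<Sum>s\<in>insert t S \<union> A. (if s = r then riccati b' (l j) r else 0) * (\<eta> s)\<^sup>2)"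
      unfolding c'_def by (simp only: distrib_right sum.distrib)
    also have "(\<Sum>s\<in>insert t S \<union> A. (if s \<in> S \<union> A then c j s else 0) * (\<eta> s)\<^sup>2) = (\<Sum>s\<in>S \<union> A. c j s * (\<eta> s)\<^sup>2)"
      using fin by (intro sum.mono_neutral_cong_right) auto
    also have "(\<Sum>s\<in>insert t S \<union> A. (if s = r then riccati b' (l j) r else 0) * (\<eta> s)\<^sup>2) =
      (\<Sum>s\<in>insert t S \<union> A. if s = r then riccati b' (l j) r * (\<eta> s)\<^sup>2 else 0)"
      by (intro sum.cong) auto
    also have "\<dots> = riccati b' (l j) r * (\<eta> r)\<^sup>2"
      using fin r(4) by (subst sum.delta) auto
    finally show "G j \<eta> * gflow \<delta> b' (l j) r (\<eta> r) = a' j * cexp (insert t S \<union> A) (c' j) \<eta>"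
      by (simp add: G_def a'_def gflow_def cexp_def exp_add[symmetric] mult_ac exp_diff exp_minus field_simps)
  qed
  have "0 \<le> c' j s" for j s
    using insert.prems riccati_bounds(1)[of "l j" r b' T] r t bq unfolding c'_def l_def by auto
  then obtain v1 w1 B1 where 1: "represents t r v1 w1 B1"
      "v1 r = (\<lambda>\<eta>. \<Sum>j<n. a' j * cexp (insert t S \<union> A) (c' j) \<eta>)" "v1 t \<in> cyl t"
    using insert.IH[of r "insert t S" c' a'] r rT insert.prems t by auto
  have "?\<Phi> \<in> cyl q"
  proof (intro cyl_sum cyl_scaled_cexp)
    have "{0..r} \<subseteq> {0..q}" "b' \<in> {0..q}" using r bq t by auto
    then show "S \<union> insert b' A \<subseteq> {0..q}" using SA by blast
    show "finite (S \<union> insert b' A)" using fin by simp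
  qed (use insert.prems in auto)
  then have \<Phi>m: "?\<Phi> \<in> borel_measurable (path_borel T)" and "\<exists>K. \<forall>\<eta>. \<bar>?\<Phi> \<eta>\<bar> \<le> K"
    using T insert.prems measurable_path_filtration_path_borel[OF _ cyl_measurable[of ?\<Phi> q T]] cyl_bounded by auto
  then obtain B3 where 3: "represents b' q (\<lambda>_. ?\<Phi>) (\<lambda>_ _. 0) B3"
    using represents_const[OF \<Phi>m] by blast
  have eq1: "v1 r = ?v2 r" using 1(2) v2r by simp
  note g1 = represents_glue[OF 1(1) B2 eq1 r(1) less_imp_le[OF r(2)]]
  have eq2: "(if b' \<le> r then v1 b' else ?v2 b') = ?\<Phi>" using r v2b by simp
  note g2 = represents_glue[OF g1 3 eq2 less_imp_le[OF bq(1)] bq(2)]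
  show ?case
  proof (intro exI conjI, rule g2)
    show "(if q \<le> b' then if q \<le> r then v1 q else ?v2 q else ?\<Phi>) = ?\<Phi>"
      using bq r v2b by (auto dest: antisym)
    show "(if t \<le> b' then if t \<le> r then v1 t else ?v2 t else ?\<Phi>) \<in> cyl t"
      using bq r 1(3) by auto
  qed
qed

lemma cyl_represents:
  assumes "0 \<le> t" "t \<le> q" "q \<le> T" "\<Phi> \<in> cyl q"
  shows "\<exists>v w B. represents t q v w B \<and> v q = \<Phi> \<and> v t \<in> cyl t"
proof -
  obtain S n a c where S: "finite S" "S \<subseteq> {0..q}" "\<forall>j s. 0 \<le> c j s"
    and \<Phi>: "\<Phi> = (\<lambda>\<eta>. \<Sum>j<(n::nat). a j * cexp S (c j) \<eta>)"
    using cyl_normal_form[OF assms(4)] by blast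
  have "S = (S \<inter> {0..t}) \<union> (S \<inter> {t<..q})" using S assms by auto
  then show ?thesis
    using represents_sum_cexp[of "S \<inter> {t<..q}" t q "S \<inter> {0..t}" c a n] S assms unfolding \<Phi> by auto
qed

end

section \<open>Energy estimate\<close>

text \<open>Cauchy-Schwarz, obtained by integrating the square of the deviation of \<open>g\<close>
  from its mean \<open>I / L\<close>.\<close>

lemma set_integral_square_le:
  fixes g :: "real \<Rightarrow> real"
  assumes "t \<le> q" "g \<in> borel_measurable borel" "\<And>u. t < u \<Longrightarrow> u \<le> q \<Longrightarrow> \<bar>g u\<bar> \<le> K"
  shows "(LBINT u:{t<..q}. g u)\<^sup>2 \<le> (q - t) * (LBINT u:{t<..q}. (g u)\<^sup>2)"
proof (cases "t = q")
  case False
  define L where "L = q - t"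
  define I where "I = (LBINT u:{t<..q}. g u)"
  have L: "0 < L" using False assms by (simp add: L_def)
  have i1: "set_integrable lborel {t<..q} g" using assms by (intro set_integrable_bounded)
  have i2: "set_integrable lborel {t<..q} (\<lambda>u. (g u)\<^sup>2)"
    using assms by (intro set_integrable_bounded[of _ _ _ "K * K"]) (auto simp only: power2_eq_square intro!: abs_mult_le borel_measurable_times)
  have i3: "set_integrable lborel {t<..q} (\<lambda>u. (I / L)\<^sup>2)"
    by (intro set_integrable_bounded[of _ _ _ "(I / L)\<^sup>2"]) auto
  have "0 \<le> (LBINT u:{t<..q}. (g u - I / L)\<^sup>2)"
    unfolding set_lebesgue_integral_def by (intro Bochner_Integration.integral_nonneg) auto
  also have "\<dots> = (LBINT u:{t<..q}. ((g u)\<^sup>2 - (2 * (I / L)) * g u) + (I / L)\<^sup>2)"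
    by (intro set_lebesgue_integral_cong) (auto simp: power2_eq_square algebra_simps)
  also have "\<dots> = (LBINT u:{t<..q}. (g u)\<^sup>2) - (2 * (I / L)) * I + (I / L)\<^sup>2 * L"
    using i1 i2 i3 assms(1)
    by (simp add: set_integral_add set_integral_diff set_integral_const I_def[symmetric] L_def)
  also have "\<dots> = (LBINT u:{t<..q}. (g u)\<^sup>2) - I\<^sup>2 / L"
    using L by (simp add: power2_eq_square field_simps)
  finally show ?thesis using L by (simp add: I_def[symmetric] L_def[symmetric] field_simps)
qed (simp add: set_lebesgue_integral_def)

context bounded_drift
begin

text \<open>The cross term is absorbed by \<open>2 v w b \<ge> - w^2 / 2 - 2 C^2 v^2\<close>. On a
  short interval the resulting multiple of \<open>v^2\<close> costs at most the supremum
  \<open>m\<close> of its expectation, and \<open>m\<close> is itself at most twice the terminal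
  value.\<close>

lemma represents_energy:
  assumes rep: "represents t q v w B" and Q: "gauss_solution Q" and tq: "t \<le> q" "4 * C\<^sup>2 * (q - t) \<le> 1"
  shows "(LBINT u:{t<..q}. (\<integral>\<eta>. (w u \<eta>)\<^sup>2 \<partial>Q)) \<le> 4 * (\<integral>\<eta>. (v q \<eta>)\<^sup>2 \<partial>Q)"
    and "set_integrable lborel {t<..q} (\<lambda>u. \<integral>\<eta>. (w u \<eta>)\<^sup>2 \<partial>Q)"
proof -
  interpret Q: prob_space Q using gauss_solutionD(1)[OF Q] .
  note spQ = gauss_solutionD(3)[OF Q] and jQ = gauss_solutionD(4)[OF Q] and mQ = gauss_solutionD(5)[OF Q]
  note rep = rep[unfolded represents_def]
  have [measurable]: "(\<lambda>p. v (fst p) (snd p)) \<in> borel_measurable (borel \<Otimes>\<^sub>M path_borel T)"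
    "(\<lambda>p. w (fst p) (snd p)) \<in> borel_measurable (borel \<Otimes>\<^sub>M path_borel T)"
    using rep by (auto simp: case_prod_beta')
  define D where "D = (\<lambda>u \<eta>. (w u \<eta>)\<^sup>2 + 2 * v u \<eta> * w u \<eta> * b u \<eta>)"
  have vb: "\<bar>v u \<eta>\<bar> \<le> B" and wb: "\<bar>w u \<eta>\<bar> \<le> B" if "u \<in> {t..q}" "\<eta> \<in> space Q" for u \<eta>
    using rep that spQ by auto
  have bb: "\<bar>b u \<eta>\<bar> \<le> C" if "\<eta> \<in> space Q" for u \<eta> using b_bound that spQ by simp
  have v2b: "\<bar>(v u \<eta>)\<^sup>2\<bar> \<le> B * B" and w2b: "\<bar>(w u \<eta>)\<^sup>2\<bar> \<le> B * B" if "u \<in> {t..q}" "\<eta> \<in> space Q" for u \<eta>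
    unfolding power2_eq_square by (rule abs_mult_le[OF vb[OF that] vb[OF that]], rule abs_mult_le[OF wb[OF that] wb[OF that]])
  have Db: "\<bar>D u \<eta>\<bar> \<le> B * B + 2 * B * B * C" if u: "u \<in> {t..q}" and \<eta>: "\<eta> \<in> space Q" for u \<eta>
  proof -
    have "\<bar>2 * v u \<eta> * w u \<eta> * b u \<eta>\<bar> \<le> 2 * B * B * C"
      by (rule abs_mult_le[OF abs_mult_le[OF abs_mult_le[OF _ vb[OF u \<eta>]] wb[OF u \<eta>]] bb[OF \<eta>]]) simp
    then show ?thesis unfolding D_def using w2b[OF u \<eta>] by linarith
  qed
  have j: "(\<lambda>(u, \<eta>). (w u \<eta>)\<^sup>2) \<in> borel_measurable (borel \<Otimes>\<^sub>M Q)" "(\<lambda>(u, \<eta>). (v u \<eta>)\<^sup>2) \<in> borel_measurable (borel \<Otimes>\<^sub>M Q)"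
    "(\<lambda>(u, \<eta>). D u \<eta>) \<in> borel_measurable (borel \<Otimes>\<^sub>M Q)"
    unfolding jQ case_prod_beta' D_def by measurable
  have iv: "integrable Q (\<lambda>\<eta>. (v u \<eta>)\<^sup>2)" and iw: "integrable Q (\<lambda>\<eta>. (w u \<eta>)\<^sup>2)" and iD: "integrable Q (D u)"
    if "u \<in> {t..q}" for u
    using v2b[OF that] w2b[OF that] Db[OF that] measurable_section[OF j(1), of u] measurable_section[OF j(2), of u] measurable_section[OF j(3), of u]
    by (auto intro!: Q.integrable_const_bound AE_I2)
  have siw: "set_integrable lborel {s<..q} (\<lambda>u. \<integral>\<eta>. (w u \<eta>)\<^sup>2 \<partial>Q)" if "s \<in> {t..q}" for s
    using w2b that by (intro time_fubini(1)[OF Q.prob_space_axioms j(1), where B="B * B"]) auto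
  have siD: "set_integrable lborel {s<..q} (\<lambda>u. \<integral>\<eta>. D u \<eta> \<partial>Q)" if "s \<in> {t..q}" for s
    using Db that by (intro time_fubini(1)[OF Q.prob_space_axioms j(3), where B="B * B + 2 * B * B * C"]) auto
  show "set_integrable lborel {t<..q} (\<lambda>u. \<integral>\<eta>. (w u \<eta>)\<^sup>2 \<partial>Q)" using siw tq by auto
  define N where "N = (\<lambda>u. \<integral>\<eta>. (v u \<eta>)\<^sup>2 \<partial>Q)"
  \<comment> \<open>Working with the supremum over the interval replaces a Gronwall argument; the
    bound on \<open>v\<close> makes it finite.\<close>
  define m where "m = (SUP u\<in>{t..q}. N u)"
  have "N u \<le> B * B" if "u \<in> {t..q}" for u
  proof -
    have "N u \<le> (\<integral>\<eta>. B * B \<partial>Q)"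
      unfolding N_def using iv[OF that] v2b[OF that] by (intro integral_mono) auto
    then show ?thesis by (simp add: Q.prob_space)
  qed
  then have bdd: "bdd_above (N ` {t..q})" by (intro bdd_aboveI2)
  have Nm: "N u \<le> m" if "u \<in> {t..q}" for u unfolding m_def using bdd that by (rule cSUP_upper2) auto
  have N0: "0 \<le> N u" for u unfolding N_def by simp
  have m0: "0 \<le> m" using N0[of q] Nm[of q] tq by auto
  have main: "(LBINT u:{s<..q}. (\<integral>\<eta>. (w u \<eta>)\<^sup>2 \<partial>Q)) \<le> 2 * (N q - N s) + m" if s: "s \<in> {t..q}" for s
  proof -
    have Dlow: "(\<integral>\<eta>. (w u \<eta>)\<^sup>2 \<partial>Q) / 2 - 2 * C\<^sup>2 * m \<le> (\<integral>\<eta>. D u \<eta> \<partial>Q)" if u: "u \<in> {s<..q}" for u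
    proof -
      have u': "u \<in> {t..q}" using u s by auto
      have "(w u \<eta>)\<^sup>2 / 2 - 2 * C\<^sup>2 * (v u \<eta>)\<^sup>2 \<le> D u \<eta>" if \<eta>: "\<eta> \<in> space Q" for \<eta>
      proof -
        have "(b u \<eta>)\<^sup>2 \<le> C\<^sup>2" using bb[OF \<eta>, of u] by (metis abs_ge_zero power2_abs power_mono)
        then have "(b u \<eta>)\<^sup>2 * (v u \<eta>)\<^sup>2 \<le> C\<^sup>2 * (v u \<eta>)\<^sup>2" by (intro mult_right_mono) auto
        \<comment> \<open>Completing the square with weights that leave half of \<open>w^2\<close>
          over.\<close>
        moreover have "0 \<le> (w u \<eta> + 2 * v u \<eta> * b u \<eta>)\<^sup>2" by simp
        then have "0 \<le> (w u \<eta>)\<^sup>2 + 4 * v u \<eta> * w u \<eta> * b u \<eta> + 4 * ((b u \<eta>)\<^sup>2 * (v u \<eta>)\<^sup>2)"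
          by (simp add: power2_eq_square algebra_simps)
        ultimately show ?thesis unfolding D_def by linarith
      qed
      then have "(\<integral>\<eta>. (w u \<eta>)\<^sup>2 / 2 - 2 * C\<^sup>2 * (v u \<eta>)\<^sup>2 \<partial>Q) \<le> (\<integral>\<eta>. D u \<eta> \<partial>Q)"
        using iv[OF u'] iw[OF u'] iD[OF u'] by (intro integral_mono) auto
      moreover have "(\<integral>\<eta>. (w u \<eta>)\<^sup>2 / 2 - 2 * C\<^sup>2 * (v u \<eta>)\<^sup>2 \<partial>Q) = (\<integral>\<eta>. (w u \<eta>)\<^sup>2 \<partial>Q) / 2 - 2 * C\<^sup>2 * N u"
        unfolding N_def using iv[OF u'] iw[OF u'] by simp
      moreover have "2 * C\<^sup>2 * N u \<le> 2 * C\<^sup>2 * m" using Nm[OF u'] by (intro mult_left_mono) auto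
      ultimately show ?thesis by linarith
    qed
    have k: "set_integrable lborel {s<..q} (\<lambda>u. 2 * C\<^sup>2 * m)"
      by (intro set_integrable_bounded[of _ _ _ "\<bar>2 * C\<^sup>2 * m\<bar>"]) auto
    have "(LBINT u:{s<..q}. (\<integral>\<eta>. (w u \<eta>)\<^sup>2 \<partial>Q)) / 2 - 2 * C\<^sup>2 * m * (q - s) =
      (LBINT u:{s<..q}. (\<integral>\<eta>. (w u \<eta>)\<^sup>2 \<partial>Q) / 2 - 2 * C\<^sup>2 * m)"
      using siw[OF s] k s by (simp add: set_integral_diff set_integral_const)
    also have "\<dots> \<le> (LBINT u:{s<..q}. (\<integral>\<eta>. D u \<eta> \<partial>Q))"
      using siw[OF s] siD[OF s] k Dlow by (intro set_integral_mono set_integral_diff(1)) auto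
    also have "\<dots> = N q - N s"
      using rep Q s by (simp add: N_def D_def)
    finally have 1: "(LBINT u:{s<..q}. (\<integral>\<eta>. (w u \<eta>)\<^sup>2 \<partial>Q)) \<le> 2 * (N q - N s) + m * (4 * C\<^sup>2 * (q - s))"
      by (simp add: algebra_simps)
    have "4 * C\<^sup>2 * (q - s) \<le> 4 * C\<^sup>2 * (q - t)" using s by (intro mult_left_mono) auto
    then have "m * (4 * C\<^sup>2 * (q - s)) \<le> m * 1" using m0 tq by (intro mult_left_mono) auto
    then show ?thesis using 1 by simp
  qed
  have "N s \<le> N q + m / 2" if "s \<in> {t..q}" for s
  proof -
    have "0 \<le> (LBINT u:{s<..q}. (\<integral>\<eta>. (w u \<eta>)\<^sup>2 \<partial>Q))"
      unfolding set_lebesgue_integral_def by (intro Bochner_Integration.integral_nonneg) auto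
    from order_trans[OF this main[OF that]] show ?thesis by (simp add: field_simps)
  qed
  \<comment> \<open>Taking the supremum over \<open>s\<close> gives \<open>m \<le> 2 * N q\<close>,
    so the estimate \<open>2 * N q + m\<close> at time \<open>t\<close> becomes
    \<open>4 * N q\<close>.\<close>
  then have "m \<le> N q + m / 2" unfolding m_def[symmetric] using tq
    by (subst m_def) (intro cSUP_least, auto)
  then have "(LBINT u:{t<..q}. (\<integral>\<eta>. (w u \<eta>)\<^sup>2 \<partial>Q)) \<le> 4 * N q"
    using main[of t] N0[of t] tq by auto
  then show "(LBINT u:{t<..q}. (\<integral>\<eta>. (w u \<eta>)\<^sup>2 \<partial>Q)) \<le> 4 * (\<integral>\<eta>. (v q \<eta>)\<^sup>2 \<partial>Q)"
    by (simp add: N_def)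
qed

end

section \<open>Comparison of two solutions\<close>

text \<open>Path space contains all continuous paths, so nonnegativity can only hold almost surely.
  It makes functionals of squares determine the path.\<close>

locale two_solutions = bounded_drift +
  fixes Q1 Q2 :: "(real \<Rightarrow> real) measure"
  assumes Q1: "gauss_solution Q1" and Q2: "gauss_solution Q2"
    and nonneg: "\<And>s. s \<in> {0..T} \<Longrightarrow> AE \<eta> in Q1. 0 \<le> \<eta> s" "\<And>s. s \<in> {0..T} \<Longrightarrow> AE \<eta> in Q2. 0 \<le> \<eta> s"
begin

sublocale Q1: prob_space Q1 using gauss_solutionD(1)[OF Q1] .
sublocale Q2: prob_space Q2 using gauss_solutionD(1)[OF Q2] .

definition bdd_meas :: "((real \<Rightarrow> real) \<Rightarrow> real) \<Rightarrow> bool" where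
  "bdd_meas \<Phi> \<longleftrightarrow> \<Phi> \<in> borel_measurable (path_borel T) \<and> (\<exists>K. \<forall>\<eta>\<in>space (path_borel T). \<bar>\<Phi> \<eta>\<bar> \<le> K)"

definition gap :: "((real \<Rightarrow> real) \<Rightarrow> real) \<Rightarrow> real" where
  "gap \<Phi> = (\<integral>\<eta>. \<Phi> \<eta> \<partial>Q1) - (\<integral>\<eta>. \<Phi> \<eta> \<partial>Q2)"

text \<open>The squared norm of \<open>L^2\<close> for the sum of the two laws: approximation in it
  is approximation under both laws at once.\<close>

definition sqn :: "((real \<Rightarrow> real) \<Rightarrow> real) \<Rightarrow> real" where
  "sqn \<Phi> = (\<integral>\<eta>. (\<Phi> \<eta>)\<^sup>2 \<partial>Q1) + (\<integral>\<eta>. (\<Phi> \<eta>)\<^sup>2 \<partial>Q2)"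

lemmas meas_Q [simp] = gauss_solutionD(5)[OF Q1] gauss_solutionD(5)[OF Q2]
lemmas space_Q [simp] = gauss_solutionD(3)[OF Q1] gauss_solutionD(3)[OF Q2]

lemma bdd_measE:
  assumes "bdd_meas \<Phi>"
  obtains K where "0 \<le> K" "\<And>\<eta>. \<eta> \<in> space (path_borel T) \<Longrightarrow> \<bar>\<Phi> \<eta>\<bar> \<le> K"
proof -
  obtain K where "\<And>\<eta>. \<eta> \<in> space (path_borel T) \<Longrightarrow> \<bar>\<Phi> \<eta>\<bar> \<le> K" using assms unfolding bdd_meas_def by blast
  then have "\<And>\<eta>. \<eta> \<in> space (path_borel T) \<Longrightarrow> \<bar>\<Phi> \<eta>\<bar> \<le> max 0 K" by fastforce
  then show thesis using that[of "max 0 K"] by simp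
qed

lemma bdd_meas_integrable:
  assumes "bdd_meas \<Phi>"
  shows "integrable Q1 \<Phi>" "integrable Q2 \<Phi>"
proof -
  obtain K where K: "\<And>\<eta>. \<eta> \<in> space (path_borel T) \<Longrightarrow> \<bar>\<Phi> \<eta>\<bar> \<le> K" using bdd_measE[OF assms] by blast
  show "integrable Q1 \<Phi>"
    using assms K by (intro Q1.integrable_const_bound[of _ K]) (auto simp: bdd_meas_def intro!: AE_I2)
  show "integrable Q2 \<Phi>"
    using assms K by (intro Q2.integrable_const_bound[of _ K]) (auto simp: bdd_meas_def intro!: AE_I2)
qed

lemma bdd_meas_const: "bdd_meas (\<lambda>_. c)"
  by (auto simp: bdd_meas_def)

lemma bdd_meas_add: assumes "bdd_meas \<Phi>" "bdd_meas \<Psi>" shows "bdd_meas (\<lambda>\<eta>. \<Phi> \<eta> + \<Psi> \<eta>)"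
proof -
  obtain K L where "\<And>\<eta>. \<eta> \<in> space (path_borel T) \<Longrightarrow> \<bar>\<Phi> \<eta>\<bar> \<le> K" "\<And>\<eta>. \<eta> \<in> space (path_borel T) \<Longrightarrow> \<bar>\<Psi> \<eta>\<bar> \<le> L"
    using bdd_measE[OF assms(1)] bdd_measE[OF assms(2)] by metis
  then have "\<bar>\<Phi> \<eta> + \<Psi> \<eta>\<bar> \<le> K + L" if "\<eta> \<in> space (path_borel T)" for \<eta>
    using that by (intro order_trans[OF abs_triangle_ineq add_mono]) auto
  then show ?thesis using assms by (auto simp: bdd_meas_def)
qed

lemma bdd_meas_mult: assumes "bdd_meas \<Phi>" "bdd_meas \<Psi>" shows "bdd_meas (\<lambda>\<eta>. \<Phi> \<eta> * \<Psi> \<eta>)"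
proof -
  obtain K L where "\<And>\<eta>. \<eta> \<in> space (path_borel T) \<Longrightarrow> \<bar>\<Phi> \<eta>\<bar> \<le> K" "\<And>\<eta>. \<eta> \<in> space (path_borel T) \<Longrightarrow> \<bar>\<Psi> \<eta>\<bar> \<le> L"
    using bdd_measE[OF assms(1)] bdd_measE[OF assms(2)] by metis
  then have "\<bar>\<Phi> \<eta> * \<Psi> \<eta>\<bar> \<le> K * L" if "\<eta> \<in> space (path_borel T)" for \<eta>
    using that by (intro abs_mult_le) auto
  then show ?thesis using assms by (auto simp: bdd_meas_def)
qed

lemma bdd_meas_diff: "bdd_meas \<Phi> \<Longrightarrow> bdd_meas \<Psi> \<Longrightarrow> bdd_meas (\<lambda>\<eta>. \<Phi> \<eta> - \<Psi> \<eta>)"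
  using bdd_meas_add[OF _ bdd_meas_mult[OF bdd_meas_const[of "-1"]]] by simp

lemma bdd_meas_power2: "bdd_meas \<Phi> \<Longrightarrow> bdd_meas (\<lambda>\<eta>. (\<Phi> \<eta>)\<^sup>2)"
  unfolding power2_eq_square by (rule bdd_meas_mult)

lemma bdd_meas_cyl:
  assumes "\<Phi> \<in> cyl q" "q \<le> T"
  shows "bdd_meas \<Phi>"
  using cyl_bounded[OF assms(1)] measurable_path_filtration_path_borel[OF _ cyl_measurable[OF assms]] T
  by (auto simp: bdd_meas_def)

lemma sqn_nonneg: "0 \<le> sqn \<Phi>"
  by (simp add: sqn_def)

lemma sqn_add:
  assumes "bdd_meas \<Phi>" "bdd_meas \<Psi>"
  shows "sqn (\<lambda>\<eta>. \<Phi> \<eta> + \<Psi> \<eta>) \<le> 2 * sqn \<Phi> + 2 * sqn \<Psi>"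
proof -
  note i = bdd_meas_integrable[OF bdd_meas_power2[OF assms(1)]] bdd_meas_integrable[OF bdd_meas_power2[OF assms(2)]]
    bdd_meas_integrable[OF bdd_meas_power2[OF bdd_meas_add[OF assms]]]
  have le: "(x + y)\<^sup>2 \<le> 2 * x\<^sup>2 + 2 * y\<^sup>2" for x y :: real
    using zero_le_power2[of "x - y"] by (simp add: power2_eq_square algebra_simps)
  have "(\<integral>\<eta>. (\<Phi> \<eta> + \<Psi> \<eta>)\<^sup>2 \<partial>Q1) \<le> (\<integral>\<eta>. 2 * (\<Phi> \<eta>)\<^sup>2 + 2 * (\<Psi> \<eta>)\<^sup>2 \<partial>Q1)"
    "(\<integral>\<eta>. (\<Phi> \<eta> + \<Psi> \<eta>)\<^sup>2 \<partial>Q2) \<le> (\<integral>\<eta>. 2 * (\<Phi> \<eta>)\<^sup>2 + 2 * (\<Psi> \<eta>)\<^sup>2 \<partial>Q2)"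
    using i le by (intro integral_mono; simp)+
  then show ?thesis using i by (simp add: sqn_def)
qed

lemma sqn_times:
  assumes "bdd_meas \<Phi>" "bdd_meas \<Psi>" "\<And>\<eta>. \<eta> \<in> space (path_borel T) \<Longrightarrow> \<bar>\<Psi> \<eta>\<bar> \<le> K"
  shows "sqn (\<lambda>\<eta>. \<Phi> \<eta> * \<Psi> \<eta>) \<le> K\<^sup>2 * sqn \<Phi>"
proof -
  note i = bdd_meas_integrable[OF bdd_meas_power2[OF assms(1)]] bdd_meas_integrable[OF bdd_meas_power2[OF bdd_meas_mult[OF assms(1,2)]]]
  have le: "(\<Phi> \<eta> * \<Psi> \<eta>)\<^sup>2 \<le> K\<^sup>2 * (\<Phi> \<eta>)\<^sup>2" if "\<eta> \<in> space (path_borel T)" for \<eta>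
  proof -
    have "(\<Psi> \<eta>)\<^sup>2 \<le> K\<^sup>2" using assms(3)[OF that] by (metis abs_ge_zero power2_abs power_mono)
    then show ?thesis unfolding power_mult_distrib by (subst mult.commute) (intro mult_right_mono, auto)
  qed
  have "(\<integral>\<eta>. (\<Phi> \<eta> * \<Psi> \<eta>)\<^sup>2 \<partial>Q1) \<le> (\<integral>\<eta>. K\<^sup>2 * (\<Phi> \<eta>)\<^sup>2 \<partial>Q1)"
    "(\<integral>\<eta>. (\<Phi> \<eta> * \<Psi> \<eta>)\<^sup>2 \<partial>Q2) \<le> (\<integral>\<eta>. K\<^sup>2 * (\<Phi> \<eta>)\<^sup>2 \<partial>Q2)"
    using i le by (intro integral_mono; simp)+
  then show ?thesis by (simp add: sqn_def algebra_simps)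
qed

text \<open>Nonnegativity of the variances. This is the starting bound that the iteration
  improves.\<close>

lemma gap_square_le:
  assumes "bdd_meas \<Phi>"
  shows "(gap \<Phi>)\<^sup>2 \<le> 2 * sqn \<Phi>"
proof -
  note i = bdd_meas_integrable[OF bdd_meas_power2[OF assms]] bdd_meas_integrable[OF assms]
  have "0 \<le> Q1.variance \<Phi>" "0 \<le> Q2.variance \<Phi>" by simp_all
  then have "(\<integral>\<eta>. \<Phi> \<eta> \<partial>Q1)\<^sup>2 \<le> (\<integral>\<eta>. (\<Phi> \<eta>)\<^sup>2 \<partial>Q1)" "(\<integral>\<eta>. \<Phi> \<eta> \<partial>Q2)\<^sup>2 \<le> (\<integral>\<eta>. (\<Phi> \<eta>)\<^sup>2 \<partial>Q2)"
    using Q1.variance_eq[OF i(3,1)] Q2.variance_eq[OF i(4,2)] by simp_all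
  moreover have "(x - y)\<^sup>2 \<le> 2 * x\<^sup>2 + 2 * y\<^sup>2" for x y :: real
    using zero_le_power2[of "x + y"] by (simp add: power2_eq_square algebra_simps)
  then have "(gap \<Phi>)\<^sup>2 \<le> 2 * (\<integral>\<eta>. \<Phi> \<eta> \<partial>Q1)\<^sup>2 + 2 * (\<integral>\<eta>. \<Phi> \<eta> \<partial>Q2)\<^sup>2" unfolding gap_def .
  ultimately show ?thesis unfolding sqn_def distrib_left
    by (elim order_trans) (intro add_mono mult_left_mono; simp)
qed

lemma gap_diff: "bdd_meas \<Phi> \<Longrightarrow> bdd_meas \<Psi> \<Longrightarrow> gap (\<lambda>\<eta>. \<Phi> \<eta> - \<Psi> \<eta>) = gap \<Phi> - gap \<Psi>"
  using bdd_meas_integrable by (simp add: gap_def)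

section \<open>Density of cylinder functionals\<close>

text \<open>The \<open>L^2\<close> closure of the cylinder functionals within the bounded
  functionals. Members are measurable in the whole path only, since the class is meant to be stable
  under modification on null sets.\<close>

definition cyl_closure :: "real \<Rightarrow> ((real \<Rightarrow> real) \<Rightarrow> real) set" where
  "cyl_closure q = {\<Phi>. bdd_meas \<Phi> \<and> (\<forall>e>0. \<exists>\<Psi>\<in>cyl q. sqn (\<lambda>\<eta>. \<Phi> \<eta> - \<Psi> \<eta>) < e)}"

lemma cyl_closure_bm: "\<Phi> \<in> cyl_closure q \<Longrightarrow> bdd_meas \<Phi>" by (simp add: cyl_closure_def)

lemma cyl_closureD: "\<Phi> \<in> cyl_closure q \<Longrightarrow> 0 < e \<Longrightarrow> \<exists>\<Psi>\<in>cyl q. sqn (\<lambda>\<eta>. \<Phi> \<eta> - \<Psi> \<eta>) < e"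
  by (simp add: cyl_closure_def)

lemma cyl_subset_closure: "\<Phi> \<in> cyl q \<Longrightarrow> q \<le> T \<Longrightarrow> \<Phi> \<in> cyl_closure q"
  unfolding cyl_closure_def using bdd_meas_cyl by (auto intro!: bexI[of _ \<Phi>] simp: sqn_def)

lemma cyl_closure_closed:
  assumes "bdd_meas \<Phi>" "q \<le> T" "\<And>e. 0 < e \<Longrightarrow> \<exists>\<Psi>\<in>cyl_closure q. sqn (\<lambda>\<eta>. \<Phi> \<eta> - \<Psi> \<eta>) < e"
  shows "\<Phi> \<in> cyl_closure q"
  unfolding cyl_closure_def
proof (intro CollectI conjI allI impI)
  fix e :: real assume e: "0 < e"
  obtain \<Psi> where 1: "\<Psi> \<in> cyl_closure q" "sqn (\<lambda>\<eta>. \<Phi> \<eta> - \<Psi> \<eta>) < e / 4" using assms(3)[of "e / 4"] e by auto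
  then obtain \<Theta> where 2: "\<Theta> \<in> cyl q" "sqn (\<lambda>\<eta>. \<Psi> \<eta> - \<Theta> \<eta>) < e / 4"
    using cyl_closureD[of \<Psi> q "e / 4"] e by auto
  have "sqn (\<lambda>\<eta>. (\<Phi> \<eta> - \<Psi> \<eta>) + (\<Psi> \<eta> - \<Theta> \<eta>)) \<le> 2 * sqn (\<lambda>\<eta>. \<Phi> \<eta> - \<Psi> \<eta>) + 2 * sqn (\<lambda>\<eta>. \<Psi> \<eta> - \<Theta> \<eta>)"
    using assms(1,2) 1 2 bdd_meas_cyl cyl_closure_bm by (intro sqn_add bdd_meas_diff) auto
  then have "sqn (\<lambda>\<eta>. \<Phi> \<eta> - \<Theta> \<eta>) < e" using 1 2 by simp
  then show "\<exists>\<Psi>\<in>cyl q. sqn (\<lambda>\<eta>. \<Phi> \<eta> - \<Psi> \<eta>) < e" using 2 by blast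
qed fact

text \<open>Used where nonnegativity holds only almost surely, and to ignore arguments outside the
  space of paths.\<close>

lemma cyl_closure_AE:
  assumes "\<Phi> \<in> cyl_closure q" "bdd_meas \<Psi>" "q \<le> T" "AE \<eta> in Q1. \<Phi> \<eta> = \<Psi> \<eta>" "AE \<eta> in Q2. \<Phi> \<eta> = \<Psi> \<eta>"
  shows "\<Psi> \<in> cyl_closure q"
proof (rule cyl_closure_closed[OF assms(2,3)])
  fix e :: real assume "0 < e"
  have "(\<integral>\<eta>. (\<Psi> \<eta> - \<Phi> \<eta>)\<^sup>2 \<partial>Q1) = 0" "(\<integral>\<eta>. (\<Psi> \<eta> - \<Phi> \<eta>)\<^sup>2 \<partial>Q2) = 0"
    using assms(4,5) by (auto intro!: integral_eq_zero_AE)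
  then show "\<exists>\<Theta>\<in>cyl_closure q. sqn (\<lambda>\<eta>. \<Psi> \<eta> - \<Theta> \<eta>) < e"
    using assms(1) \<open>0 < e\<close> by (intro bexI[of _ \<Phi>]) (auto simp: sqn_def)
qed

lemma cyl_closure_limit:
  assumes "\<And>n. \<Phi>n n \<in> cyl_closure q" "q \<le> T"
    and K: "\<And>n \<eta>. \<eta> \<in> space (path_borel T) \<Longrightarrow> \<bar>\<Phi>n n \<eta>\<bar> \<le> K"
    and lim: "\<And>\<eta>. \<eta> \<in> space (path_borel T) \<Longrightarrow> (\<lambda>n. \<Phi>n n \<eta>) \<longlonglongrightarrow> \<Phi> \<eta>"
  shows "\<Phi> \<in> cyl_closure q"
proof (rule cyl_closure_closed)
  have m: "\<Phi>n n \<in> borel_measurable (path_borel T)" for n using cyl_closure_bm[OF assms(1)] by (auto simp: bdd_meas_def)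
  have m': "\<Phi> \<in> borel_measurable (path_borel T)"
    by (rule borel_measurable_LIMSEQ_real[OF lim m])
  have K': "\<bar>\<Phi> \<eta>\<bar> \<le> K" if "\<eta> \<in> space (path_borel T)" for \<eta>
    by (rule LIMSEQ_le_const2[OF tendsto_rabs[OF lim[OF that]]]) (use K[OF that] in blast)
  show "bdd_meas \<Phi>" using m' K' by (auto simp: bdd_meas_def)
  have 0: "(\<lambda>n. (\<Phi> \<eta> - \<Phi>n n \<eta>)\<^sup>2) \<longlonglongrightarrow> 0" if "\<eta> \<in> space (path_borel T)" for \<eta>
    using tendsto_power[OF tendsto_diff[OF tendsto_const[of "\<Phi> \<eta>"] lim[OF that]], of 2] by simp
  have bd: "(\<Phi> \<eta> - \<Phi>n n \<eta>)\<^sup>2 \<le> (2 * K) * (2 * K)" if "\<eta> \<in> space (path_borel T)" for n \<eta>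
  proof -
    have "\<bar>\<Phi> \<eta> - \<Phi>n n \<eta>\<bar> \<le> 2 * K" using K[OF that, of n] K'[OF that] by linarith
    from abs_mult_le[OF this this] show ?thesis by (simp add: power2_eq_square)
  qed
  have l1: "(\<lambda>n. \<integral>\<eta>. (\<Phi> \<eta> - \<Phi>n n \<eta>)\<^sup>2 \<partial>Q1) \<longlonglongrightarrow> (\<integral>\<eta>. 0 \<partial>Q1)"
    using m m' 0 bd by (intro integral_dominated_convergence[where w="\<lambda>_. (2 * K) * (2 * K)"]) (auto intro!: AE_I2)
  have l2: "(\<lambda>n. \<integral>\<eta>. (\<Phi> \<eta> - \<Phi>n n \<eta>)\<^sup>2 \<partial>Q2) \<longlonglongrightarrow> (\<integral>\<eta>. 0 \<partial>Q2)"
    using m m' 0 bd by (intro integral_dominated_convergence[where w="\<lambda>_. (2 * K) * (2 * K)"]) (auto intro!: AE_I2)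
  have "(\<lambda>n. sqn (\<lambda>\<eta>. \<Phi> \<eta> - \<Phi>n n \<eta>)) \<longlonglongrightarrow> 0"
    using tendsto_add[OF l1 l2] by (simp add: sqn_def)
  then have "eventually (\<lambda>n. sqn (\<lambda>\<eta>. \<Phi> \<eta> - \<Phi>n n \<eta>) < e) sequentially" if "0 < e" for e
    using that by (rule order_tendstoD(2))
  then show "\<exists>\<Psi>\<in>cyl_closure q. sqn (\<lambda>\<eta>. \<Phi> \<eta> - \<Psi> \<eta>) < e" if "0 < e" for e
    using that assms(1) by (fastforce simp: eventually_sequentially)
qed fact

lemma cyl_closure_add:
  assumes "\<Phi> \<in> cyl_closure q" "\<Psi> \<in> cyl_closure q" "q \<le> T"
  shows "(\<lambda>\<eta>. \<Phi> \<eta> + \<Psi> \<eta>) \<in> cyl_closure q"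
  unfolding cyl_closure_def
proof (intro CollectI conjI allI impI)
  show "bdd_meas (\<lambda>\<eta>. \<Phi> \<eta> + \<Psi> \<eta>)" using assms cyl_closure_bm bdd_meas_add by blast
  fix e :: real assume e: "0 < e"
  obtain \<Phi>' where 1: "\<Phi>' \<in> cyl q" "sqn (\<lambda>\<eta>. \<Phi> \<eta> - \<Phi>' \<eta>) < e / 4"
    using cyl_closureD[OF assms(1), of "e / 4"] e by auto
  obtain \<Psi>' where 2: "\<Psi>' \<in> cyl q" "sqn (\<lambda>\<eta>. \<Psi> \<eta> - \<Psi>' \<eta>) < e / 4"
    using cyl_closureD[OF assms(2), of "e / 4"] e by auto
  have "sqn (\<lambda>\<eta>. (\<Phi> \<eta> - \<Phi>' \<eta>) + (\<Psi> \<eta> - \<Psi>' \<eta>)) \<le> 2 * sqn (\<lambda>\<eta>. \<Phi> \<eta> - \<Phi>' \<eta>) + 2 * sqn (\<lambda>\<eta>. \<Psi> \<eta> - \<Psi>' \<eta>)"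
    using assms 1 2 bdd_meas_cyl cyl_closure_bm by (intro sqn_add bdd_meas_diff) auto
  then have "sqn (\<lambda>\<eta>. (\<Phi> \<eta> + \<Psi> \<eta>) - (\<Phi>' \<eta> + \<Psi>' \<eta>)) < e" using 1 2 by (simp add: algebra_simps)
  then show "\<exists>\<Theta>\<in>cyl q. sqn (\<lambda>\<eta>. \<Phi> \<eta> + \<Psi> \<eta> - \<Theta> \<eta>) < e"
    using cyl_plus[OF 1(1) 2(1)] by (intro bexI[of _ "\<lambda>\<eta>. \<Phi>' \<eta> + \<Psi>' \<eta>"])
qed

lemma cyl_closure_mult:
  assumes "\<Phi> \<in> cyl_closure q" "\<Psi> \<in> cyl_closure q" "q \<le> T"
  shows "(\<lambda>\<eta>. \<Phi> \<eta> * \<Psi> \<eta>) \<in> cyl_closure q"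
  unfolding cyl_closure_def
proof (intro CollectI conjI allI impI)
  show "bdd_meas (\<lambda>\<eta>. \<Phi> \<eta> * \<Psi> \<eta>)" using assms cyl_closure_bm bdd_meas_mult by blast
  fix e :: real assume e: "0 < e"
  obtain K where K: "\<And>\<eta>. \<eta> \<in> space (path_borel T) \<Longrightarrow> \<bar>\<Psi> \<eta>\<bar> \<le> K" using bdd_measE[OF cyl_closure_bm[OF assms(2)]] by blast
  \<comment> \<open>The first approximant is chosen with the tolerance for the bound of \<Psi>, the
    second with the tolerance for the bound of that approximant. The summand 1 avoids a division by
    0.\<close>
  define d where "d = (\<lambda>K. e / (4 * (K\<^sup>2 + 1)))"
  have d: "0 < d K" "K\<^sup>2 * d K \<le> e / 4" for K
  proof -
    have p: "0 < K\<^sup>2 + 1" by (simp add: add_nonneg_pos)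
    then show "0 < d K" using e by (simp add: d_def)
    show "K\<^sup>2 * d K \<le> e / 4" using p e by (simp add: d_def field_simps)
  qed
  obtain \<Phi>' where 1: "\<Phi>' \<in> cyl q" "sqn (\<lambda>\<eta>. \<Phi> \<eta> - \<Phi>' \<eta>) < d K"
    using assms(1) d(1) by (auto simp: cyl_closure_def)
  obtain L where L: "\<And>\<eta>. \<bar>\<Phi>' \<eta>\<bar> \<le> L" using cyl_bounded[OF 1(1)] by blast
  obtain \<Psi>' where 2: "\<Psi>' \<in> cyl q" "sqn (\<lambda>\<eta>. \<Psi> \<eta> - \<Psi>' \<eta>) < d L"
    using assms(2) d(1) by (auto simp: cyl_closure_def)
  note bms = cyl_closure_bm[OF assms(1)] cyl_closure_bm[OF assms(2)] bdd_meas_cyl[OF 1(1) assms(3)] bdd_meas_cyl[OF 2(1) assms(3)]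
  have "sqn (\<lambda>\<eta>. (\<Phi> \<eta> - \<Phi>' \<eta>) * \<Psi> \<eta>) \<le> K\<^sup>2 * sqn (\<lambda>\<eta>. \<Phi> \<eta> - \<Phi>' \<eta>)"
    using bms K by (intro sqn_times bdd_meas_diff) auto
  also have "\<dots> \<le> K\<^sup>2 * d K" using 1 by (intro mult_left_mono) auto
  finally have a1: "sqn (\<lambda>\<eta>. (\<Phi> \<eta> - \<Phi>' \<eta>) * \<Psi> \<eta>) \<le> e / 4" using d(2)[of K] by linarith
  have a2: "sqn (\<lambda>\<eta>. (\<Psi> \<eta> - \<Psi>' \<eta>) * \<Phi>' \<eta>) < e / 4"
  proof (cases "L = 0")
    case True
    then have "\<Phi>' \<eta> = 0" for \<eta> using L[of \<eta>] by simp
    then show ?thesis using e by (simp add: sqn_def)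
  next
    case False
    have "sqn (\<lambda>\<eta>. (\<Psi> \<eta> - \<Psi>' \<eta>) * \<Phi>' \<eta>) \<le> L\<^sup>2 * sqn (\<lambda>\<eta>. \<Psi> \<eta> - \<Psi>' \<eta>)"
      using bms L by (intro sqn_times bdd_meas_diff) auto
    also have "\<dots> < L\<^sup>2 * d L" using 2 False by (intro mult_strict_left_mono) auto
    finally show ?thesis using d(2)[of L] by linarith
  qed
  have "sqn (\<lambda>\<eta>. (\<Phi> \<eta> - \<Phi>' \<eta>) * \<Psi> \<eta> + (\<Psi> \<eta> - \<Psi>' \<eta>) * \<Phi>' \<eta>) \<le>
     2 * sqn (\<lambda>\<eta>. (\<Phi> \<eta> - \<Phi>' \<eta>) * \<Psi> \<eta>) + 2 * sqn (\<lambda>\<eta>. (\<Psi> \<eta> - \<Psi>' \<eta>) * \<Phi>' \<eta>)"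
    using bms by (intro sqn_add bdd_meas_mult bdd_meas_diff) auto
  then have "sqn (\<lambda>\<eta>. (\<Phi> \<eta> - \<Phi>' \<eta>) * \<Psi> \<eta> + (\<Psi> \<eta> - \<Psi>' \<eta>) * \<Phi>' \<eta>) < e" using a1 a2 by linarith
  then have "sqn (\<lambda>\<eta>. \<Phi> \<eta> * \<Psi> \<eta> - \<Phi>' \<eta> * \<Psi>' \<eta>) < e" by (simp add: algebra_simps)
  then show "\<exists>\<Theta>\<in>cyl q. sqn (\<lambda>\<eta>. \<Phi> \<eta> * \<Psi> \<eta> - \<Theta> \<eta>) < e"
    using cyl_mult[OF 1(1) 2(1)] by (intro bexI[of _ "\<lambda>\<eta>. \<Phi>' \<eta> * \<Psi>' \<eta>"])
qed

lemma cyl_closure_const: "0 \<le> q \<Longrightarrow> q \<le> T \<Longrightarrow> (\<lambda>_. a) \<in> cyl_closure q"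
  using cyl_subset_closure[OF cyl_scaled_cexp[of "{}" q "\<lambda>_. 0" a]] by (simp add: cexp_def)

lemma cyl_closure_scale: "0 \<le> q \<Longrightarrow> q \<le> T \<Longrightarrow> \<Phi> \<in> cyl_closure q \<Longrightarrow> (\<lambda>\<eta>. a * \<Phi> \<eta>) \<in> cyl_closure q"
  using cyl_closure_mult[OF cyl_closure_const] by blast

lemma cyl_closure_diff: "0 \<le> q \<Longrightarrow> q \<le> T \<Longrightarrow> \<Phi> \<in> cyl_closure q \<Longrightarrow> \<Psi> \<in> cyl_closure q \<Longrightarrow> (\<lambda>\<eta>. \<Phi> \<eta> - \<Psi> \<eta>) \<in> cyl_closure q"
  using cyl_closure_add[OF _ cyl_closure_scale[where a="-1"]] by simp

lemma cyl_closure_sum: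
  assumes "0 \<le> q" "q \<le> T" "finite I" "\<And>i. i \<in> I \<Longrightarrow> \<Phi> i \<in> cyl_closure q"
  shows "(\<lambda>\<eta>. \<Sum>i\<in>I. \<Phi> i \<eta>) \<in> cyl_closure q"
  using assms(3,4) by (induction rule: finite_induct) (auto intro: cyl_closure_const cyl_closure_add assms)

lemma cyl_closure_power: "0 \<le> q \<Longrightarrow> q \<le> T \<Longrightarrow> \<Phi> \<in> cyl_closure q \<Longrightarrow> (\<lambda>\<eta>. \<Phi> \<eta> ^ n) \<in> cyl_closure q"
  by (induction n) (auto intro: cyl_closure_const cyl_closure_mult)

text \<open>Polynomials of \<open>Z\<close> stay in the class because it is an algebra; Weierstrass
  approximation on the unit interval and bounded limits do the rest.\<close>

lemma cyl_closure_continuous: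
  assumes q: "0 \<le> q" "q \<le> T" and Z: "Z \<in> cyl_closure q" "\<And>\<eta>. \<eta> \<in> space (path_borel T) \<Longrightarrow> Z \<eta> \<in> {0..1}"
    and f: "continuous_on {0..1} f"
  shows "(\<lambda>\<eta>. f (Z \<eta>) :: real) \<in> cyl_closure q"
proof -
  have "\<exists>p. real_polynomial_function p \<and> (\<forall>x\<in>{0..1}. \<bar>f x - p x\<bar> < 1 / real (Suc n))" for n
    using Stone_Weierstrass_real_polynomial_function[of "{0..1}" f "1 / real (Suc n)"] f by (metis compact_Icc of_nat_0_less_iff zero_less_Suc zero_less_divide_1_iff)
  then obtain p where p: "\<And>n. real_polynomial_function (p n)"
    "\<And>n x. x \<in> {0..1} \<Longrightarrow> \<bar>f x - p n x\<bar> < 1 / real (Suc n)" by metis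
  have pd: "(\<lambda>\<eta>. p n (Z \<eta>)) \<in> cyl_closure q" for n
  proof -
    obtain a m where "p n = (\<lambda>x. \<Sum>i\<le>m. a i * x ^ i)"
      using p(1)[of n] real_polynomial_function_iff_sum by blast
    then show ?thesis using q Z by (auto intro!: cyl_closure_sum cyl_closure_scale cyl_closure_power)
  qed
  have "bounded (f ` {0..1})"
    using f by (intro compact_imp_bounded compact_continuous_image) auto
  then obtain K where "\<forall>y\<in>f ` {0..1}. norm y \<le> K" unfolding bounded_iff by blast
  then have K: "\<And>x. x \<in> {0..1} \<Longrightarrow> \<bar>f x\<bar> \<le> K" by auto
  show ?thesis
  proof (rule cyl_closure_limit[OF pd q(2)])
    fix n \<eta> assume \<eta>: "\<eta> \<in> space (path_borel T)"
    have "1 / real (Suc n) \<le> 1" by simp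
    then show "\<bar>p n (Z \<eta>)\<bar> \<le> K + 1" using p(2)[OF Z(2)[OF \<eta>], of n] K[OF Z(2)[OF \<eta>]] by linarith
  next
    fix \<eta> assume \<eta>: "\<eta> \<in> space (path_borel T)"
    have "(\<lambda>n. p n (Z \<eta>) - f (Z \<eta>)) \<longlonglongrightarrow> 0"
    proof (rule Lim_null_comparison)
      show "eventually (\<lambda>n. norm (p n (Z \<eta>) - f (Z \<eta>)) \<le> 1 / real (Suc n)) sequentially"
        using p(2)[OF Z(2)[OF \<eta>]] by (intro always_eventually allI) (simp add: abs_minus_commute less_imp_le)
      show "(\<lambda>n. 1 / real (Suc n)) \<longlonglongrightarrow> 0" by (rule LIMSEQ_Suc[OF lim_1_over_n])
    qed
    then show "(\<lambda>n. p n (Z \<eta>)) \<longlonglongrightarrow> f (Z \<eta>)" by (simp add: LIM_zero_iff)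
  qed
qed

lemma cyl_closure_indicator_greater:
  assumes q: "0 \<le> q" "q \<le> T" and Z: "Z \<in> cyl_closure q" "\<And>\<eta>. \<eta> \<in> space (path_borel T) \<Longrightarrow> Z \<eta> \<in> {0..1}"
  shows "(\<lambda>\<eta>. indicator {c<..} (Z \<eta>)) \<in> cyl_closure q"
proof (rule cyl_closure_limit[OF _ q(2)])
  show "(\<lambda>\<eta>. min 1 (real n * max 0 (Z \<eta> - c))) \<in> cyl_closure q" for n
    by (rule cyl_closure_continuous[OF q Z], assumption, intro continuous_intros)
  show "\<bar>min 1 (real n * max 0 (Z \<eta> - c))\<bar> \<le> 1" for n \<eta>
  proof -
    have "0 \<le> real n * max 0 (Z \<eta> - c)" by simp
    then show ?thesis by linarith
  qed
  fix \<eta>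
  show "(\<lambda>n. min 1 (real n * max 0 (Z \<eta> - c))) \<longlonglongrightarrow> indicator {c<..} (Z \<eta>)"
  proof (cases "c < Z \<eta>")
    case True
    then obtain N where N: "1 < real N * (Z \<eta> - c)" using reals_Archimedean3[of "Z \<eta> - c"] by auto
    have "min 1 (real n * max 0 (Z \<eta> - c)) = 1" if "N \<le> n" for n
    proof -
      have "real N * (Z \<eta> - c) \<le> real n * (Z \<eta> - c)" using that True by (intro mult_right_mono) auto
      then have "1 \<le> real n * (Z \<eta> - c)" using N by linarith
      then show ?thesis using True by simp
    qed
    then have "eventually (\<lambda>n. min 1 (real n * max 0 (Z \<eta> - c)) = 1) sequentially"
      unfolding eventually_sequentially by blast
    then show ?thesis using True by (simp add: tendsto_eventually)
  qed simp
qed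

text \<open>Cylinder functionals see only the square of \<open>\<eta> s\<close>. For
  \<open>c < 0\<close> the indicator is almost surely 1; for \<open>c \<ge> 0\<close> and
  nonnegative paths the event is a level set of the decreasing function
  \<open>exp (- (\<eta> s)^2)\<close>.\<close>

lemma cyl_closure_indicator_eval:
  assumes q: "q \<le> T" and s: "0 \<le> s" "s \<le> q"
  shows "(\<lambda>\<eta>. indicator {c<..} (\<eta> s)) \<in> cyl_closure q"
proof -
  have q0: "0 \<le> q" using s by simp
  have m: "(\<lambda>\<eta>. \<eta> s) \<in> borel_measurable (path_borel T)" using T s q by (intro measurable_path_eval) auto
  have bmi: "bdd_meas (\<lambda>\<eta>. indicator {c<..} (\<eta> s))"
    using m by (auto simp: bdd_meas_def indicator_def intro!: exI[of _ 1])
  note nn = nonneg(1)[of s] nonneg(2)[of s]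
  show ?thesis
  proof (cases "c < 0")
    case True
    show ?thesis
      by (rule cyl_closure_AE[OF cyl_closure_const[OF q0 q, of 1] bmi q])
        (use nn s q True in \<open>auto elim!: eventually_mono simp: indicator_def\<close>)
  next
    case False
    define Z where "Z = (\<lambda>\<eta> :: real \<Rightarrow> real. exp (- (\<eta> s)\<^sup>2))"
    have "(\<lambda>\<eta>. 1 * cexp {s} (\<lambda>_. 1) \<eta>) \<in> cyl q" using s by (intro cyl_scaled_cexp) auto
    then have "Z \<in> cyl q" by (simp add: Z_def cexp_def)
    then have Z: "(\<lambda>\<eta>. 1 - Z \<eta>) \<in> cyl_closure q" using cyl_subset_closure[OF _ q] by (intro cyl_closure_diff cyl_closure_const q q0)
    have eq: "exp (- c\<^sup>2) > Z \<eta> \<longleftrightarrow> c < \<eta> s" if "0 \<le> \<eta> s" for \<eta>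
      using False that power_mono_iff[of "\<eta> s" c 2] by (auto simp: Z_def not_le[symmetric])
    \<comment> \<open>Passing to \<open>1 - Z\<close> turns the sublevel set into a strict
      superlevel set, the form whose indicator is known to be in the class.\<close>
    have "(\<lambda>\<eta>. indicator {1 - exp (- c\<^sup>2)<..} (1 - Z \<eta>)) \<in> cyl_closure q"
      by (rule cyl_closure_indicator_greater[OF q0 q Z]) (simp add: Z_def)
    then show ?thesis
      by (rule cyl_closure_AE[OF _ bmi q]) (use nn s q eq in \<open>auto elim!: eventually_mono simp: indicator_def\<close>)
  qed
qed

text \<open>As the class is an algebra closed under bounded limits, the sets with indicator in it
  form a sigma-algebra, and this contains the generators \<open>c < \<eta> s\<close>.\<close>

lemma cyl_closure_indicator:
  assumes q: "0 \<le> q" "q \<le> T" and A: "A \<in> sets (path_filtration T q)"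
  shows "indicator A \<in> cyl_closure q"
proof -
  let ?\<Omega> = "space (path_borel T)"
  define D where "D = {A \<in> sets (path_borel T). (indicator A :: _ \<Rightarrow> real) \<in> cyl_closure q}"
  have Un: "A \<union> B \<in> D" if "A \<in> D" "B \<in> D" for A B
  proof -
    have "(\<lambda>\<eta>. (indicator A \<eta> + indicator B \<eta>) - indicator A \<eta> * indicator B \<eta> :: real) \<in> cyl_closure q"
      using that q by (intro cyl_closure_diff cyl_closure_add cyl_closure_mult) (auto simp: D_def)
    also have "(\<lambda>\<eta>. (indicator A \<eta> + indicator B \<eta>) - indicator A \<eta> * indicator B \<eta> :: real) = indicator (A \<union> B)"
      by (auto simp: fun_eq_iff indicator_def)
    finally show ?thesis using that by (auto simp: D_def)
  qed
  have empty: "{} \<in> D"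
  proof -
    have "indicator {} = (\<lambda>_ :: real \<Rightarrow> real. 0 :: real)" by auto
    then show ?thesis using cyl_closure_const[OF q, of 0] by (simp add: D_def)
  qed
  have sa: "sigma_algebra ?\<Omega> D"
    unfolding sigma_algebra_iff2
  proof (intro conjI ballI allI impI)
    show "D \<subseteq> Pow ?\<Omega>" using sets.sets_into_space by (auto simp: D_def)
    show "{} \<in> D" by (rule empty)
  next
    fix A assume A: "A \<in> D"
    have d: "(\<lambda>\<eta>. 1 - indicator A \<eta> :: real) \<in> cyl_closure q"
      using A q by (intro cyl_closure_diff cyl_closure_const) (auto simp: D_def)
    have "indicator (?\<Omega> - A) \<in> cyl_closure q"
    proof (rule cyl_closure_AE[OF d _ q(2)])
      have "?\<Omega> - A \<in> sets (path_borel T)" using A by (auto simp: D_def)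
      then show "bdd_meas (indicator (?\<Omega> - A))" by (auto simp: bdd_meas_def indicator_def intro!: exI[of _ 1])
    qed (auto intro!: AE_I2 simp: indicator_def)
    then show "?\<Omega> - A \<in> D" using A by (auto simp: D_def)
  next
    fix A :: "nat \<Rightarrow> _" assume A: "range A \<subseteq> D"
    have fin: "(\<Union>i<n. A i) \<in> D" for n
    proof (induction n)
      case (Suc n)
      have "(\<Union>i<Suc n. A i) = (\<Union>i<n. A i) \<union> A n" by (auto simp: less_Suc_eq)
      moreover have "A n \<in> D" using A by auto
      ultimately show ?case using Un[OF Suc] by simp
    qed (simp add: empty)
    have "indicator (\<Union>i. A i) \<in> cyl_closure q"
    proof (rule cyl_closure_limit[OF _ q(2)])
      show "indicator (\<Union>i<n. A i) \<in> cyl_closure q" for n using fin by (simp add: D_def)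
      show "\<bar>indicator (\<Union>i<n. A i) \<eta> :: real\<bar> \<le> 1" for n \<eta> by (simp add: indicator_def)
      show "(\<lambda>n. indicator (\<Union>i<n. A i) \<eta> :: real) \<longlonglongrightarrow> indicator (\<Union>i. A i) \<eta>" for \<eta>
        by (rule LIMSEQ_indicator_UN)
    qed
    moreover have "(\<Union>i. A i) \<in> sets (path_borel T)" using A by (auto simp: D_def)
    ultimately show "(\<Union>i. A i) \<in> D" by (simp add: D_def)
  qed
  let ?M = "sigma ?\<Omega> D"
  have M: "space ?M = ?\<Omega>" "sets ?M = D"
    using sigma_algebra.sets_measure_of_eq[OF sa] sigma_algebra.space_measure_of_eq[OF sa] by auto
  have "(\<lambda>\<eta>. \<eta>) \<in> measurable ?M (path_filtration T q)"
  proof (rule measurable_canonical_filtration)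
    fix s assume s: "0 \<le> s" "s \<le> q" "s \<le> T"
    show "(\<lambda>\<eta>. \<eta> s) \<in> borel_measurable ?M"
      unfolding borel_measurable_iff_greater M
    proof
      fix c
      have e: "{\<eta> \<in> ?\<Omega>. c < \<eta> s} = (\<lambda>\<eta>. \<eta> s) -` {c<..} \<inter> ?\<Omega>" by auto
      have set: "{\<eta> \<in> ?\<Omega>. c < \<eta> s} \<in> sets (path_borel T)"
        unfolding e using T s by (intro measurable_sets[OF measurable_path_eval]) auto
      have "indicator {\<eta> \<in> ?\<Omega>. c < \<eta> s} \<in> cyl_closure q"
      proof (rule cyl_closure_AE[OF cyl_closure_indicator_eval[OF q(2) s(1,2), of c] _ q(2)])
        show "bdd_meas (indicator {\<eta> \<in> ?\<Omega>. c < \<eta> s})" using set by (auto simp: bdd_meas_def indicator_def intro!: exI[of _ 1])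
      qed (auto intro!: AE_I2 simp: indicator_def)
      then show "{\<eta> \<in> ?\<Omega>. c < \<eta> s} \<in> D" using set by (simp add: D_def)
    qed
  qed (simp add: M)
  from measurable_ident_subalgebra[OF this] A have "A \<in> D" by (auto simp: subalgebra_def M)
  then show ?thesis by (simp add: D_def)
qed

text \<open>Rounding the values down to multiples of \<open>1 / (n + 1)\<close> gives uniform
  approximation by finite combinations of indicators.\<close>

lemma cyl_closure_measurable:
  assumes q: "0 \<le> q" "q \<le> T" and \<Phi>: "\<Phi> \<in> borel_measurable (path_filtration T q)"
    and K: "\<And>\<eta>. \<eta> \<in> space (path_borel T) \<Longrightarrow> \<bar>\<Phi> \<eta>\<bar> \<le> K"
  shows "\<Phi> \<in> cyl_closure q"
proof -
  let ?\<Omega> = "space (path_borel T)"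
  define I where "I = (\<lambda>n. {- \<lceil>(real n + 1) * K\<rceil> - 1..\<lceil>(real n + 1) * K\<rceil> + 1})"
  define A where "A = (\<lambda>n k. {\<eta> \<in> ?\<Omega>. \<lfloor>(real n + 1) * \<Phi> \<eta>\<rfloor> = k})"
  define \<Psi> where "\<Psi> = (\<lambda>n \<eta>. \<Sum>k\<in>I n. (of_int k / (real n + 1)) * indicator (A n k) \<eta>)"
  have "A n k \<in> sets (path_filtration T q)" for n k
  proof -
    have "{\<eta> \<in> space (path_filtration T q). \<lfloor>(real n + 1) * \<Phi> \<eta>\<rfloor> = k} \<in> sets (path_filtration T q)"
      using \<Phi> by measurable
    then show ?thesis by (simp add: A_def)
  qed
  then have d: "\<Psi> n \<in> cyl_closure q" for n
    unfolding \<Psi>_def using q by (intro cyl_closure_sum cyl_closure_scale cyl_closure_indicator) (auto simp: I_def)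
  have \<Psi>: "\<Psi> n \<eta> = of_int \<lfloor>(real n + 1) * \<Phi> \<eta>\<rfloor> / (real n + 1)" if \<eta>: "\<eta> \<in> ?\<Omega>" for n \<eta>
  proof -
    have "\<bar>(real n + 1) * \<Phi> \<eta>\<bar> \<le> (real n + 1) * K" using K[OF \<eta>] by (simp add: abs_mult mult_left_mono)
    then have "\<lfloor>(real n + 1) * \<Phi> \<eta>\<rfloor> \<in> I n" unfolding I_def by simp linarith
    then show ?thesis
      unfolding \<Psi>_def using \<eta>
      by (subst sum.remove[of _ "\<lfloor>(real n + 1) * \<Phi> \<eta>\<rfloor>"]) (auto simp: A_def I_def indicator_def intro!: sum.neutral)
  qed
  have err: "\<bar>\<Psi> n \<eta> - \<Phi> \<eta>\<bar> \<le> 1 / (real n + 1)" if \<eta>: "\<eta> \<in> ?\<Omega>" for n \<eta>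
  proof -
    have "\<Psi> n \<eta> - \<Phi> \<eta> = (of_int \<lfloor>(real n + 1) * \<Phi> \<eta>\<rfloor> - (real n + 1) * \<Phi> \<eta>) / (real n + 1)"
      unfolding \<Psi>[OF \<eta>] by (simp add: field_simps)
    moreover have "\<bar>of_int \<lfloor>(real n + 1) * \<Phi> \<eta>\<rfloor> - (real n + 1) * \<Phi> \<eta>\<bar> \<le> 1" by linarith
    ultimately show ?thesis by (simp add: abs_divide divide_right_mono)
  qed
  show ?thesis
  proof (rule cyl_closure_limit[OF d q(2)])
    fix n \<eta> assume \<eta>: "\<eta> \<in> ?\<Omega>"
    have "1 / (real n + 1) \<le> 1" by simp
    then show "\<bar>\<Psi> n \<eta>\<bar> \<le> K + 1" using err[OF \<eta>, of n] K[OF \<eta>] by linarith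
  next
    fix \<eta> assume \<eta>: "\<eta> \<in> ?\<Omega>"
    have "(\<lambda>n. \<Psi> n \<eta> - \<Phi> \<eta>) \<longlonglongrightarrow> 0"
    proof (rule Lim_null_comparison)
      show "eventually (\<lambda>n. norm (\<Psi> n \<eta> - \<Phi> \<eta>) \<le> 1 / (real n + 1)) sequentially"
        using err[OF \<eta>] by (intro always_eventually allI) simp
      show "(\<lambda>n. 1 / (real n + 1)) \<longlonglongrightarrow> 0" using LIMSEQ_Suc[OF lim_1_over_n] by (simp add: add.commute)
    qed
    then show "(\<lambda>n. \<Psi> n \<eta>) \<longlonglongrightarrow> \<Phi> \<eta>" by (simp add: LIM_zero_iff)
  qed
qed

text \<open>On a time interval so short that the energy estimate applies, any bound of the gap
  by the \<open>L\<^sup>2\<close> norm can be improved by a factor 2, because the gap of a cylinder functional is an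
  integral of gaps of \<open>w u \<cdot> b u\<close>.\<close>

lemma gap_improve:
  assumes tq: "0 \<le> t" "t \<le> q" "q \<le> T" "32 * C\<^sup>2 * (q - t) \<le> 1"
    and t: "\<And>\<Phi>. \<Phi> \<in> cyl t \<Longrightarrow> gap \<Phi> = 0" and k: "0 \<le> k"
    and bound: "\<And>\<Phi>. bdd_meas \<Phi> \<Longrightarrow> \<Phi> \<in> borel_measurable (path_filtration T q) \<Longrightarrow> (gap \<Phi>)\<^sup>2 \<le> k * sqn \<Phi>"
    and \<Phi>: "bdd_meas \<Phi>" "\<Phi> \<in> borel_measurable (path_filtration T q)"
  shows "(gap \<Phi>)\<^sup>2 \<le> k / 2 * sqn \<Phi>"
proof -
  have C4: "4 * C\<^sup>2 * (q - t) \<le> 1"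
  proof -
    have "0 \<le> C\<^sup>2 * (q - t)" using tq by simp
    then show ?thesis using tq(4) by linarith
  qed
  \<comment> \<open>For cylinder functionals the gain is a factor 8; a factor 4 of it is spent in
    the approximation at the end.\<close>
  have cyl: "(gap \<Psi>)\<^sup>2 \<le> k / 8 * sqn \<Psi>" if \<Psi>: "\<Psi> \<in> cyl q" for \<Psi>
  proof -
    obtain v w B where rep: "represents t q v w B" and vq: "v q = \<Psi>" and vt: "v t \<in> cyl t"
      using cyl_represents[OF tq(1-3) \<Psi>] by blast
    note rep' = rep[unfolded represents_def]
    note E1 = represents_energy[OF rep Q1 tq(2) C4] and E2 = represents_energy[OF rep Q2 tq(2) C4]
    have wb: "\<bar>w u \<eta>\<bar> \<le> B" if "u \<in> {t..q}" "\<eta> \<in> space (path_borel T)" for u \<eta>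
      using rep' that by auto
    have [measurable]: "(\<lambda>p. w (fst p) (snd p)) \<in> borel_measurable (borel \<Otimes>\<^sub>M path_borel T)"
      using rep' by (auto simp: case_prod_beta')
    have j: "(\<lambda>(u, \<eta>). w u \<eta> * b u \<eta>) \<in> borel_measurable (borel \<Otimes>\<^sub>M path_borel T)"
      unfolding case_prod_beta' by measurable
    have j1: "(\<lambda>(u, \<eta>). w u \<eta> * b u \<eta>) \<in> borel_measurable (borel \<Otimes>\<^sub>M Q1)"
      unfolding gauss_solutionD(4)[OF Q1] by (rule j)
    have j2: "(\<lambda>(u, \<eta>). w u \<eta> * b u \<eta>) \<in> borel_measurable (borel \<Otimes>\<^sub>M Q2)"
      unfolding gauss_solutionD(4)[OF Q2] by (rule j)
    have wbb: "\<bar>w u \<eta> * b u \<eta>\<bar> \<le> B * C" if "u \<in> {t..q}" "\<eta> \<in> space (path_borel T)" for u \<eta>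
      using wb[OF that] b_bound[OF that(2)] by (rule abs_mult_le)
    have w_m: "w u \<in> borel_measurable (path_filtration T q)" if "u \<in> {t..q}" for u using rep' that by auto
    have w_bm: "bdd_meas (w u)" if "u \<in> {t..q}" for u
      using wb[OF that] measurable_path_filtration_path_borel[OF _ w_m[OF that]] T by (auto simp: bdd_meas_def)
    have b_m: "b u \<in> borel_measurable (path_filtration T q)" if "u \<in> {t..q}" for u
      using T \<Gamma> that by (intro measurable_drift) auto
    have b_bm: "bdd_meas (b u)" if "u \<in> {t..q}" for u
      using b_bound measurable_path_filtration_path_borel[OF _ b_m[OF that]] T by (auto simp: bdd_meas_def)
    define g where "g = (\<lambda>u. gap (\<lambda>\<eta>. w u \<eta> * b u \<eta>))"
    have gm: "g \<in> borel_measurable borel"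
      unfolding g_def gap_def
      by (intro borel_measurable_diff Q1.borel_measurable_lebesgue_integral Q2.borel_measurable_lebesgue_integral j1 j2)
    \<comment> \<open>The assumed bound enters here. Because \<Gamma> depends on the past,
      \<open>w u * b u\<close> is in general no cylinder functional, but it is a bounded functional
      of the path up to \<open>q\<close>.\<close>
    have g2: "(g u)\<^sup>2 \<le> k * C\<^sup>2 * ((\<integral>\<eta>. (w u \<eta>)\<^sup>2 \<partial>Q1) + (\<integral>\<eta>. (w u \<eta>)\<^sup>2 \<partial>Q2))" if u: "u \<in> {t..q}" for u
    proof -
      have "(g u)\<^sup>2 \<le> k * sqn (\<lambda>\<eta>. w u \<eta> * b u \<eta>)"
        unfolding g_def using w_m[OF u] b_m[OF u] by (intro bound bdd_meas_mult w_bm b_bm u) measurable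
      also have "\<dots> \<le> k * (C\<^sup>2 * sqn (w u))"
        using b_bound k by (intro mult_left_mono sqn_times w_bm b_bm u) auto
      finally show ?thesis by (simp add: sqn_def mult.assoc)
    qed
    have gb: "\<bar>g u\<bar> \<le> 2 * (B * C)" if u: "t < u" "u \<le> q" for u
    proof -
      have i: "integrable Q1 (\<lambda>\<eta>. w u \<eta> * b u \<eta>)" "integrable Q2 (\<lambda>\<eta>. w u \<eta> * b u \<eta>)"
        using u by (auto intro!: bdd_meas_integrable bdd_meas_mult w_bm b_bm)
      have "\<bar>\<integral>\<eta>. w u \<eta> * b u \<eta> \<partial>Q1\<bar> \<le> B * C"
        using i wbb u by (intro Q1.abs_expectation_le) auto
      moreover have "\<bar>\<integral>\<eta>. w u \<eta> * b u \<eta> \<partial>Q2\<bar> \<le> B * C"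
        using i wbb u by (intro Q2.abs_expectation_le) auto
      ultimately show ?thesis unfolding g_def gap_def by linarith
    qed
    have "gap \<Psi> = gap (v q) - gap (v t)" using t[OF vt] vq by simp
    also have "\<dots> = ((\<integral>\<eta>. v q \<eta> \<partial>Q1) - (\<integral>\<eta>. v t \<eta> \<partial>Q1)) - ((\<integral>\<eta>. v q \<eta> \<partial>Q2) - (\<integral>\<eta>. v t \<eta> \<partial>Q2))"
      by (simp add: gap_def)
    also have "\<dots> = (LBINT u:{t<..q}. (\<integral>\<eta>. w u \<eta> * b u \<eta> \<partial>Q1)) - (LBINT u:{t<..q}. (\<integral>\<eta>. w u \<eta> * b u \<eta> \<partial>Q2))"
      using rep' Q1 Q2 tq by simp
    also have "\<dots> = (LBINT u:{t<..q}. g u)"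
      unfolding g_def gap_def using wbb
      by (intro set_integral_diff(2)[symmetric] time_fubini(1)[OF Q1.prob_space_axioms j1, where B="B * C"]
          time_fubini(1)[OF Q2.prob_space_axioms j2, where B="B * C"]) auto
    finally have "(gap \<Psi>)\<^sup>2 \<le> (q - t) * (LBINT u:{t<..q}. (g u)\<^sup>2)"
      using set_integral_square_le[OF tq(2) gm gb] by simp
    also have "(LBINT u:{t<..q}. (g u)\<^sup>2) \<le>
      (LBINT u:{t<..q}. k * C\<^sup>2 * ((\<integral>\<eta>. (w u \<eta>)\<^sup>2 \<partial>Q1) + (\<integral>\<eta>. (w u \<eta>)\<^sup>2 \<partial>Q2)))"
    proof (rule set_integral_mono)
      show "set_integrable lborel {t<..q} (\<lambda>u. (g u)\<^sup>2)"
      proof (rule set_integrable_bounded)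
        show "(\<lambda>u. (g u)\<^sup>2) \<in> borel_measurable borel" using gm by measurable
        show "\<bar>(g u)\<^sup>2\<bar> \<le> (2 * (B * C)) * (2 * (B * C))" if "t < u" "u \<le> q" for u
          unfolding power2_eq_square by (rule abs_mult_le[OF gb[OF that] gb[OF that]])
      qed
      show "set_integrable lborel {t<..q} (\<lambda>u. k * C\<^sup>2 * ((\<integral>\<eta>. (w u \<eta>)\<^sup>2 \<partial>Q1) + (\<integral>\<eta>. (w u \<eta>)\<^sup>2 \<partial>Q2)))"
        using E1(2) E2(2) by (intro set_integrable_mult_right set_integral_add(1)) auto
    qed (use g2 in auto)
    also have "\<dots> = k * C\<^sup>2 * ((LBINT u:{t<..q}. (\<integral>\<eta>. (w u \<eta>)\<^sup>2 \<partial>Q1)) + (LBINT u:{t<..q}. (\<integral>\<eta>. (w u \<eta>)\<^sup>2 \<partial>Q2)))"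
      using E1(2) E2(2) by (simp add: set_integral_add)
    also have "\<dots> \<le> k * C\<^sup>2 * (4 * sqn \<Psi>)"
      using E1(1) E2(1) k by (intro mult_left_mono) (auto simp: sqn_def vq)
    finally have "(gap \<Psi>)\<^sup>2 \<le> (q - t) * (k * C\<^sup>2 * (4 * sqn \<Psi>))" using tq by (simp add: mult_left_mono)
    \<comment> \<open>The 4 of the energy estimate times the desired gain 8.\<close>
    also have "\<dots> = (32 * C\<^sup>2 * (q - t)) * (k / 8 * sqn \<Psi>)" by simp
    also have "\<dots> \<le> 1 * (k / 8 * sqn \<Psi>)" using tq(4) k sqn_nonneg by (intro mult_right_mono) auto
    finally show ?thesis by simp
  qed
  have le: "(x + y)\<^sup>2 \<le> 2 * x\<^sup>2 + 2 * y\<^sup>2" for x y :: real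
    using zero_le_power2[of "x - y"] by (simp add: power2_eq_square algebra_simps)
  obtain K where "\<And>\<eta>. \<eta> \<in> space (path_borel T) \<Longrightarrow> \<bar>\<Phi> \<eta>\<bar> \<le> K" using bdd_measE[OF \<Phi>(1)] by blast
  then have cyl_closure: "\<Phi> \<in> cyl_closure q" using tq \<Phi> by (intro cyl_closure_measurable) auto
  have "(gap \<Phi>)\<^sup>2 \<le> k / 2 * sqn \<Phi> + e" if e: "0 < e" for e
  proof -
    \<comment> \<open>\<open>k / 2 + 4\<close> is the total factor of the approximation error below:
      \<open>k / 2\<close> through \<open>sqn \<Psi>\<close> and 4 through the crude bound on the
      gap of the difference.\<close>
    define d where "d = e / (k / 2 + 4)"
    have d: "0 < d" "(k / 2 + 4) * d = e" using e k by (auto simp: d_def)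
    obtain \<Psi> where \<Psi>: "\<Psi> \<in> cyl q" "sqn (\<lambda>\<eta>. \<Phi> \<eta> - \<Psi> \<eta>) < d" using cyl_closureD[OF cyl_closure d(1)] by blast
    have \<Psi>b: "bdd_meas \<Psi>" using bdd_meas_cyl[OF \<Psi>(1) tq(3)] .
    have sq: "sqn \<Psi> \<le> 2 * sqn \<Phi> + 2 * sqn (\<lambda>\<eta>. \<Phi> \<eta> - \<Psi> \<eta>)"
    proof -
      have "sqn \<Psi> = sqn (\<lambda>\<eta>. \<Phi> \<eta> + (\<Psi> \<eta> - \<Phi> \<eta>))" by simp
      also have "\<dots> \<le> 2 * sqn \<Phi> + 2 * sqn (\<lambda>\<eta>. \<Psi> \<eta> - \<Phi> \<eta>)" using \<Phi>(1) \<Psi>b by (intro sqn_add bdd_meas_diff)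
      also have "sqn (\<lambda>\<eta>. \<Psi> \<eta> - \<Phi> \<eta>) = sqn (\<lambda>\<eta>. \<Phi> \<eta> - \<Psi> \<eta>)" by (simp add: sqn_def power2_commute)
      finally show ?thesis .
    qed
    have "(gap \<Phi>)\<^sup>2 = (gap \<Psi> + gap (\<lambda>\<eta>. \<Phi> \<eta> - \<Psi> \<eta>))\<^sup>2" using gap_diff[OF \<Phi>(1) \<Psi>b] by simp
    also have "\<dots> \<le> 2 * (gap \<Psi>)\<^sup>2 + 2 * (gap (\<lambda>\<eta>. \<Phi> \<eta> - \<Psi> \<eta>))\<^sup>2" by (rule le)
    also have "\<dots> \<le> 2 * (k / 8 * sqn \<Psi>) + 2 * (2 * sqn (\<lambda>\<eta>. \<Phi> \<eta> - \<Psi> \<eta>))"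
      using cyl[OF \<Psi>(1)] gap_square_le[OF bdd_meas_diff[OF \<Phi>(1) \<Psi>b]] by (intro add_mono mult_left_mono) auto
    also have "\<dots> \<le> 2 * (k / 8 * (2 * sqn \<Phi> + 2 * sqn (\<lambda>\<eta>. \<Phi> \<eta> - \<Psi> \<eta>))) + 2 * (2 * sqn (\<lambda>\<eta>. \<Phi> \<eta> - \<Psi> \<eta>))"
      using sq k by (intro add_right_mono mult_left_mono) auto
    also have "\<dots> = k / 2 * sqn \<Phi> + (k / 2 + 4) * sqn (\<lambda>\<eta>. \<Phi> \<eta> - \<Psi> \<eta>)" by (simp add: algebra_simps)
    also have "\<dots> \<le> k / 2 * sqn \<Phi> + (k / 2 + 4) * d" using \<Psi>(2) k by (intro add_left_mono mult_left_mono) auto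
    finally show ?thesis using d by simp
  qed
  then show ?thesis by (rule field_le_epsilon)
qed

section \<open>From short intervals to the whole law\<close>

text \<open>Iterating the improvement from the bound with constant 2 gives
  \<open>2 * (1 / 2) ^ n\<close> for every \<open>n\<close>.\<close>

lemma gap_step:
  assumes tq: "0 \<le> t" "t \<le> q" "q \<le> T" "32 * C\<^sup>2 * (q - t) \<le> 1"
    and t: "\<And>\<Phi>. \<Phi> \<in> cyl t \<Longrightarrow> gap \<Phi> = 0"
    and \<Phi>: "bdd_meas \<Phi>" "\<Phi> \<in> borel_measurable (path_filtration T q)"
  shows "gap \<Phi> = 0"
proof -
  have "(gap \<Psi>)\<^sup>2 \<le> 2 * (1 / 2) ^ n * sqn \<Psi>" if "bdd_meas \<Psi>" "\<Psi> \<in> borel_measurable (path_filtration T q)" for n \<Psi>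
    using that
  proof (induction n arbitrary: \<Psi>)
    case 0
    then show ?case using gap_square_le by simp
  next
    case (Suc n)
    have "(gap \<Psi>)\<^sup>2 \<le> (2 * (1 / 2) ^ n) / 2 * sqn \<Psi>"
      by (rule gap_improve[OF tq t _ Suc.IH Suc.prems]) auto
    then show ?case by simp
  qed
  from this[OF \<Phi>] have "\<And>n. (gap \<Phi>)\<^sup>2 \<le> 2 * (1 / 2) ^ n * sqn \<Phi>" .
  moreover have "(\<lambda>n. 2 * (1 / 2) ^ n * sqn \<Phi>) \<longlonglongrightarrow> 2 * 0 * sqn \<Phi>"
    by (intro tendsto_intros LIMSEQ_power_zero) auto
  ultimately have "(gap \<Phi>)\<^sup>2 \<le> 2 * 0 * sqn \<Phi>" by (intro LIMSEQ_le_const) auto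
  then show ?thesis by simp
qed

text \<open>The admissible step length depends only on \<open>C\<close>, so finitely many equal
  steps suffice. One step hands over to the next only that the gap vanishes on cylinder
  functionals.\<close>

lemma gap_zero:
  assumes 0: "\<And>\<Phi>. \<Phi> \<in> cyl 0 \<Longrightarrow> gap \<Phi> = 0" and \<Phi>: "bdd_meas \<Phi>"
  shows "gap \<Phi> = 0"
proof -
  obtain n :: nat where n: "32 * C\<^sup>2 * T < real n" using reals_Archimedean2 by blast
  have n0: "0 < real n"
  proof -
    have "0 \<le> 32 * C\<^sup>2 * T" using T by simp
    then show ?thesis using n by linarith
  qed
  define \<tau> where "\<tau> = (\<lambda>i :: nat. real i * (T / real n))"
  have \<tau>n: "\<tau> n = T" using n0 by (simp add: \<tau>_def)
  have st: "gap \<Psi> = 0" if "i < n" "\<And>\<Phi>. \<Phi> \<in> cyl (\<tau> i) \<Longrightarrow> gap \<Phi> = 0"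
    "bdd_meas \<Psi>" "\<Psi> \<in> borel_measurable (path_filtration T (\<tau> (Suc i)))" for i \<Psi>
  proof (rule gap_step[OF _ _ _ _ that(2-4)])
    show "0 \<le> \<tau> i" "\<tau> i \<le> \<tau> (Suc i)" using T n0 by (auto simp: \<tau>_def field_simps)
    have "real (Suc i) \<le> real n" using that(1) by simp
    then have "real (Suc i) * (T / real n) \<le> real n * (T / real n)" using T n0 by (intro mult_right_mono) auto
    then show "\<tau> (Suc i) \<le> T" using n0 by (simp add: \<tau>_def)
    have "\<tau> (Suc i) - \<tau> i = T / real n" by (simp add: \<tau>_def algebra_simps add_divide_distrib)
    then show "32 * C\<^sup>2 * (\<tau> (Suc i) - \<tau> i) \<le> 1" using n n0 by simp
  qed
  have cyl0: "\<forall>\<Psi>\<in>cyl (\<tau> i). gap \<Psi> = 0" if "i < n" for i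
    using that
  proof (induction i)
    case 0
    then show ?case using assms(1) by (simp add: \<tau>_def)
  next
    case (Suc i)
    have "real (Suc i) * (T / real n) \<le> real n * (T / real n)" using T n0 Suc.prems by (intro mult_right_mono) auto
    then have le: "\<tau> (Suc i) \<le> T" using n0 by (simp add: \<tau>_def)
    show ?case
    proof
      fix \<Psi> assume "\<Psi> \<in> cyl (\<tau> (Suc i))"
      then have "bdd_meas \<Psi>" "\<Psi> \<in> borel_measurable (path_filtration T (\<tau> (Suc i)))"
        using le bdd_meas_cyl cyl_measurable by blast+
      moreover have "gap \<Phi> = 0" if "\<Phi> \<in> cyl (\<tau> i)" for \<Phi>
        using Suc that by simp
      ultimately show "gap \<Psi> = 0" using Suc.prems st[of i \<Psi>] by simp
    qed
  qed
  \<comment> \<open>The last step is taken separately, for its conclusion on all bounded functionals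
    of the path up to \<open>T\<close>.\<close>
  obtain i where i: "n = Suc i" using n0 by (cases n) auto
  have m: "\<Phi> \<in> borel_measurable (path_filtration T (\<tau> (Suc i)))"
  proof -
    have "measurable (path_filtration T T) borel = measurable (path_borel T) (borel :: real measure)"
      using T by (intro measurable_cong_sets sets_path_filtration_T) auto
    then show ?thesis using \<Phi> by (simp only: bdd_meas_def i[symmetric] \<tau>n)
  qed
  have "i < n" by (simp add: i)
  then show ?thesis by (rule st[OF _ _ \<Phi> m]) (use cyl0[OF \<open>i < n\<close>] in blast)
qed

lemma solutions_eq:
  assumes "\<And>\<Phi>. \<Phi> \<in> cyl 0 \<Longrightarrow> gap \<Phi> = 0"
  shows "Q1 = Q2"
proof (rule measure_eqI)
  show "sets Q1 = sets Q2" using gauss_solutionD(2)[OF Q1] gauss_solutionD(2)[OF Q2] by simp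
  fix A assume "A \<in> sets Q1"
  then have A: "A \<in> sets (path_borel T)" using gauss_solutionD(2)[OF Q1] by simp
  then have "bdd_meas (indicator A)" by (auto simp: bdd_meas_def indicator_def intro!: exI[of _ 1])
  then have "gap (indicator A) = 0" using gap_zero[of "indicator A"] assms by blast
  moreover have "A \<subseteq> space (path_borel T)" using sets.sets_into_space[OF A] .
  ultimately have "measure Q1 A = measure Q2 A" by (simp add: gap_def Int_absorb2 Int_absorb1)
  then show "emeasure Q1 A = emeasure Q2 A" by (simp add: Q1.emeasure_eq_measure Q2.emeasure_eq_measure)
qed

end

text \<open>At time 0 the only possible evaluation is the initial value, so a common starting point
  starts the recursion over the steps.\<close>

lemma cyl_0_cong: "\<Phi> \<in> cyl 0 \<Longrightarrow> \<eta> 0 = \<zeta> 0 \<Longrightarrow> \<Phi> \<eta> = \<Phi> \<zeta>"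
proof (induction rule: cyl.induct)
  case (add S c \<Phi> a)
  have "cexp S c \<eta> = cexp S c \<zeta>"
    unfolding cexp_def using add.hyps(2) add.prems by (intro arg_cong[of _ _ "\<lambda>x. exp (- x)"] sum.cong) auto
  then show ?case using add by simp
qed simp

theorem proposition4p11:
  fixes T \<delta> x0 :: real
    and \<Gamma> :: "real \<times> (real \<Rightarrow> real) \<Rightarrow> real"
    and P1 :: "'a measure" and X1 :: "real \<Rightarrow> 'a \<Rightarrow> real"
    and P2 :: "'b measure" and X2 :: "real \<Rightarrow> 'b \<Rightarrow> real"
  assumes "0 < T" and "0 \<le> \<delta>" and "\<delta> \<le> 1"
    and "\<Gamma> \<in> borel_measurable (stopped_paths_borel T)"
    and "\<exists>C. \<forall>p\<in>stopped_paths T. \<bar>\<Gamma> p\<bar> \<le> C"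
    and "0 \<le> x0"
    and "solves_martingale_problem T \<delta> \<Gamma> x0 P1 X1"
    and "solves_martingale_problem T \<delta> \<Gamma> x0 P2 X2"
  shows "path_law T P1 X1 = path_law T P2 X2"
proof -
  obtain C0 where C0: "\<forall>p\<in>stopped_paths T. \<bar>\<Gamma> p\<bar> \<le> C0" using assms(5) by blast
  \<comment> \<open>The bound is enlarged to be positive, as the locale requires.\<close>
  interpret bounded_drift T \<delta> "max C0 1" \<Gamma>
    by unfold_locales (use assms C0 in \<open>auto intro: max.coboundedI1\<close>)
  \<comment> \<open>Stated for an arbitrary sample space, since the two solutions live on different
    types.\<close>
  have law: "AE \<eta> in path_law T P X. Pr (\<eta> s)"
    if sol: "solves_martingale_problem T \<delta> \<Gamma> x0 P X" and s: "s \<in> {0..T}"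
      and Pr: "AE \<omega> in P. Pr (X s \<omega>)" "Measurable.pred borel Pr"
    for P :: "'c measure" and X :: "real \<Rightarrow> 'c \<Rightarrow> real" and s and Pr :: "real \<Rightarrow> bool"
  proof -
    have X: "\<And>t. t \<in> {0..T} \<Longrightarrow> X t \<in> borel_measurable P"
      "\<And>\<omega>. \<omega> \<in> space P \<Longrightarrow> continuous_on {0..T} (\<lambda>t. X t \<omega>)"
      using sol by (auto simp: solves_martingale_problem_def)
    have S: "sample_path T X \<in> measurable P (path_borel T)"
    proof (rule measurable_path_borel)
      fix u assume "u \<in> {0..T}"
      then show "(\<lambda>\<omega>. sample_path T X \<omega> u) \<in> borel_measurable P" using X(1)[of u] by (simp add: sample_path_def)
    qed (use assms(1) sample_path_in_mspace[OF X(2)] in auto)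
    have [measurable]: "(\<lambda>\<eta>. \<eta> s) \<in> borel_measurable (path_borel T)"
      using assms(1) s by (intro measurable_path_eval) auto
    have "{\<eta> \<in> space (path_borel T). Pr (\<eta> s)} \<in> sets (path_borel T)" using Pr(2) by measurable
    then show ?thesis
      unfolding path_law_def using Pr(1) s by (subst AE_distr_iff[OF S]) (auto simp: sample_path_def)
  qed
  interpret two_solutions T \<delta> "max C0 1" \<Gamma> "path_law T P1 X1" "path_law T P2 X2"
  proof unfold_locales
    show "gauss_solution (path_law T P1 X1)" by (rule gauss_solution_path_law[OF assms(7,6)])
    show "gauss_solution (path_law T P2 X2)" by (rule gauss_solution_path_law[OF assms(8,6)])
    fix s assume s: "s \<in> {0..T}"
    show "AE \<eta> in path_law T P1 X1. 0 \<le> \<eta> s"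
      by (rule law[OF assms(7) s]) (use assms(7) s in \<open>auto simp: solves_martingale_problem_def intro!: AE_I2\<close>)
    show "AE \<eta> in path_law T P2 X2. 0 \<le> \<eta> s"
      by (rule law[OF assms(8) s]) (use assms(8) s in \<open>auto simp: solves_martingale_problem_def intro!: AE_I2\<close>)
  qed
  show ?thesis
  proof (rule solutions_eq)
    fix \<Phi> assume \<Phi>: "\<Phi> \<in> cyl 0"
    have bdd_meas: "bdd_meas \<Phi>" using bdd_meas_cyl[OF \<Phi>] assms(1) by simp
    have start: "AE \<eta> in path_law T P1 X1. \<eta> 0 = x0" "AE \<eta> in path_law T P2 X2. \<eta> 0 = x0"
      using law[OF assms(7), of 0 "\<lambda>x. x = x0"] law[OF assms(8), of 0 "\<lambda>x. x = x0"] assms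
      by (auto simp: solves_martingale_problem_def)
    \<comment> \<open>The constant function \<open>\<lambda>_. x0\<close> is not extensional and
      hence no element of path space; it serves because \<Phi> reads only the value at 0.\<close>
    have "(\<integral>\<eta>. \<Phi> \<eta> \<partial>path_law T P1 X1) = (\<integral>\<eta>. \<Phi> (\<lambda>_. x0) \<partial>path_law T P1 X1)"
    proof (rule integral_cong_AE)
      show "AE \<eta> in path_law T P1 X1. \<Phi> \<eta> = \<Phi> (\<lambda>_. x0)"
        using start(1) by eventually_elim (rule cyl_0_cong[OF \<Phi>])
    qed (use bdd_meas_integrable[OF bdd_meas] in auto)
    moreover have "(\<integral>\<eta>. \<Phi> \<eta> \<partial>path_law T P2 X2) = (\<integral>\<eta>. \<Phi> (\<lambda>_. x0) \<partial>path_law T P2 X2)"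
    proof (rule integral_cong_AE)
      show "AE \<eta> in path_law T P2 X2. \<Phi> \<eta> = \<Phi> (\<lambda>_. x0)"
        using start(2) by eventually_elim (rule cyl_0_cong[OF \<Phi>])
    qed (use bdd_meas_integrable[OF bdd_meas] in auto)
    ultimately show "gap \<Phi> = 0" 
      by (simp add: gap_def Q1.prob_space[simplified] Q2.prob_space[simplified])
  qed
qed

end
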